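(* If $\mathbf{C}$ and $\mathbf{D}$ are strict (2,1)-categories, then a morphism of simplicial sets $\mathrm{N}_{(2,1)}\mathbf{C} \to \mathrm{N}_{(2,1)}\mathbf{D}$ can be identified with a normal pseudofunctor $\mathbf{C} \to \mathbf{D}$.
   Context: A strict 2-category is a category enriched in categories; a strict (2,1)-category is a category enriched in groupoids (regarded as a strict 2-category). A normal oplax functor $F\colon\mathbf{C}\to\mathbf{D}$ of strict 2-categories consists of: (a) for each object $x\in\mathbf{C}$ an object $F(x)\in\mathbf{D}$; (b) for each 1-morphism $f\colon x\to y$ a 1-morphism $F(f)\colon F(x)\to F(y)$; (c) for each 2-morphism $\phi\colon f\Rightarrow g$ in $\mathbf{C}(x,y)$ a 2-morphism $F(\phi)\colon F(f)\Rightarrow F(g)$; (d) for each composable pair $f\colon x\to y$, $g\colon y\to z$ a 2-morphism $\eta_{f,g}\colon F(g\circ f)\Rightarrow F(g)\circ F(f)$; such that: (i) $F(\mathrm{id}_x)=\mathrm{id}_{F(x)}$; (ii) $F(\mathrm{id}_f)=\mathrm{id}_{F(f)}$; (iii) $F(\psi\circ\phi)=F(\psi)\circ F(\phi)$ for vertically composable 2-morphisms; (iv) $\eta_{\mathrm{id}_x,f}=\mathrm{id}_{F(f)}=\eta_{f,\mathrm{id}_y}$ for every $f\colon x\to y$; (v) for $\phi\colon f\Rightarrow f'$ in $\mathbf{C}(x,y)$ and $\psi\colon g\Rightarrow g'$ in $\mathbf{C}(y,z)$, with $\psi\circ\phi$ the horizontal composite, $\eta_{f',g'}\cdot F(\psi\circ\phi)=(F(\psi)\circ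 F(\phi))\cdot\eta_{f,g}$; (vi) for composable $f,g,h$, $(\eta_{g,h}\circ\mathrm{id}_{F(f)})\cdot\eta_{f,h\circ g}=(\mathrm{id}_{F(h)}\circ\eta_{f,g})\cdot\eta_{g\circ f,h}$ as 2-morphisms $F(h\circ g\circ f)\Rightarrow F(h)\circ F(g)\circ F(f)$. It is a normal pseudofunctor if all $\eta_{f,g}$ are isomorphisms. The nerve (Duskin nerve): let $P_{i,j}$ be the partially ordered set (under inclusion) of subsets of $\{i,i+1,\dots,j\}$ containing $i$ and $j$. Let $\mathrm{C}_2(\Delta^n)$ be the strict 2-category with objects $0,\dots,n$, with $\mathrm{C}_2(\Delta^n)(i,j)$ empty if $i>j$ and $P_{i,j}$ otherwise, with composition given by union. For a strict 2-category $\mathbf{C}$, $\mathrm{N}_2\mathbf{C}$ is the simplicial set whose $n$-simplices are the strict 2-functors $\mathrm{C}_2(\Delta^n)\to\mathbf{C}$ (equivalently, the coherent nerve of the simplicial category obtained by applying the ordinary nerve to all mapping categories). $\mathrm{N}_{(2,1)}$ is the restriction of $\mathrm{N}_2$ to strict (2,1)-categories. In low degrees: 0-simplices are objects, 1-simplices are 1-morphisms, and a 2-simplex consists of 1-morphisms $f_{01}\colon x_0\to x_1$, $f_{12}\colon x_1\to x_2$, $f_{02}\colon x_0\to x_2$ and a 2-morphism $f_{02}\Rightarrow f_{12}\circ f_{01}$. "Can be identified" means there is a natural bijection between simplicial maps and normal pseudofunctors, under which a simplicial map acts on 0-simplices and 1-simplices as the normal pseudofunctor acts on objects and 1-morphisms,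 with $F$ on 2-morphisms given by the values on 2-simplices $f_{02}\Rightarrow \mathrm{id}\circ f_{01}$ with $f_{12}$ an identity and $\eta_{f,g}$ given by the value on the 2-simplex with identity 2-morphism $g\circ f\Rightarrow g\circ f$. *)

theory Defs
  imports "HOL-Library.FuncSet"
begin

section \<open>Categories and functors\<close>

text \<open>\<open>Comp A q p\<close> is the composite of \<open>p\<close> followed by \<open>q\<close>.\<close>

record ('a, 'b) category =
  Obj :: "'a set"
  Arr :: "'b set"
  Dom :: "'b \<Rightarrow> 'a"
  Cod :: "'b \<Rightarrow> 'a"
  Ident :: "'a \<Rightarrow> 'b"
  Comp :: "'b \<Rightarrow> 'b \<Rightarrow> 'b"

locale is_category =
  fixes A :: "('a, 'b) category"
  assumes Dom_Obj: "p \<in> Arr A \<Longrightarrow> Dom A p \<in> Obj A"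
    and Cod_Obj: "p \<in> Arr A \<Longrightarrow> Cod A p \<in> Obj A"
    and Ident_Arr: "a \<in> Obj A \<Longrightarrow> Ident A a \<in> Arr A"
    and Dom_Ident: "a \<in> Obj A \<Longrightarrow> Dom A (Ident A a) = a"
    and Cod_Ident: "a \<in> Obj A \<Longrightarrow> Cod A (Ident A a) = a"
    and Comp_Arr: "\<lbrakk>p \<in> Arr A; q \<in> Arr A; Cod A p = Dom A q\<rbrakk> \<Longrightarrow> Comp A q p \<in> Arr A"
    and Dom_Comp: "\<lbrakk>p \<in> Arr A; q \<in> Arr A; Cod A p = Dom A q\<rbrakk> \<Longrightarrow> Dom A (Comp A q p) = Dom A p"
    and Cod_Comp: "\<lbrakk>p \<in> Arr A; q \<in> Arr A; Cod A p = Dom A q\<rbrakk> \<Longrightarrow> Cod A (Comp A q p) = Cod A q"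
    and Comp_Ident_right: "p \<in> Arr A \<Longrightarrow> Comp A p (Ident A (Dom A p)) = p"
    and Comp_Ident_left: "p \<in> Arr A \<Longrightarrow> Comp A (Ident A (Cod A p)) p = p"
    and Comp_assoc: "\<lbrakk>p \<in> Arr A; q \<in> Arr A; r \<in> Arr A; Cod A p = Dom A q; Cod A q = Dom A r\<rbrakk>
      \<Longrightarrow> Comp A r (Comp A q p) = Comp A (Comp A r q) p"

definition is_iso :: "('a, 'b) category \<Rightarrow> 'b \<Rightarrow> bool" where
  "is_iso A p \<longleftrightarrow> p \<in> Arr A \<and>
    (\<exists>q\<in>Arr A. Dom A q = Cod A p \<and> Cod A q = Dom A p \<and>
       Comp A q p = Ident A (Dom A p) \<and> Comp A p q = Ident A (Cod A p))"

locale is_groupoid = is_category +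
  assumes all_iso: "p \<in> Arr A \<Longrightarrow> is_iso A p"

locale is_functor =
  fixes A :: "('a, 'b) category" and B :: "('c, 'd) category"
    and F :: "'a \<Rightarrow> 'c" and G :: "'b \<Rightarrow> 'd"
  assumes map_Obj: "a \<in> Obj A \<Longrightarrow> F a \<in> Obj B"
    and map_Arr: "p \<in> Arr A \<Longrightarrow> G p \<in> Arr B"
    and map_Dom: "p \<in> Arr A \<Longrightarrow> Dom B (G p) = F (Dom A p)"
    and map_Cod: "p \<in> Arr A \<Longrightarrow> Cod B (G p) = F (Cod A p)"
    and map_Ident: "a \<in> Obj A \<Longrightarrow> G (Ident A a) = Ident B (F a)"
    and map_Comp: "\<lbrakk>p \<in> Arr A; q \<in> Arr A; Cod A p = Dom A q\<rbrakk>
      \<Longrightarrow> G (Comp A q p) = Comp B (G q) (G p)"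

definition prod_category :: "('a, 'b) category \<Rightarrow> ('c, 'd) category \<Rightarrow> ('a \<times> 'c, 'b \<times> 'd) category" where
  "prod_category A B =
    \<lparr>Obj = Obj A \<times> Obj B,
     Arr = Arr A \<times> Arr B,
     Dom = map_prod (Dom A) (Dom B),
     Cod = map_prod (Cod A) (Cod B),
     Ident = map_prod (Ident A) (Ident B),
     Comp = (\<lambda>(q, q') (p, p'). (Comp A q p, Comp B q' p'))\<rparr>"

definition poset_category :: "'a set set \<Rightarrow> ('a set, 'a set \<times> 'a set) category" where
  "poset_category P =
    \<lparr>Obj = P,
     Arr = {(S, T). S \<in> P \<and> T \<in> P \<and> S \<subseteq> T},
     Dom = fst,
     Cod = snd,
     Ident = (\<lambda>S. (S, S)),
     Comp = (\<lambda>q p. (fst p, snd q))\<rparr>"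


section \<open>Strict 2-categories\<close>

text \<open>
  1-morphisms are the objects and 2-morphisms the arrows of the mapping categories \<open>Hom C x y\<close>;
  \<open>Comp (Hom C x y)\<close> is vertical composition.  For \<open>f \<in> Hom C x y\<close> and \<open>g \<in> Hom C y z\<close> the
  composite \<open>g \<circ> f\<close> is \<open>Comp1 C x y z g f\<close>, and \<open>Comp2 C x y z\<close> is horizontal composition, also
  with the second factor written first.  Mapping categories of different pairs of objects need
  not be disjoint, which is why the compositions carry the objects as arguments.
\<close>

record ('o, 'm, 'c) two_category =
  Ob :: "'o set"
  Hom :: "'o \<Rightarrow> 'o \<Rightarrow> ('m, 'c) category"
  Unit :: "'o \<Rightarrow> 'm"
  Comp1 :: "'o \<Rightarrow> 'o \<Rightarrow> 'o \<Rightarrow> 'm \<Rightarrow> 'm \<Rightarrow> 'm"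
  Comp2 :: "'o \<Rightarrow> 'o \<Rightarrow> 'o \<Rightarrow> 'c \<Rightarrow> 'c \<Rightarrow> 'c"

abbreviation Unit2 :: "('o, 'm, 'c) two_category \<Rightarrow> 'o \<Rightarrow> 'c" where
  "Unit2 C x \<equiv> Ident (Hom C x x) (Unit C x)"

locale strict_2_category =
  fixes C :: "('o, 'm, 'c) two_category"
  assumes Hom_category: "\<lbrakk>x \<in> Ob C; y \<in> Ob C\<rbrakk> \<Longrightarrow> is_category (Hom C x y)"
    and Unit_Obj: "x \<in> Ob C \<Longrightarrow> Unit C x \<in> Obj (Hom C x x)"
    and Comp_functor: "\<lbrakk>x \<in> Ob C; y \<in> Ob C; z \<in> Ob C\<rbrakk> \<Longrightarrow>
      is_functor (prod_category (Hom C y z) (Hom C x y)) (Hom C x z)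
        (\<lambda>(g, f). Comp1 C x y z g f) (\<lambda>(\<psi>, \<phi>). Comp2 C x y z \<psi> \<phi>)"
    and Comp1_Unit_right: "\<lbrakk>x \<in> Ob C; y \<in> Ob C; f \<in> Obj (Hom C x y)\<rbrakk>
      \<Longrightarrow> Comp1 C x x y f (Unit C x) = f"
    and Comp1_Unit_left: "\<lbrakk>x \<in> Ob C; y \<in> Ob C; f \<in> Obj (Hom C x y)\<rbrakk>
      \<Longrightarrow> Comp1 C x y y (Unit C y) f = f"
    and Comp2_Unit_right: "\<lbrakk>x \<in> Ob C; y \<in> Ob C; \<phi> \<in> Arr (Hom C x y)\<rbrakk>
      \<Longrightarrow> Comp2 C x x y \<phi> (Unit2 C x) = \<phi>"
    and Comp2_Unit_left: "\<lbrakk>x \<in> Ob C; y \<in> Ob C; \<phi> \<in> Arr (Hom C x y)\<rbrakk>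
      \<Longrightarrow> Comp2 C x y y (Unit2 C y) \<phi> = \<phi>"
    and Comp1_assoc: "\<lbrakk>w \<in> Ob C; x \<in> Ob C; y \<in> Ob C; z \<in> Ob C;
        f \<in> Obj (Hom C w x); g \<in> Obj (Hom C x y); h \<in> Obj (Hom C y z)\<rbrakk>
      \<Longrightarrow> Comp1 C w x z (Comp1 C x y z h g) f = Comp1 C w y z h (Comp1 C w x y g f)"
    and Comp2_assoc: "\<lbrakk>w \<in> Ob C; x \<in> Ob C; y \<in> Ob C; z \<in> Ob C;
        \<phi> \<in> Arr (Hom C w x); \<psi> \<in> Arr (Hom C x y); \<chi> \<in> Arr (Hom C y z)\<rbrakk>
      \<Longrightarrow> Comp2 C w x z (Comp2 C x y z \<chi> \<psi>) \<phi> = Comp2 C w y z \<chi> (Comp2 C w x y \<psi> \<phi>)"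

locale strict_21_category = strict_2_category +
  assumes Hom_groupoid: "\<lbrakk>x \<in> Ob C; y \<in> Ob C\<rbrakk> \<Longrightarrow> is_groupoid (Hom C x y)"


section \<open>Strict 2-functors and normal pseudofunctors\<close>

record ('o, 'm, 'c, 'o2, 'm2, 'c2) two_map =
  obj_map :: "'o \<Rightarrow> 'o2"
  mor_map :: "'o \<Rightarrow> 'o \<Rightarrow> 'm \<Rightarrow> 'm2"
  cell_map :: "'o \<Rightarrow> 'o \<Rightarrow> 'c \<Rightarrow> 'c2"

text \<open>
  The maps are required to be \<open>undefined\<close> outside their domains, so that equality of records is
  equality of 2-functors.
\<close>

locale hom_functorial =
  fixes C :: "('o, 'm, 'c) two_category" and D :: "('o2, 'm2, 'c2) two_category"
    and F :: "('o, 'm, 'c, 'o2, 'm2, 'c2, 'z) two_map_scheme"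
  assumes obj_map_Ob: "x \<in> Ob C \<Longrightarrow> obj_map F x \<in> Ob D"
    and hom_functor: "\<lbrakk>x \<in> Ob C; y \<in> Ob C\<rbrakk> \<Longrightarrow>
      is_functor (Hom C x y) (Hom D (obj_map F x) (obj_map F y)) (mor_map F x y) (cell_map F x y)"
    and mor_map_Unit: "x \<in> Ob C \<Longrightarrow> mor_map F x x (Unit C x) = Unit D (obj_map F x)"
    and obj_map_undefined: "x \<notin> Ob C \<Longrightarrow> obj_map F x = undefined"
    and mor_map_undefined: "\<not> (x \<in> Ob C \<and> y \<in> Ob C \<and> f \<in> Obj (Hom C x y))
      \<Longrightarrow> mor_map F x y f = undefined"
    and cell_map_undefined: "\<not> (x \<in> Ob C \<and> y \<in> Ob C \<and> \<phi> \<in> Arr (Hom C x y))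
      \<Longrightarrow> cell_map F x y \<phi> = undefined"

locale strict_2_functor =
  hom_functorial C D F
  for C :: "('o, 'm, 'c) two_category" and D :: "('o2, 'm2, 'c2) two_category"
    and F :: "('o, 'm, 'c, 'o2, 'm2, 'c2) two_map" +
  assumes mor_map_Comp1: "\<lbrakk>x \<in> Ob C; y \<in> Ob C; z \<in> Ob C;
        f \<in> Obj (Hom C x y); g \<in> Obj (Hom C y z)\<rbrakk>
      \<Longrightarrow> mor_map F x z (Comp1 C x y z g f) =
        Comp1 D (obj_map F x) (obj_map F y) (obj_map F z) (mor_map F y z g) (mor_map F x y f)"
    and cell_map_Comp2: "\<lbrakk>x \<in> Ob C; y \<in> Ob C; z \<in> Ob C;
        \<phi> \<in> Arr (Hom C x y); \<psi> \<in> Arr (Hom C y z)\<rbrakk>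
      \<Longrightarrow> cell_map F x z (Comp2 C x y z \<psi> \<phi>) =
        Comp2 D (obj_map F x) (obj_map F y) (obj_map F z) (cell_map F y z \<psi>) (cell_map F x y \<phi>)"

text \<open>\<open>eta F x y z f g\<close> is \<open>\<eta>\<^bsub>f,g\<^esub> : F (g \<circ> f) \<Rightarrow> F g \<circ> F f\<close>, where \<open>f : x \<rightarrow> y\<close> and \<open>g : y \<rightarrow> z\<close>.\<close>

record ('o, 'm, 'c, 'o2, 'm2, 'c2) oplax_map = "('o, 'm, 'c, 'o2, 'm2, 'c2) two_map" +
  eta :: "'o \<Rightarrow> 'o \<Rightarrow> 'o \<Rightarrow> 'm \<Rightarrow> 'm \<Rightarrow> 'c2"

locale normal_oplax_functor =
  hom_functorial C D F
  for C :: "('o, 'm, 'c) two_category" and D :: "('o2, 'm2, 'c2) two_category"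
    and F :: "('o, 'm, 'c, 'o2, 'm2, 'c2) oplax_map" +
  assumes eta_Arr: "\<lbrakk>x \<in> Ob C; y \<in> Ob C; z \<in> Ob C; f \<in> Obj (Hom C x y); g \<in> Obj (Hom C y z)\<rbrakk>
      \<Longrightarrow> eta F x y z f g \<in> Arr (Hom D (obj_map F x) (obj_map F z))"
    and Dom_eta: "\<lbrakk>x \<in> Ob C; y \<in> Ob C; z \<in> Ob C; f \<in> Obj (Hom C x y); g \<in> Obj (Hom C y z)\<rbrakk>
      \<Longrightarrow> Dom (Hom D (obj_map F x) (obj_map F z)) (eta F x y z f g)
        = mor_map F x z (Comp1 C x y z g f)"
    and Cod_eta: "\<lbrakk>x \<in> Ob C; y \<in> Ob C; z \<in> Ob C; f \<in> Obj (Hom C x y); g \<in> Obj (Hom C y z)\<rbrakk>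
      \<Longrightarrow> Cod (Hom D (obj_map F x) (obj_map F z)) (eta F x y z f g)
        = Comp1 D (obj_map F x) (obj_map F y) (obj_map F z) (mor_map F y z g) (mor_map F x y f)"
    and eta_Unit_left: "\<lbrakk>x \<in> Ob C; y \<in> Ob C; f \<in> Obj (Hom C x y)\<rbrakk>
      \<Longrightarrow> eta F x x y (Unit C x) f = Ident (Hom D (obj_map F x) (obj_map F y)) (mor_map F x y f)"
    and eta_Unit_right: "\<lbrakk>x \<in> Ob C; y \<in> Ob C; f \<in> Obj (Hom C x y)\<rbrakk>
      \<Longrightarrow> eta F x y y f (Unit C y) = Ident (Hom D (obj_map F x) (obj_map F y)) (mor_map F x y f)"
    and eta_natural: "\<lbrakk>x \<in> Ob C; y \<in> Ob C; z \<in> Ob C;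
        \<phi> \<in> Arr (Hom C x y); Dom (Hom C x y) \<phi> = f; Cod (Hom C x y) \<phi> = f';
        \<psi> \<in> Arr (Hom C y z); Dom (Hom C y z) \<psi> = g; Cod (Hom C y z) \<psi> = g'\<rbrakk>
      \<Longrightarrow> Comp (Hom D (obj_map F x) (obj_map F z))
            (eta F x y z f' g') (cell_map F x z (Comp2 C x y z \<psi> \<phi>))
        = Comp (Hom D (obj_map F x) (obj_map F z))
            (Comp2 D (obj_map F x) (obj_map F y) (obj_map F z)
              (cell_map F y z \<psi>) (cell_map F x y \<phi>))
            (eta F x y z f g)"
    and eta_coherence: "\<lbrakk>w \<in> Ob C; x \<in> Ob C; y \<in> Ob C; z \<in> Ob C;
        f \<in> Obj (Hom C w x); g \<in> Obj (Hom C x y); h \<in> Obj (Hom C y z)\<rbrakk>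
      \<Longrightarrow> Comp (Hom D (obj_map F w) (obj_map F z))
            (Comp2 D (obj_map F w) (obj_map F x) (obj_map F z)
              (eta F x y z g h) (Ident (Hom D (obj_map F w) (obj_map F x)) (mor_map F w x f)))
            (eta F w x z f (Comp1 C x y z h g))
        = Comp (Hom D (obj_map F w) (obj_map F z))
            (Comp2 D (obj_map F w) (obj_map F y) (obj_map F z)
              (Ident (Hom D (obj_map F y) (obj_map F z)) (mor_map F y z h)) (eta F w x y f g))
            (eta F w y z (Comp1 C w x y g f) h)"
    and eta_undefined: "\<not> (x \<in> Ob C \<and> y \<in> Ob C \<and> z \<in> Ob C \<and>
        f \<in> Obj (Hom C x y) \<and> g \<in> Obj (Hom C y z)) \<Longrightarrow> eta F x y z f g = undefined"

locale normal_pseudofunctor = normal_oplax_functor +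
  assumes eta_iso: "\<lbrakk>x \<in> Ob C; y \<in> Ob C; z \<in> Ob C; f \<in> Obj (Hom C x y); g \<in> Obj (Hom C y z)\<rbrakk>
      \<Longrightarrow> is_iso (Hom D (obj_map F x) (obj_map F z)) (eta F x y z f g)"

text \<open>Composites \<open>G \<circ> F\<close> of 2-functors and of pseudofunctors with source \<open>C\<close>.\<close>

definition two_map_comp ::
  "('o, 'm, 'c) two_category \<Rightarrow> ('o2, 'm2, 'c2, 'o3, 'm3, 'c3) two_map
    \<Rightarrow> ('o, 'm, 'c, 'o2, 'm2, 'c2) two_map \<Rightarrow> ('o, 'm, 'c, 'o3, 'm3, 'c3) two_map" where
  "two_map_comp C G F =
    \<lparr>obj_map = (\<lambda>x\<in>Ob C. obj_map G (obj_map F x)),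
     mor_map = (\<lambda>x y f. if x \<in> Ob C \<and> y \<in> Ob C \<and> f \<in> Obj (Hom C x y)
       then mor_map G (obj_map F x) (obj_map F y) (mor_map F x y f) else undefined),
     cell_map = (\<lambda>x y \<phi>. if x \<in> Ob C \<and> y \<in> Ob C \<and> \<phi> \<in> Arr (Hom C x y)
       then cell_map G (obj_map F x) (obj_map F y) (cell_map F x y \<phi>) else undefined)\<rparr>"

definition pseudofunctor_comp ::
  "('o, 'm, 'c) two_category \<Rightarrow> ('o3, 'm3, 'c3) two_category
    \<Rightarrow> ('o2, 'm2, 'c2, 'o3, 'm3, 'c3) oplax_map \<Rightarrow> ('o, 'm, 'c, 'o2, 'm2, 'c2) oplax_map
    \<Rightarrow> ('o, 'm, 'c, 'o3, 'm3, 'c3) oplax_map" where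
  "pseudofunctor_comp C E G F =
    \<lparr>obj_map = (\<lambda>x\<in>Ob C. obj_map G (obj_map F x)),
     mor_map = (\<lambda>x y f. if x \<in> Ob C \<and> y \<in> Ob C \<and> f \<in> Obj (Hom C x y)
       then mor_map G (obj_map F x) (obj_map F y) (mor_map F x y f) else undefined),
     cell_map = (\<lambda>x y \<phi>. if x \<in> Ob C \<and> y \<in> Ob C \<and> \<phi> \<in> Arr (Hom C x y)
       then cell_map G (obj_map F x) (obj_map F y) (cell_map F x y \<phi>) else undefined),
     eta = (\<lambda>x y z f g. if x \<in> Ob C \<and> y \<in> Ob C \<and> z \<in> Ob C \<and>
         f \<in> Obj (Hom C x y) \<and> g \<in> Obj (Hom C y z)
       then Comp (Hom E (obj_map G (obj_map F x)) (obj_map G (obj_map F z)))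
         (eta G (obj_map F x) (obj_map F y) (obj_map F z) (mor_map F x y f) (mor_map F y z g))
         (cell_map G (obj_map F x) (obj_map F z) (eta F x y z f g))
       else undefined)\<rparr>"

definition strict_as_pseudofunctor ::
  "('o, 'm, 'c) two_category \<Rightarrow> ('o2, 'm2, 'c2) two_category
    \<Rightarrow> ('o, 'm, 'c, 'o2, 'm2, 'c2) two_map \<Rightarrow> ('o, 'm, 'c, 'o2, 'm2, 'c2) oplax_map" where
  "strict_as_pseudofunctor C D G =
    \<lparr>obj_map = obj_map G, mor_map = mor_map G, cell_map = cell_map G,
     eta = (\<lambda>x y z f g. if x \<in> Ob C \<and> y \<in> Ob C \<and> z \<in> Ob C \<and>
         f \<in> Obj (Hom C x y) \<and> g \<in> Obj (Hom C y z)
       then Ident (Hom D (obj_map G x) (obj_map G z)) (mor_map G x z (Comp1 C x y z g f))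
       else undefined)\<rparr>"


section \<open>Simplicial sets\<close>

definition Delta_maps :: "nat \<Rightarrow> nat \<Rightarrow> (nat \<Rightarrow> nat) set" where
  "Delta_maps m n = {\<alpha> \<in> {..m} \<rightarrow>\<^sub>E {..n}. mono_on {..m} \<alpha>}"

text \<open>\<open>Op X m n \<alpha>\<close> is the map \<open>\<alpha>\<^sup>* : X\<^sub>n \<rightarrow> X\<^sub>m\<close> induced by \<open>\<alpha> : [m] \<rightarrow> [n]\<close>.\<close>

record 's sset =
  Simp :: "nat \<Rightarrow> 's set"
  Op :: "nat \<Rightarrow> nat \<Rightarrow> (nat \<Rightarrow> nat) \<Rightarrow> 's \<Rightarrow> 's"

locale simplicial_set =
  fixes X :: "'s sset"
  assumes Op_Simp: "\<lbrakk>\<alpha> \<in> Delta_maps m n; a \<in> Simp X n\<rbrakk> \<Longrightarrow> Op X m n \<alpha> a \<in> Simp X m"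
    and Op_id: "a \<in> Simp X n \<Longrightarrow> Op X n n (\<lambda>i\<in>{..n}. i) a = a"
    and Op_comp: "\<lbrakk>\<alpha> \<in> Delta_maps l m; \<beta> \<in> Delta_maps m n; a \<in> Simp X n\<rbrakk>
      \<Longrightarrow> Op X l n (compose {..l} \<beta> \<alpha>) a = Op X l m \<alpha> (Op X m n \<beta> a)"

locale simplicial_map =
  X: simplicial_set X + Y: simplicial_set Y
  for X :: "'s sset" and Y :: "'t sset" +
  fixes \<sigma> :: "nat \<Rightarrow> 's \<Rightarrow> 't"
  assumes map_Simp: "\<sigma> n \<in> Simp X n \<rightarrow>\<^sub>E Simp Y n"
    and map_Op: "\<lbrakk>\<alpha> \<in> Delta_maps m n; a \<in> Simp X n\<rbrakk>
      \<Longrightarrow> \<sigma> m (Op X m n \<alpha> a) = Op Y m n \<alpha> (\<sigma> n a)"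

definition simplicial_map_comp ::
  "'s sset \<Rightarrow> (nat \<Rightarrow> 't \<Rightarrow> 'u) \<Rightarrow> (nat \<Rightarrow> 's \<Rightarrow> 't) \<Rightarrow> nat \<Rightarrow> 's \<Rightarrow> 'u" where
  "simplicial_map_comp X \<tau> \<sigma> = (\<lambda>n. compose (Simp X n) (\<tau> n) (\<sigma> n))"


section \<open>The nerve\<close>

definition P :: "nat \<Rightarrow> nat \<Rightarrow> nat set set" where
  "P i j = {S. S \<subseteq> {i..j} \<and> i \<in> S \<and> j \<in> S}"

type_synonym simplex_cell = "nat set \<times> nat set"

definition C2 :: "nat \<Rightarrow> (nat, nat set, simplex_cell) two_category" where
  "C2 n =
    \<lparr>Ob = {..n},
     Hom = (\<lambda>i j. poset_category (if i > j then {} else P i j)),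
     Unit = (\<lambda>i. {i}),
     Comp1 = (\<lambda>i j k T S. T \<union> S),
     Comp2 = (\<lambda>i j k q p. (fst q \<union> fst p, snd q \<union> snd p))\<rparr>"

definition C2_map :: "(nat \<Rightarrow> nat) \<Rightarrow> (nat, nat set, simplex_cell, nat, nat set, simplex_cell) two_map" where
  "C2_map \<alpha> =
    \<lparr>obj_map = \<alpha>,
     mor_map = (\<lambda>i j S. \<alpha> ` S),
     cell_map = (\<lambda>i j p. (\<alpha> ` fst p, \<alpha> ` snd p))\<rparr>"

type_synonym ('o, 'm, 'c) simplex = "(nat, nat set, simplex_cell, 'o, 'm, 'c) two_map"

definition nerve :: "('o, 'm, 'c) two_category \<Rightarrow> ('o, 'm, 'c) simplex sset" where
  "nerve C =
    \<lparr>Simp = (\<lambda>n. {a. strict_2_functor (C2 n) C a}),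
     Op = (\<lambda>m n \<alpha> a. two_map_comp (C2 m) a (C2_map \<alpha>))\<rparr>"

definition nerve_map ::
  "('o, 'm, 'c) two_category \<Rightarrow> ('o, 'm, 'c, 'o2, 'm2, 'c2) two_map
    \<Rightarrow> nat \<Rightarrow> ('o, 'm, 'c) simplex \<Rightarrow> ('o2, 'm2, 'c2) simplex" where
  "nerve_map C G = (\<lambda>n. \<lambda>a\<in>Simp (nerve C) n. two_map_comp (C2 n) G a)"

text \<open>
  The 0-simplex of an object, the 1-simplex of a 1-morphism \<open>f : x \<rightarrow> y\<close>, and the 2-simplex with
  \<open>f\<^bsub>01\<^esub> = f : x \<rightarrow> y\<close>, \<open>f\<^bsub>12\<^esub> = g : y \<rightarrow> z\<close>, \<open>f\<^bsub>02\<^esub> = h\<close> and \<open>\<phi> : h \<Rightarrow> g \<circ> f\<close>,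
  written out as 2-functors.
\<close>

definition vertex :: "('o, 'm, 'c) two_category \<Rightarrow> 'o \<Rightarrow> ('o, 'm, 'c) simplex" where
  "vertex C x =
    \<lparr>obj_map = (\<lambda>i\<in>{..0}. x),
     mor_map = (\<lambda>i j S. if i = 0 \<and> j = 0 \<and> S = {0} then Unit C x else undefined),
     cell_map = (\<lambda>i j p. if i = 0 \<and> j = 0 \<and> p = ({0}, {0}) then Unit2 C x else undefined)\<rparr>"

definition edge :: "('o, 'm, 'c) two_category \<Rightarrow> 'o \<Rightarrow> 'o \<Rightarrow> 'm \<Rightarrow> ('o, 'm, 'c) simplex" where
  "edge C x y f =
    \<lparr>obj_map = (\<lambda>i\<in>{..1}. if i = 0 then x else y),
     mor_map = (\<lambda>i j S.
       if i = 0 \<and> j = 0 \<and> S = {0} then Unit C x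
       else if i = 1 \<and> j = 1 \<and> S = {1} then Unit C y
       else if i = 0 \<and> j = 1 \<and> S = {0, 1} then f
       else undefined),
     cell_map = (\<lambda>i j p.
       if i = 0 \<and> j = 0 \<and> p = ({0}, {0}) then Unit2 C x
       else if i = 1 \<and> j = 1 \<and> p = ({1}, {1}) then Unit2 C y
       else if i = 0 \<and> j = 1 \<and> p = ({0, 1}, {0, 1}) then Ident (Hom C x y) f
       else undefined)\<rparr>"

definition triangle ::
  "('o, 'm, 'c) two_category \<Rightarrow> 'o \<Rightarrow> 'o \<Rightarrow> 'o \<Rightarrow> 'm \<Rightarrow> 'm \<Rightarrow> 'm \<Rightarrow> 'c \<Rightarrow> ('o, 'm, 'c) simplex" where
  "triangle C x y z f g h \<phi> =
    \<lparr>obj_map = (\<lambda>i\<in>{..2}. if i = 0 then x else if i = 1 then y else z),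
     mor_map = (\<lambda>i j S.
       if i = 0 \<and> j = 0 \<and> S = {0} then Unit C x
       else if i = 1 \<and> j = 1 \<and> S = {1} then Unit C y
       else if i = 2 \<and> j = 2 \<and> S = {2} then Unit C z
       else if i = 0 \<and> j = 1 \<and> S = {0, 1} then f
       else if i = 1 \<and> j = 2 \<and> S = {1, 2} then g
       else if i = 0 \<and> j = 2 \<and> S = {0, 2} then h
       else if i = 0 \<and> j = 2 \<and> S = {0, 1, 2} then Comp1 C x y z g f
       else undefined),
     cell_map = (\<lambda>i j p.
       if i = 0 \<and> j = 0 \<and> p = ({0}, {0}) then Unit2 C x
       else if i = 1 \<and> j = 1 \<and> p = ({1}, {1}) then Unit2 C y
       else if i = 2 \<and> j = 2 \<and> p = ({2}, {2}) then Unit2 C z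
       else if i = 0 \<and> j = 1 \<and> p = ({0, 1}, {0, 1}) then Ident (Hom C x y) f
       else if i = 1 \<and> j = 2 \<and> p = ({1, 2}, {1, 2}) then Ident (Hom C y z) g
       else if i = 0 \<and> j = 2 \<and> p = ({0, 2}, {0, 2}) then Ident (Hom C x z) h
       else if i = 0 \<and> j = 2 \<and> p = ({0, 1, 2}, {0, 1, 2})
         then Ident (Hom C x z) (Comp1 C x y z g f)
       else if i = 0 \<and> j = 2 \<and> p = ({0, 2}, {0, 1, 2}) then \<phi>
       else undefined)\<rparr>"


section \<open>From simplicial maps to pseudofunctors\<close>

text \<open>
  A 2-morphism \<open>\<phi> : f \<Rightarrow> g\<close> is regarded as the 2-simplex \<open>f \<Rightarrow> id \<circ> g\<close>, and \<open>\<eta>\<^bsub>f,g\<^esub>\<close> is read off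
  from the 2-simplex with identity 2-morphism \<open>g \<circ> f \<Rightarrow> g \<circ> f\<close>.
\<close>

definition pseudofunctor_of ::
  "('o, 'm, 'c) two_category \<Rightarrow> (nat \<Rightarrow> ('o, 'm, 'c) simplex \<Rightarrow> ('o2, 'm2, 'c2) simplex)
    \<Rightarrow> ('o, 'm, 'c, 'o2, 'm2, 'c2) oplax_map" where
  "pseudofunctor_of C \<sigma> =
    \<lparr>obj_map = (\<lambda>x\<in>Ob C. obj_map (\<sigma> 0 (vertex C x)) 0),
     mor_map = (\<lambda>x y f. if x \<in> Ob C \<and> y \<in> Ob C \<and> f \<in> Obj (Hom C x y)
       then mor_map (\<sigma> 1 (edge C x y f)) 0 1 {0, 1} else undefined),
     cell_map = (\<lambda>x y \<phi>. if x \<in> Ob C \<and> y \<in> Ob C \<and> \<phi> \<in> Arr (Hom C x y)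
       then cell_map
         (\<sigma> 2 (triangle C x y y (Cod (Hom C x y) \<phi>) (Unit C y) (Dom (Hom C x y) \<phi>) \<phi>))
         0 2 ({0, 2}, {0, 1, 2})
       else undefined),
     eta = (\<lambda>x y z f g. if x \<in> Ob C \<and> y \<in> Ob C \<and> z \<in> Ob C \<and>
         f \<in> Obj (Hom C x y) \<and> g \<in> Obj (Hom C y z)
       then cell_map
         (\<sigma> 2 (triangle C x y z f g (Comp1 C x y z g f) (Ident (Hom C x z) (Comp1 C x y z g f))))
         0 2 ({0, 2}, {0, 1, 2})
       else undefined)\<rparr>"

end

theory Submission
  imports Defs
begin

text \<open>
  An \<open>n\<close>-simplex of the nerve is determined by its objects, the 1-morphisms \<open>f\<^sub>i\<^sub>j\<close> of its edges and
  the 2-morphisms \<open>a\<^sub>i\<^sub>j\<^sub>k : f\<^sub>i\<^sub>k \<Rightarrow> f\<^sub>j\<^sub>k \<circ> f\<^sub>i\<^sub>j\<close> of its 2-dimensional faces, and such a family comes from a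
  simplex iff it satisfies one coherence equation for each 3-dimensional face.  A simplicial map is
  therefore determined by its values on triangles, and every 3-simplex of the source yields an
  equation in the target.  Degenerate 3-simplices give \<open>\<sigma>(f, g, \<chi>) = \<eta>\<^bsub>f,g\<^esub> \<cdot> F(\<chi>)\<close> for the triangle
  \<open>\<chi> : h \<Rightarrow> g \<circ> f\<close>, which yields injectivity, and the axioms of a pseudofunctor; conversely the
  right-hand side of this equation applied to the faces of a simplex is again a coherent family.
\<close>

text \<open>Families are indexed by weakly increasing indices and take prescribed values where
  indices coincide. A simplicial operator, injective or not, then acts by substituting indices, so
  equality of simplices and naturality reduce to comparing objects, edges and faces. Filling in the
  degenerate values is done once, in \<open>simplex_data_pad\<close>. The obstacle in building a
  simplex from a coherent family is that \<open>P i j\<close> has many maximal chains: defining the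
  2-morphism of an inclusion along a chain would require independence of the chain. But
  \<open>{i, j}\<close> is the least element of \<open>P i j\<close>, so it is enough to attach to
  each set one 2-morphism out of \<open>f i j\<close>, given by a fixed triangulation of a polygon.
  Any other cell compares two of these. In this construction coherence enters only through
  \<open>path_fan_append\<close>, which changes the triangulation. Laws of a pseudofunctor are
  extracted from tetrahedra in which some edges are units and some faces identities, chosen so that
  the one equation of the image becomes the desired law.\<close>

section \<open>Arrows with prescribed ends\<close>

text \<open>Compositions are total functions, so categorical laws carry side conditions on the ends
  of arrows. Bundled into one membership, these conditions chain by resolution like typing
  rules.\<close>

definition arrows :: "('a, 'b) category \<Rightarrow> 'a \<Rightarrow> 'a \<Rightarrow> 'b set" where
  "arrows A a b = {p \<in> Arr A. Dom A p = a \<and> Cod A p = b}"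

lemma arrowsI: "\<lbrakk>p \<in> Arr A; Dom A p = a; Cod A p = b\<rbrakk> \<Longrightarrow> p \<in> arrows A a b"
  by (simp add: arrows_def)

lemma arrows_iff: "p \<in> arrows A a b \<longleftrightarrow> p \<in> Arr A \<and> Dom A p = a \<and> Cod A p = b"
  by (simp add: arrows_def)

context is_category
begin

lemma arrows_Obj: "p \<in> arrows A a b \<Longrightarrow> a \<in> Obj A \<and> b \<in> Obj A"
  using Dom_Obj Cod_Obj by (auto simp: arrows_iff)

lemma Ident_arrows: "a \<in> Obj A \<Longrightarrow> Ident A a \<in> arrows A a a"
  by (simp add: arrows_iff Ident_Arr Dom_Ident Cod_Ident)

lemma Comp_arrows: "\<lbrakk>p \<in> arrows A a b; q \<in> arrows A b c\<rbrakk> \<Longrightarrow> Comp A q p \<in> arrows A a c"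
  by (auto simp: arrows_iff Comp_Arr Dom_Comp Cod_Comp)

lemma Comp_Ident_right_arrows: "p \<in> arrows A a b \<Longrightarrow> Comp A p (Ident A a) = p"
  using Comp_Ident_right by (auto simp: arrows_iff)

lemma Comp_Ident_left_arrows: "p \<in> arrows A a b \<Longrightarrow> Comp A (Ident A b) p = p"
  using Comp_Ident_left by (auto simp: arrows_iff)

lemma Comp_assoc_arrows:
  "\<lbrakk>p \<in> arrows A a b; q \<in> arrows A b c; r \<in> arrows A c d\<rbrakk>
    \<Longrightarrow> Comp A (Comp A r q) p = Comp A r (Comp A q p)"
  using Comp_assoc[of p q r] by (simp add: arrows_iff)

end

text \<open>A choice is made because \<open>is_iso\<close> only asserts that an inverse
  exists.\<close>

definition inverse_arrow :: "('a, 'b) category \<Rightarrow> 'b \<Rightarrow> 'b" where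
  "inverse_arrow A p = (SOME q. q \<in> arrows A (Cod A p) (Dom A p) \<and>
     Comp A q p = Ident A (Dom A p) \<and> Comp A p q = Ident A (Cod A p))"

context is_groupoid
begin

lemma inverse_arrow:
  assumes "p \<in> arrows A a b"
  shows "inverse_arrow A p \<in> arrows A b a"
    and "Comp A (inverse_arrow A p) p = Ident A a"
    and "Comp A p (inverse_arrow A p) = Ident A b"
proof -
  have "\<exists>q. q \<in> arrows A (Cod A p) (Dom A p) \<and>
     Comp A q p = Ident A (Dom A p) \<and> Comp A p q = Ident A (Cod A p)"
    using all_iso[of p] assms by (auto simp: is_iso_def arrows_iff)
  from someI_ex[OF this] assms show "inverse_arrow A p \<in> arrows A b a"
    "Comp A (inverse_arrow A p) p = Ident A a" "Comp A p (inverse_arrow A p) = Ident A b"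
    by (auto simp: inverse_arrow_def arrows_iff)
qed


end

lemma (in is_functor) map_arrows: "p \<in> arrows A a b \<Longrightarrow> G p \<in> arrows B (F a) (F b)"
  by (auto simp: arrows_iff map_Arr map_Dom map_Cod)

context strict_2_category
begin

lemma Hom_arrows_Obj:
  assumes "x \<in> Ob C" "y \<in> Ob C" "\<phi> \<in> arrows (Hom C x y) f g"
  shows "f \<in> Obj (Hom C x y)" "g \<in> Obj (Hom C x y)"
  using is_category.arrows_Obj[OF Hom_category] assms by auto

lemma Ident_in:
  "\<lbrakk>x \<in> Ob C; y \<in> Ob C; f \<in> Obj (Hom C x y)\<rbrakk> \<Longrightarrow> Ident (Hom C x y) f \<in> arrows (Hom C x y) f f"
  by (rule is_category.Ident_arrows[OF Hom_category])

lemma Comp_in: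
  "\<lbrakk>x \<in> Ob C; y \<in> Ob C; \<phi> \<in> arrows (Hom C x y) f g; \<psi> \<in> arrows (Hom C x y) g h\<rbrakk>
    \<Longrightarrow> Comp (Hom C x y) \<psi> \<phi> \<in> arrows (Hom C x y) f h"
  by (rule is_category.Comp_arrows[OF Hom_category])

lemma Ident_Comp:
  "\<lbrakk>x \<in> Ob C; y \<in> Ob C; \<phi> \<in> arrows (Hom C x y) f g\<rbrakk>
    \<Longrightarrow> Comp (Hom C x y) (Ident (Hom C x y) g) \<phi> = \<phi>"
  by (rule is_category.Comp_Ident_left_arrows[OF Hom_category])

lemma Comp_Ident:
  "\<lbrakk>x \<in> Ob C; y \<in> Ob C; \<phi> \<in> arrows (Hom C x y) f g\<rbrakk>
    \<Longrightarrow> Comp (Hom C x y) \<phi> (Ident (Hom C x y) f) = \<phi>"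
  by (rule is_category.Comp_Ident_right_arrows[OF Hom_category])

lemma vertical_assoc:
  "\<lbrakk>x \<in> Ob C; y \<in> Ob C; \<phi> \<in> arrows (Hom C x y) f g; \<psi> \<in> arrows (Hom C x y) g h;
    \<chi> \<in> arrows (Hom C x y) h k\<rbrakk>
    \<Longrightarrow> Comp (Hom C x y) (Comp (Hom C x y) \<chi> \<psi>) \<phi> = Comp (Hom C x y) \<chi> (Comp (Hom C x y) \<psi> \<phi>)"
  by (rule is_category.Comp_assoc_arrows[OF Hom_category])

lemma Comp1_in:
  assumes "x \<in> Ob C" "y \<in> Ob C" "z \<in> Ob C" "f \<in> Obj (Hom C x y)" "g \<in> Obj (Hom C y z)"
  shows "Comp1 C x y z g f \<in> Obj (Hom C x z)"
  using is_functor.map_Obj[OF Comp_functor[OF assms(1-3)], of "(g, f)"] assms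
  by (simp add: prod_category_def)

lemma Comp2_in:
  assumes "x \<in> Ob C" "y \<in> Ob C" "z \<in> Ob C"
    "\<phi> \<in> arrows (Hom C x y) f f'" "\<psi> \<in> arrows (Hom C y z) g g'"
  shows "Comp2 C x y z \<psi> \<phi> \<in> arrows (Hom C x z) (Comp1 C x y z g f) (Comp1 C x y z g' f')"
  using is_functor.map_arrows[OF Comp_functor[OF assms(1-3)], of "(\<psi>, \<phi>)" "(g, f)" "(g', f')"] assms(4,5)
  by (simp add: prod_category_def arrows_iff)

lemma Comp2_Ident:
  assumes "x \<in> Ob C" "y \<in> Ob C" "z \<in> Ob C" "f \<in> Obj (Hom C x y)" "g \<in> Obj (Hom C y z)"
  shows "Comp2 C x y z (Ident (Hom C y z) g) (Ident (Hom C x y) f)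
    = Ident (Hom C x z) (Comp1 C x y z g f)"
  using is_functor.map_Ident[OF Comp_functor[OF assms(1-3)], of "(g, f)"] assms
  by (simp add: prod_category_def)

text \<open>This is preservation of composites by \<open>Comp_functor\<close>, whose source is a
  product category.\<close>

lemma interchange:
  assumes "x \<in> Ob C" "y \<in> Ob C" "z \<in> Ob C"
    "\<phi> \<in> arrows (Hom C x y) f f'" "\<phi>' \<in> arrows (Hom C x y) f' f''"
    "\<psi> \<in> arrows (Hom C y z) g g'" "\<psi>' \<in> arrows (Hom C y z) g' g''"
  shows "Comp2 C x y z (Comp (Hom C y z) \<psi>' \<psi>) (Comp (Hom C x y) \<phi>' \<phi>)
    = Comp (Hom C x z) (Comp2 C x y z \<psi>' \<phi>') (Comp2 C x y z \<psi> \<phi>)"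
  using is_functor.map_Comp[OF Comp_functor[OF assms(1-3)], of "(\<psi>, \<phi>)" "(\<psi>', \<phi>')"] assms(4-)
  by (simp add: prod_category_def arrows_iff)

lemma Comp2_assoc_in:
  assumes "w \<in> Ob C" "x \<in> Ob C" "y \<in> Ob C" "z \<in> Ob C" "\<phi> \<in> arrows (Hom C w x) f f'"
    "\<psi> \<in> arrows (Hom C x y) g g'" "\<chi> \<in> arrows (Hom C y z) h h'"
  shows "Comp2 C w x z (Comp2 C x y z \<chi> \<psi>) \<phi> = Comp2 C w y z \<chi> (Comp2 C w x y \<psi> \<phi>)"
  using Comp2_assoc assms by (simp add: arrows_iff)

lemma Comp2_Unit_left_in:
  "\<lbrakk>x \<in> Ob C; y \<in> Ob C; \<phi> \<in> arrows (Hom C x y) f g\<rbrakk> \<Longrightarrow> Comp2 C x y y (Unit2 C y) \<phi> = \<phi>"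
  by (simp add: Comp2_Unit_left arrows_iff)

lemma Comp2_Unit_right_in:
  "\<lbrakk>x \<in> Ob C; y \<in> Ob C; \<phi> \<in> arrows (Hom C x y) f g\<rbrakk> \<Longrightarrow> Comp2 C x x y \<phi> (Unit2 C x) = \<phi>"
  by (simp add: Comp2_Unit_right arrows_iff)

end

section \<open>Simplices from coherent families of 2-morphisms\<close>

text \<open>\<open>a_coherence\<close> compares the two triangulations of the square
  \<open>i, j, k, l\<close>: the left side uses the diagonal from \<open>j\<close> to
  \<open>l\<close>, the right side the one from \<open>i\<close> to \<open>k\<close>. The conditions
  at coinciding indices reflect that \<open>{i, i, j}\<close> and \<open>{i, j, j}\<close> are just
  \<open>{i, j}\<close>, whose cell is an identity.\<close>

locale simplex_data =
  strict_2_category C for C :: "('o, 'm, 'c) two_category" +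
  fixes n :: nat and x :: "nat \<Rightarrow> 'o" and f :: "nat \<Rightarrow> nat \<Rightarrow> 'm"
    and a :: "nat \<Rightarrow> nat \<Rightarrow> nat \<Rightarrow> 'c"
  assumes x_Ob: "i \<le> n \<Longrightarrow> x i \<in> Ob C"
    and f_Obj: "\<lbrakk>i \<le> j; j \<le> n\<rbrakk> \<Longrightarrow> f i j \<in> Obj (Hom C (x i) (x j))"
    and a_in: "\<lbrakk>i \<le> j; j \<le> k; k \<le> n\<rbrakk> \<Longrightarrow>
      a i j k \<in> arrows (Hom C (x i) (x k)) (f i k) (Comp1 C (x i) (x j) (x k) (f j k) (f i j))"
    and f_refl: "i \<le> n \<Longrightarrow> f i i = Unit C (x i)"
    and a_left: "\<lbrakk>i \<le> j; j \<le> n\<rbrakk> \<Longrightarrow> a i i j = Ident (Hom C (x i) (x j)) (f i j)"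
    and a_right: "\<lbrakk>i \<le> j; j \<le> n\<rbrakk> \<Longrightarrow> a i j j = Ident (Hom C (x i) (x j)) (f i j)"
    and a_coherence: "\<lbrakk>i \<le> j; j \<le> k; k \<le> l; l \<le> n\<rbrakk> \<Longrightarrow>
      Comp (Hom C (x i) (x l))
        (Comp2 C (x i) (x j) (x l) (a j k l) (Ident (Hom C (x i) (x j)) (f i j))) (a i j l)
      = Comp (Hom C (x i) (x l))
        (Comp2 C (x i) (x k) (x l) (Ident (Hom C (x k) (x l)) (f k l)) (a i j k)) (a i k l)"
begin

abbreviation "H i j \<equiv> Hom C (x i) (x j)"
abbreviation "hid i j \<equiv> Ident (H i j) (f i j)"
abbreviation "vcomp i j \<equiv> Comp (H i j)"
abbreviation "comp1 i j k \<equiv> Comp1 C (x i) (x j) (x k)"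
abbreviation "comp2 i j k \<equiv> Comp2 C (x i) (x j) (x k)"

fun path :: "nat list \<Rightarrow> 'm" where
  "path [] = undefined"
| "path [i] = Unit C (x i)"
| "path (i # j # js) = comp1 i j (last (j # js)) (path (j # js)) (f i j)"

text \<open>The triangulation of the polygon on the listed vertices in which every triangle contains
  the last vertex. It leads from the long edge to \<open>path\<close>: the triangle at the first
  vertex is applied first, and the fan of the remaining polygon is whiskered with the first
  edge.\<close>

fun fan :: "nat list \<Rightarrow> 'c" where
  "fan [] = undefined"
| "fan [i] = Unit2 C (x i)"
| "fan (i # j # js) = (let k = last (j # js) in
    vcomp i k (comp2 i j k (fan (j # js)) (hid i j)) (a i j k))"

lemma sorted_hd_le_last: "sorted (i # is) \<Longrightarrow> i \<le> last (i # is)"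
  by auto

lemma path_fan_in:
  assumes "sorted js" "js \<noteq> []" "set js \<subseteq> {..n}"
  shows "path js \<in> Obj (H (hd js) (last js)) \<and>
    fan js \<in> arrows (H (hd js) (last js)) (f (hd js) (last js)) (path js)"
  using assms
proof (induction js rule: path.induct)
  case (2 i)
  then show ?case using Unit_Obj[OF x_Ob] Ident_in f_refl x_Ob by auto
next
  case (3 i j js)
  define k where "k = last (j # js)"
  have le: "i \<le> j" "j \<le> k" "k \<le> n"
    using 3(2,4) sorted_hd_le_last[of j js] last_in_set[of "j # js"] unfolding k_def by auto
  then have ob: "x i \<in> Ob C" "x j \<in> Ob C" "x k \<in> Ob C" using x_Ob by auto
  have IH: "path (j # js) \<in> Obj (H j k)" "fan (j # js) \<in> arrows (H j k) (f j k) (path (j # js))"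
    using 3 by (auto simp: k_def)
  have f: "f i j \<in> Obj (H i j)" using f_Obj le by simp
  have p: "path (i # j # js) = comp1 i j k (path (j # js)) (f i j)"
    and q: "fan (i # j # js) = vcomp i k (comp2 i j k (fan (j # js)) (hid i j)) (a i j k)"
    by (simp_all add: k_def Let_def)
  have "comp2 i j k (fan (j # js)) (hid i j)
      \<in> arrows (H i k) (comp1 i j k (f j k) (f i j)) (path (i # j # js))"
    unfolding p by (rule Comp2_in[OF ob Ident_in[OF ob(1,2) f] IH(2)])
  from Comp_in[OF ob(1,3) a_in[OF le] this] Comp1_in[OF ob f IH(1)]
  show ?case unfolding q unfolding p by (simp add: k_def)
qed simp

text \<open>Cutting the polygon at \<open>k\<close> instead of at its first inner vertex is a change
  of triangulation. In the induction on the part before \<open>k\<close>, each step flips one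
  diagonal of the square \<open>i, i', k, j\<close>, and such a flip is an instance of
  \<open>a_coherence\<close>.\<close>

lemma path_fan_append:
  assumes "sorted (is @ k # js)" "set (is @ k # js) \<subseteq> {..n}"
    and "i = hd (is @ [k])" "j = last (k # js)"
  shows "path (is @ k # js) = comp1 i k j (path (k # js)) (path (is @ [k])) \<and>
    fan (is @ k # js) = vcomp i j (comp2 i k j (fan (k # js)) (fan (is @ [k]))) (a i k j)"
  using assms
proof (induction "is" arbitrary: i)
  \<comment> \<open>Here \<open>i = k\<close>, so that the fan of \<open>[k]\<close> and the
    triangle \<open>a k k j\<close> are identities and unit laws suffice.\<close>
  case Nil
  have "k \<le> j" "j \<le> n"
    using Nil sorted_hd_le_last[of k js] last_in_set[of "k # js"] by auto
  then have ob: "x k \<in> Ob C" "x j \<in> Ob C" and le: "k \<le> j" "j \<le> n" using x_Ob by auto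
  have "path (k # js) \<in> Obj (H k j)" "fan (k # js) \<in> arrows (H k j) (f k j) (path (k # js))"
    using path_fan_in[of "k # js"] Nil by auto
  with ob le show ?case using Nil
    by (simp add: Comp1_Unit_right Comp2_Unit_right_in a_left Comp_Ident del: path.simps(3) fan.simps(3))
next
  case (Cons i0 "is")
  define i' where "i' = hd (is @ [k])"
  have i0: "i = i0" using Cons by simp
  obtain r where r: "is @ [k] = i' # r" "last (i' # r) = k"
    unfolding i'_def by (metis append_is_Nil_conv last_snoc list.collapse not_Cons_self2)
  then have r': "is @ k # js = i' # r @ js" by (metis append.assoc append_Cons append_Nil)
  have last: "last (i' # r @ js) = j"
    using Cons(5) r' by (metis last_appendR list.distinct(1))
  have sr: "sorted (i # i' # r @ js)" "set (i # i' # r @ js) \<subseteq> {..n}"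
    using Cons(2,3) r' i0 by auto
  have le: "i \<le> i'" "i' \<le> k" "k \<le> j" "j \<le> n"
  proof -
    show "i \<le> i'" using sr by auto
    have "k \<in> set (i' # r)" using r last_in_set[of "i' # r"] by auto
    then show "i' \<le> k" using sr by auto
    show "k \<le> j" using Cons(2,5) sorted_hd_le_last[of k js] by (simp add: sorted_append)
    have "j \<in> set (k # js)" using Cons(5) last_in_set[of "k # js"] by auto
    then show "j \<le> n" using Cons(3) by auto
  qed
  then have ob: "x i \<in> Ob C" "x i' \<in> Ob C" "x k \<in> Ob C" "x j \<in> Ob C" using x_Ob by auto
  have IH: "path (i' # r @ js) = comp1 i' k j (path (k # js)) (path (i' # r))"
    "fan (i' # r @ js) = vcomp i' j (comp2 i' k j (fan (k # js)) (fan (i' # r))) (a i' k j)"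
    using Cons(1)[OF _ _ i'_def Cons(5)] Cons(2,3) r r' by auto
  have B: "path (k # js) \<in> Obj (H k j)" "fan (k # js) \<in> arrows (H k j) (f k j) (path (k # js))"
    using path_fan_in[of "k # js"] Cons by (auto simp: sorted_append)
  have A: "path (i' # r) \<in> Obj (H i' k)" "fan (i' # r) \<in> arrows (H i' k) (f i' k) (path (i' # r))"
    using path_fan_in[of "i' # r"] sr r by (auto simp: sorted_append)
  have p: "path (i # i' # r @ js) = comp1 i i' j (path (i' # r @ js)) (f i i')"
    "path (i # i' # r) = comp1 i i' k (path (i' # r)) (f i i')"
    using last r(2) by simp_all
  have q: "fan (i # i' # r @ js) = vcomp i j (comp2 i i' j (fan (i' # r @ js)) (hid i i')) (a i i' j)"
    "fan (i # i' # r) = vcomp i k (comp2 i i' k (fan (i' # r)) (hid i i')) (a i i' k)"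
    using last r(2) by (simp_all add: Let_def)
  have f: "f i i' \<in> Obj (H i i')" "f k j \<in> Obj (H k j)" using f_Obj le by auto
  note hid = Ident_in[OF ob(1,2) f(1)] Ident_in[OF ob(3,4) f(2)]
  have a: "a i' k j \<in> arrows (H i' j) (f i' j) (comp1 i' k j (f k j) (f i' k))"
    "a i i' k \<in> arrows (H i k) (f i k) (comp1 i i' k (f i' k) (f i i'))"
    "a i i' j \<in> arrows (H i j) (f i j) (comp1 i i' j (f i' j) (f i i'))"
    "a i k j \<in> arrows (H i j) (f i j) (comp1 i k j (f k j) (f i k))"
    using a_in le by auto
  let ?X = "comp2 i i' j (comp2 i' k j (fan (k # js)) (fan (i' # r))) (hid i i')"
  have X: "?X = comp2 i k j (fan (k # js)) (comp2 i i' k (fan (i' # r)) (hid i i'))"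
    by (rule Comp2_assoc_in[OF ob hid(1) A(2) B(2)])
  note BA = Comp2_in[OF ob(2-4) A(2) B(2)]
  note X_in = Comp2_in[OF ob(1,2,4) hid(1) BA]
  note Ai = Comp2_in[OF ob(1,2,3) hid(1) A(2)]
  \<comment> \<open>Strict associativity allows the source of \<open>?X\<close> to be read with
    either bracketing; both readings are needed to reassociate before and after the flip.\<close>
  have c_assoc: "comp1 i i' j (comp1 i' k j (f k j) (f i' k)) (f i i')
      = comp1 i k j (f k j) (comp1 i i' k (f i' k) (f i i'))"
    using Comp1_assoc[OF ob] f f_Obj le by simp
  \<comment> \<open>The identity \<open>hid i i'\<close> is doubled so that interchange can split
    the whiskered composite supplied by the induction hypothesis.\<close>
  have "fan (i # i' # r @ js)
      = vcomp i j (comp2 i i' j (fan (i' # r @ js)) (vcomp i i' (hid i i') (hid i i'))) (a i i' j)"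
    by (simp only: q Comp_Ident[OF ob(1,2) hid(1)])
  also have "\<dots> = vcomp i j (vcomp i j ?X (comp2 i i' j (a i' k j) (hid i i'))) (a i i' j)"
    by (simp only: IH interchange[OF ob(1,2,4) hid(1) hid(1) a(1) BA])
  also have "\<dots> = vcomp i j ?X (vcomp i j (comp2 i i' j (a i' k j) (hid i i')) (a i i' j))"
    by (rule vertical_assoc[OF ob(1,4) a(3) Comp2_in[OF ob(1,2,4) hid(1) a(1)] X_in])
  \<comment> \<open>The flip: the diagonal from \<open>i'\<close> to \<open>j\<close> gives way to
    the one from \<open>i\<close> to \<open>k\<close>.\<close>
  also have "\<dots> = vcomp i j ?X (vcomp i j (comp2 i k j (hid k j) (a i i' k)) (a i k j))"
    using a_coherence[OF le] by simp
  also have "\<dots> = vcomp i j (vcomp i j ?X (comp2 i k j (hid k j) (a i i' k))) (a i k j)"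
    using vertical_assoc[OF ob(1,4) a(4) Comp2_in[OF ob(1,3,4) a(2) hid(2)] X_in[unfolded c_assoc]]
    by simp
  also have "\<dots> = vcomp i j (comp2 i k j (vcomp k j (fan (k # js)) (hid k j)) (fan (i # i' # r))) (a i k j)"
    by (simp only: X q interchange[OF ob(1,3,4) a(2) Ai hid(2) B(2)])
  also have "\<dots> = vcomp i j (comp2 i k j (fan (k # js)) (fan (i # i' # r))) (a i k j)"
    by (simp only: Comp_Ident[OF ob(3,4) B(2)])
  finally have F: "fan (i # i' # r @ js) = \<dots>" .
  have "path (i # i' # r @ js) = comp1 i k j (path (k # js)) (path (i # i' # r))"
    unfolding p IH by (rule Comp1_assoc[OF ob f(1) A(1) B(1)])
  moreover have "(i0 # is) @ k # js = i # i' # r @ js" "(i0 # is) @ [k] = i # i' # r"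
    using r r' i0 by simp_all
  ultimately show ?case using F by (simp only: simp_thms)
qed

end

section \<open>Members of \<open>P i j\<close> as sorted lists\<close>

lemma P_iff: "S \<in> P i j \<longleftrightarrow> S \<subseteq> {i..j} \<and> i \<in> S \<and> j \<in> S"
  by (simp add: P_def)

lemma P_le: "S \<in> P i j \<Longrightarrow> i \<le> j"
  by (auto simp: P_iff)

lemma P_atMost: "\<lbrakk>S \<in> P i j; j \<le> n\<rbrakk> \<Longrightarrow> S \<subseteq> {..n}"
  by (auto simp: P_iff subset_iff)

lemma P_Un:
  assumes "S \<in> P i j" "T \<in> P j k"
  shows "T \<union> S \<in> P i k"
proof -
  have "{i..j} \<subseteq> {i..k}" "{j..k} \<subseteq> {i..k}" using assms[THEN P_le] by auto
  then show ?thesis using assms unfolding P_iff by blast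
qed

lemma le_last_sorted: "\<lbrakk>sorted l; s \<in> set l\<rbrakk> \<Longrightarrow> s \<le> last l"
  by (induction l) (auto intro: order_trans)

text \<open>The prescribed ends \<open>i\<close> and \<open>j\<close> are the minimum and the
  maximum of \<open>S\<close>.\<close>

lemma P_sorted_list:
  assumes "S \<in> P i j"
  shows "\<exists>is. sorted_list_of_set S = is @ [j] \<and> hd (is @ [j]) = i"
    and "\<exists>js. sorted_list_of_set S = i # js \<and> last (i # js) = j"
    and "sorted_list_of_set S \<noteq> []"
    and "hd (sorted_list_of_set S) = i" and "last (sorted_list_of_set S) = j"
    and "set (sorted_list_of_set S) = S"
proof -
  have fin: "finite S" "S \<noteq> {}" using assms finite_subset by (auto simp: P_iff)
  then show ne: "sorted_list_of_set S \<noteq> []" and s: "set (sorted_list_of_set S) = S"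
    by simp_all
  have "Min S = i" "Max S = j"
    using assms fin by (auto simp: P_iff intro!: Min_eqI Max_eqI)
  then show h: "hd (sorted_list_of_set S) = i"
    using fin sorted_list_of_set_nonempty[of S] by simp
  have "last (sorted_list_of_set S) \<in> S" using ne s last_in_set by blast
  moreover have "s \<le> last (sorted_list_of_set S)" if "s \<in> S" for s
    using that fin le_last_sorted[of "sorted_list_of_set S" s] by simp
  ultimately show l: "last (sorted_list_of_set S) = j"
    using assms by (auto simp: P_iff intro!: antisym)
  show "\<exists>is. sorted_list_of_set S = is @ [j] \<and> hd (is @ [j]) = i"
    using ne h l by (metis append_butlast_last_id)
  show "\<exists>js. sorted_list_of_set S = i # js \<and> last (i # js) = j"
    using ne h l by (metis list.collapse)
qed

text \<open>No element of \<open>S\<close> exceeds \<open>j\<close> and no element of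
  \<open>T\<close> is below it, so the two sorted lists overlap in exactly the entry
  \<open>j\<close>.\<close>

lemma sorted_list_of_set_P_Un:
  assumes "S \<in> P i j" "T \<in> P j k" "sorted_list_of_set S = is @ [j]" "sorted_list_of_set T = j # js"
  shows "sorted_list_of_set (T \<union> S) = is @ j # js"
proof (rule sorted_distinct_set_unique)
  have fin: "finite S" "finite T" using assms finite_subset by (auto simp: P_iff)
  have sets: "set (is @ [j]) = S" "set (j # js) = T"
    using fin by (auto simp flip: assms(3,4))
  have sd: "sorted (is @ [j])" "distinct (is @ [j])" "sorted (j # js)" "distinct (j # js)"
    by (simp_all flip: assms(3,4))
  have "s \<le> j" if "s \<in> set is" for s using sd(1) that by (auto simp: sorted_append)
  moreover have "s \<noteq> j" if "s \<in> set is" for s using sd(2) that by auto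
  moreover have "j \<le> t" if "t \<in> set (j # js)" for t using sd(3) that by auto
  ultimately have lt: "s < t" if "s \<in> set is" "t \<in> set (j # js)" for s t
    using that by (meson order_le_less_trans less_le_trans order_le_neq_trans)
  show "sorted (is @ j # js)"
    using sd lt by (auto simp: sorted_append intro: less_imp_le)
  show "distinct (is @ j # js)"
    using sd(2,4) lt by (auto)
  show "set (sorted_list_of_set (T \<union> S)) = set (is @ j # js)" using sets fin by auto
qed simp_all

section \<open>Strict 2-functors out of \<open>C2 n\<close> in terms of sets\<close>

lemma C2_simps:
  "Ob (C2 n) = {..n}" "Unit (C2 n) i = {i}"
  "Comp1 (C2 n) i j k T S = T \<union> S" "Comp2 (C2 n) i j k q p = (fst q \<union> fst p, snd q \<union> snd p)"
  "Dom (Hom (C2 n) i j) = fst" "Cod (Hom (C2 n) i j) = snd"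
  "Ident (Hom (C2 n) i j) S = (S, S)" "Comp (Hom (C2 n) i j) q p = (fst p, snd q)"
  by (simp_all add: C2_def poset_category_def)

text \<open>For \<open>i > j\<close> the set \<open>P i j\<close> is already empty, which absorbs
  the case distinction in \<open>C2\<close>.\<close>

lemma C2_Obj: "Obj (Hom (C2 n) i j) = P i j"
  by (auto simp add: C2_def poset_category_def P_def)

lemma C2_Arr: "Arr (Hom (C2 n) i j) = {(S, T). S \<in> P i j \<and> T \<in> P i j \<and> S \<subseteq> T}"
  by (auto simp add: C2_def poset_category_def P_def)

text \<open>Together with its converse below, this hides the encoding of cells as pairs in a poset
  category. A member of \<open>P i j\<close> forces \<open>i \<le> j\<close>, so
  \<open>j \<le> n\<close> bounds both indices.\<close>

lemma strict_2_functor_C2I: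
  fixes b :: "('o, 'm, 'c) simplex"
  assumes "\<And>i. i \<le> n \<Longrightarrow> obj_map b i \<in> Ob C"
    and "\<And>i j S. \<lbrakk>j \<le> n; S \<in> P i j\<rbrakk>
      \<Longrightarrow> mor_map b i j S \<in> Obj (Hom C (obj_map b i) (obj_map b j))"
    and "\<And>i j S T. \<lbrakk>j \<le> n; S \<in> P i j; T \<in> P i j; S \<subseteq> T\<rbrakk> \<Longrightarrow> cell_map b i j (S, T)
      \<in> arrows (Hom C (obj_map b i) (obj_map b j)) (mor_map b i j S) (mor_map b i j T)"
    and "\<And>i j S. \<lbrakk>j \<le> n; S \<in> P i j\<rbrakk>
      \<Longrightarrow> cell_map b i j (S, S) = Ident (Hom C (obj_map b i) (obj_map b j)) (mor_map b i j S)"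
    and "\<And>i j S T U. \<lbrakk>j \<le> n; S \<in> P i j; T \<in> P i j; S \<subseteq> T; U \<in> P i j; T \<subseteq> U\<rbrakk>
      \<Longrightarrow> cell_map b i j (S, U) = Comp (Hom C (obj_map b i) (obj_map b j))
            (cell_map b i j (T, U)) (cell_map b i j (S, T))"
    and "\<And>i. i \<le> n \<Longrightarrow> mor_map b i i {i} = Unit C (obj_map b i)"
    and "\<And>i j k S T. \<lbrakk>k \<le> n; S \<in> P i j; T \<in> P j k\<rbrakk> \<Longrightarrow> mor_map b i k (T \<union> S)
      = Comp1 C (obj_map b i) (obj_map b j) (obj_map b k) (mor_map b j k T) (mor_map b i j S)"
    and "\<And>i j k S T S' T'. \<lbrakk>k \<le> n; S \<in> P i j; T \<in> P j k; S' \<in> P i j; S \<subseteq> S'; T' \<in> P j k; T \<subseteq> T'\<rbrakk>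
      \<Longrightarrow> cell_map b i k (T \<union> S, T' \<union> S') = Comp2 C (obj_map b i) (obj_map b j) (obj_map b k)
            (cell_map b j k (T, T')) (cell_map b i j (S, S'))"
    and "\<And>i. \<not> i \<le> n \<Longrightarrow> obj_map b i = undefined"
    and "\<And>i j S. \<not> (j \<le> n \<and> S \<in> P i j) \<Longrightarrow> mor_map b i j S = undefined"
    and "\<And>i j S T. \<not> (j \<le> n \<and> S \<in> P i j \<and> T \<in> P i j \<and> S \<subseteq> T)
      \<Longrightarrow> cell_map b i j (S, T) = undefined"
  shows "strict_2_functor (C2 n) C b"
proof (intro strict_2_functor.intro hom_functorial.intro strict_2_functor_axioms.intro;
    (unfold C2_simps C2_Obj C2_Arr)?)
  fix i j assume "i \<in> {..n}" "j \<in> {..n}"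
  then have j: "j \<le> n" by simp
  show "is_functor (Hom (C2 n) i j) (Hom C (obj_map b i) (obj_map b j)) (mor_map b i j) (cell_map b i j)"
  proof (intro is_functor.intro; (unfold C2_simps C2_Obj C2_Arr)?)
    fix p q
    assume "p \<in> {(S, T). S \<in> P i j \<and> T \<in> P i j \<and> S \<subseteq> T}"
      "q \<in> {(S, T). S \<in> P i j \<and> T \<in> P i j \<and> S \<subseteq> T}" "snd p = fst q"
    then show "cell_map b i j (fst p, snd q)
        = Comp (Hom C (obj_map b i) (obj_map b j)) (cell_map b i j q) (cell_map b i j p)"
      using assms(5)[OF j, of "fst p" i "fst q" "snd q"] by (cases p, cases q) simp
  qed (use assms(2)[OF j] assms(3)[OF j, unfolded arrows_iff] assms(4)[OF j] in auto)
next
  fix i j S assume "\<not> (i \<in> {..n} \<and> j \<in> {..n} \<and> S \<in> P i j)"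
  then show "mor_map b i j S = undefined" using P_le[of S i j] by (intro assms(10)) auto
next
  fix i j and p :: simplex_cell
  assume "\<not> (i \<in> {..n} \<and> j \<in> {..n} \<and> p \<in> {(S, T). S \<in> P i j \<and> T \<in> P i j \<and> S \<subseteq> T})"
  then show "cell_map b i j p = undefined"
    using P_le[of "fst p" i j] by (cases p) (auto intro!: assms(11) dest: le_trans)
qed (use assms(1,6-9) in auto)

lemma strict_2_functor_C2D:
  fixes b :: "('o, 'm, 'c) simplex"
  assumes "strict_2_functor (C2 n) C b"
  shows "i \<le> n \<Longrightarrow> obj_map b i \<in> Ob C"
    and "\<lbrakk>j \<le> n; S \<in> P i j\<rbrakk>
      \<Longrightarrow> mor_map b i j S \<in> Obj (Hom C (obj_map b i) (obj_map b j))"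
    and "\<lbrakk>j \<le> n; S \<in> P i j; T \<in> P i j; S \<subseteq> T\<rbrakk> \<Longrightarrow> cell_map b i j (S, T)
      \<in> arrows (Hom C (obj_map b i) (obj_map b j)) (mor_map b i j S) (mor_map b i j T)"
    and "\<lbrakk>j \<le> n; S \<in> P i j\<rbrakk>
      \<Longrightarrow> cell_map b i j (S, S) = Ident (Hom C (obj_map b i) (obj_map b j)) (mor_map b i j S)"
    and "\<lbrakk>j \<le> n; S \<in> P i j; T \<in> P i j; S \<subseteq> T; U \<in> P i j; T \<subseteq> U\<rbrakk>
      \<Longrightarrow> cell_map b i j (S, U) = Comp (Hom C (obj_map b i) (obj_map b j))
            (cell_map b i j (T, U)) (cell_map b i j (S, T))"
    and "i \<le> n \<Longrightarrow> mor_map b i i {i} = Unit C (obj_map b i)"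
    and "\<lbrakk>k \<le> n; S \<in> P i j; T \<in> P j k\<rbrakk> \<Longrightarrow> mor_map b i k (T \<union> S)
      = Comp1 C (obj_map b i) (obj_map b j) (obj_map b k) (mor_map b j k T) (mor_map b i j S)"
    and "\<lbrakk>k \<le> n; S \<in> P i j; T \<in> P j k; S' \<in> P i j; S \<subseteq> S'; T' \<in> P j k; T \<subseteq> T'\<rbrakk>
      \<Longrightarrow> cell_map b i k (T \<union> S, T' \<union> S') = Comp2 C (obj_map b i) (obj_map b j) (obj_map b k)
            (cell_map b j k (T, T')) (cell_map b i j (S, S'))"
    and "\<not> i \<le> n \<Longrightarrow> obj_map b i = undefined"
    and "\<not> (j \<le> n \<and> S \<in> P i j) \<Longrightarrow> mor_map b i j S = undefined"
    and "\<not> (j \<le> n \<and> S \<in> P i j \<and> T \<in> P i j \<and> S \<subseteq> T)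
      \<Longrightarrow> cell_map b i j (S, T) = undefined"
proof -
  interpret b: strict_2_functor "C2 n" C b by (rule assms)
  have hom: "is_functor (Hom (C2 n) i j) (Hom C (obj_map b i) (obj_map b j)) (mor_map b i j) (cell_map b i j)"
    if "j \<le> n" "S \<in> P i j" for i j S
    using b.hom_functor[of i j] that P_le[OF that(2)] by (simp add: C2_simps)
  show "i \<le> n \<Longrightarrow> obj_map b i \<in> Ob C"
    using b.obj_map_Ob by (simp add: C2_simps)
  show "\<lbrakk>j \<le> n; S \<in> P i j\<rbrakk> \<Longrightarrow> mor_map b i j S \<in> Obj (Hom C (obj_map b i) (obj_map b j))"
    using is_functor.map_Obj[OF hom] by (simp add: C2_Obj)
  show "\<lbrakk>j \<le> n; S \<in> P i j; T \<in> P i j; S \<subseteq> T\<rbrakk> \<Longrightarrow> cell_map b i j (S, T)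
      \<in> arrows (Hom C (obj_map b i) (obj_map b j)) (mor_map b i j S) (mor_map b i j T)"
    using is_functor.map_arrows[OF hom] by (simp add: C2_simps C2_Arr arrows_iff)
  show "\<lbrakk>j \<le> n; S \<in> P i j\<rbrakk>
      \<Longrightarrow> cell_map b i j (S, S) = Ident (Hom C (obj_map b i) (obj_map b j)) (mor_map b i j S)"
    using is_functor.map_Ident[OF hom] by (simp add: C2_simps C2_Obj)
  show "\<lbrakk>j \<le> n; S \<in> P i j; T \<in> P i j; S \<subseteq> T; U \<in> P i j; T \<subseteq> U\<rbrakk>
      \<Longrightarrow> cell_map b i j (S, U) = Comp (Hom C (obj_map b i) (obj_map b j))
            (cell_map b i j (T, U)) (cell_map b i j (S, T))"
    using is_functor.map_Comp[OF hom, of j S i "(S, T)" "(T, U)"] by (simp add: C2_simps C2_Arr)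
  show "i \<le> n \<Longrightarrow> mor_map b i i {i} = Unit C (obj_map b i)"
    using b.mor_map_Unit by (simp add: C2_simps)
  show "\<lbrakk>k \<le> n; S \<in> P i j; T \<in> P j k\<rbrakk> \<Longrightarrow> mor_map b i k (T \<union> S)
      = Comp1 C (obj_map b i) (obj_map b j) (obj_map b k) (mor_map b j k T) (mor_map b i j S)"
    using b.mor_map_Comp1[of i j k S T] P_le[of S i j] P_le[of T j k] by (simp add: C2_simps C2_Obj)
  show "\<lbrakk>k \<le> n; S \<in> P i j; T \<in> P j k; S' \<in> P i j; S \<subseteq> S'; T' \<in> P j k; T \<subseteq> T'\<rbrakk>
      \<Longrightarrow> cell_map b i k (T \<union> S, T' \<union> S') = Comp2 C (obj_map b i) (obj_map b j) (obj_map b k)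
            (cell_map b j k (T, T')) (cell_map b i j (S, S'))"
    using b.cell_map_Comp2[of i j k "(S, S')" "(T, T')"] P_le[of S i j] P_le[of T j k]
    by (simp add: C2_simps C2_Arr)
  show "\<not> i \<le> n \<Longrightarrow> obj_map b i = undefined"
    using b.obj_map_undefined by (simp add: C2_simps)
  show "\<not> (j \<le> n \<and> S \<in> P i j) \<Longrightarrow> mor_map b i j S = undefined"
    using b.mor_map_undefined[of i j S] by (simp add: C2_simps C2_Obj)
  show "\<not> (j \<le> n \<and> S \<in> P i j \<and> T \<in> P i j \<and> S \<subseteq> T) \<Longrightarrow> cell_map b i j (S, T) = undefined"
    using b.cell_map_undefined[of i j "(S, T)"] by (simp add: C2_simps C2_Arr)
qed

section \<open>The candidate 2-functor of a coherent family\<close>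

context simplex_data
begin

definition "walk S = path (sorted_list_of_set S)"
definition "fan_of S = fan (sorted_list_of_set S)"

lemma walk_fan_of_in:
  assumes "S \<in> P i j" "j \<le> n"
  shows "walk S \<in> Obj (H i j)" "fan_of S \<in> arrows (H i j) (f i j) (walk S)"
  using path_fan_in[of "sorted_list_of_set S"] P_sorted_list(3-6)[OF assms(1)] P_atMost[OF assms]
  by (simp_all add: walk_def fan_of_def)

text \<open>Carries \<open>path_fan_append\<close> from lists to sets: composition in
  \<open>C2 n\<close> is union, which on sorted lists is concatenation at the shared point
  \<open>j\<close>.\<close>

lemma walk_fan_of_Un:
  assumes "S \<in> P i j" "T \<in> P j k" "k \<le> n"
  shows "walk (T \<union> S) = comp1 i j k (walk T) (walk S)"
    and "fan_of (T \<union> S) = vcomp i k (comp2 i j k (fan_of T) (fan_of S)) (a i j k)"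
proof -
  obtain "is" js where l: "sorted_list_of_set S = is @ [j]" "hd (is @ [j]) = i"
    "sorted_list_of_set T = j # js" "last (j # js) = k"
    using P_sorted_list(1)[OF assms(1)] P_sorted_list(2)[OF assms(2)] by auto
  note u = sorted_list_of_set_P_Un[OF assms(1,2) l(1,3)]
  have fin: "finite (T \<union> S)" using assms finite_subset by (auto simp: P_iff)
  have "set (is @ j # js) \<subseteq> {..n}"
    using P_atMost[OF P_Un[OF assms(1,2)] assms(3)] fin by (simp flip: u)
  moreover have "sorted (is @ j # js)" by (simp flip: u)
  ultimately show "walk (T \<union> S) = comp1 i j k (walk T) (walk S)"
    "fan_of (T \<union> S) = vcomp i k (comp2 i j k (fan_of T) (fan_of S)) (a i j k)"
    using path_fan_append[of "is" j js i k] l u by (simp_all add: walk_def fan_of_def)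
qed

lemma walk_singleton: "walk {i} = Unit C (x i)" and fan_of_singleton: "fan_of {i} = Unit2 C (x i)"
  by (simp_all add: walk_def fan_of_def)

lemma walk_fan_of_pair:
  assumes "i \<le> j" "j \<le> n"
  shows "walk {i, j} = f i j" and "fan_of {i, j} = hid i j"
proof -
  have "walk {i, j} = f i j \<and> fan_of {i, j} = hid i j"
  \<comment> \<open>For \<open>i = j\<close> the sorted list has a single entry; otherwise it is
    \<open>[i, j]\<close> and the fan reduces to the identity \<open>a i j j\<close>.\<close>
  proof (cases "i = j")
    case True
    then show ?thesis using assms by (simp add: walk_singleton fan_of_singleton f_refl)
  next
    case False
    then have s: "sorted_list_of_set {i, j} = [i, j]"
      using assms by (intro sorted_distinct_set_unique) auto
    have ob: "x i \<in> Ob C" "x j \<in> Ob C" and f: "f i j \<in> Obj (H i j)" using assms x_Ob f_Obj by auto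
    show ?thesis using ob f
      by (simp add: walk_def fan_of_def s a_right assms Comp1_Unit_left
          Comp2_Unit_left_in[OF ob Ident_in] Ident_Comp[OF ob Ident_in])
  qed
  then show "walk {i, j} = f i j" "fan_of {i, j} = hid i j" by auto
qed

text \<open>Splitting the set at \<open>j\<close> treats coinciding indices uniformly, and the fans
  of both parts are identities by \<open>walk_fan_of_pair\<close>.\<close>

lemma fan_of_triple:
  assumes "i \<le> j" "j \<le> k" "k \<le> n"
  shows "fan_of {i, j, k} = a i j k"
proof -
  have ob: "x i \<in> Ob C" "x j \<in> Ob C" "x k \<in> Ob C" using x_Ob assms by auto
  have "{i, j, k} = {j, k} \<union> {i, j}" by auto
  then have "fan_of {i, j, k} = vcomp i k (comp2 i j k (hid j k) (hid i j)) (a i j k)"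
    using walk_fan_of_Un(2)[of "{i, j}" i j "{j, k}" k] assms
    by (simp add: P_iff walk_fan_of_pair)
  then show ?thesis
    using assms f_Obj by (simp add: Comp2_Ident[OF ob] Ident_Comp[OF ob(1,3) a_in])
qed

definition simplex :: "('o, 'm, 'c) simplex" where
  "simplex =
    \<lparr>obj_map = (\<lambda>i\<in>{..n}. x i),
     mor_map = (\<lambda>i j S. if i \<le> n \<and> j \<le> n \<and> S \<in> P i j then walk S else undefined),
     cell_map = (\<lambda>i j (S, T). if i \<le> n \<and> j \<le> n \<and> S \<in> P i j \<and> T \<in> P i j \<and> S \<subseteq> T
       then vcomp i j (fan_of T) (inverse_arrow (H i j) (fan_of S)) else undefined)\<rparr>"

lemma simplex_simps:
  "i \<le> n \<Longrightarrow> obj_map simplex i = x i"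
  "\<lbrakk>j \<le> n; S \<in> P i j\<rbrakk> \<Longrightarrow> mor_map simplex i j S = walk S"
  "\<lbrakk>j \<le> n; S \<in> P i j; T \<in> P i j; S \<subseteq> T\<rbrakk> \<Longrightarrow>
    cell_map simplex i j (S, T) = vcomp i j (fan_of T) (inverse_arrow (H i j) (fan_of S))"
  using P_le[of S i j] by (auto simp: simplex_def)

end

text \<open>
  Since mapping categories are groupoids, the 2-morphism attached to \<open>S \<subseteq> T\<close> is the fan of \<open>T\<close>
  after the inverse of the fan of \<open>S\<close>; only horizontal composition needs coherence.
\<close>

locale groupoid_simplex_data = simplex_data + strict_21_category
begin

lemma inverse_in:
  assumes "i \<le> n" "j \<le> n" "\<phi> \<in> arrows (H i j) g h"
  shows "inverse_arrow (H i j) \<phi> \<in> arrows (H i j) h g"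
    and "vcomp i j (inverse_arrow (H i j) \<phi>) \<phi> = Ident (H i j) g"
    and "vcomp i j \<phi> (inverse_arrow (H i j) \<phi>) = Ident (H i j) h"
  using is_groupoid.inverse_arrow[OF Hom_groupoid] assms x_Ob by auto

lemma hom_cell_in:
  assumes "j \<le> n" "S \<in> P i j" "T \<in> P i j" "S \<subseteq> T"
  shows "cell_map simplex i j (S, T) \<in> arrows (H i j) (walk S) (walk T)"
proof -
  have "i \<le> n" and ob: "x i \<in> Ob C" "x j \<in> Ob C" using assms P_le[OF assms(2)] x_Ob by auto
  note S = walk_fan_of_in(2)[OF assms(2,1)] and T = walk_fan_of_in(2)[OF assms(3,1)]
  show ?thesis
    using Comp_in[OF ob inverse_in(1)[OF \<open>i \<le> n\<close> assms(1) S] T] assms by (simp add: simplex_simps)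
qed

lemma hom_cell_fan:
  assumes "j \<le> n" "S \<in> P i j" "T \<in> P i j" "S \<subseteq> T"
  shows "vcomp i j (cell_map simplex i j (S, T)) (fan_of S) = fan_of T"
proof -
  have "i \<le> n" and ob: "x i \<in> Ob C" "x j \<in> Ob C" using assms P_le[OF assms(2)] x_Ob by auto
  note S = walk_fan_of_in(2)[OF assms(2,1)] and T = walk_fan_of_in(2)[OF assms(3,1)]
  note i = inverse_in[OF \<open>i \<le> n\<close> assms(1) S]
  show ?thesis
    using vertical_assoc[OF ob S i(1) T] Comp_Ident[OF ob T] assms by (simp add: simplex_simps i(2))
qed

text \<open>Fans are invertible, hence can be cancelled on the right. With
  \<open>hom_cell_fan\<close> this makes the cell of \<open>S \<subseteq> T\<close> the unique
  2-morphism that turns the fan of \<open>S\<close> into the fan of \<open>T\<close>, so laws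
  between cells are verified after precomposition with a fan.\<close>

lemma cancel_fan:
  assumes "j \<le> n" "S \<in> P i j" "\<phi> \<in> arrows (H i j) (walk S) h" "\<psi> \<in> arrows (H i j) (walk S) h"
    and "vcomp i j \<phi> (fan_of S) = vcomp i j \<psi> (fan_of S)"
  shows "\<phi> = \<psi>"
proof -
  have "i \<le> n" and ob: "x i \<in> Ob C" "x j \<in> Ob C" using assms P_le[OF assms(2)] x_Ob by auto
  note S = walk_fan_of_in(2)[OF assms(2,1)]
  note i = inverse_in[OF \<open>i \<le> n\<close> assms(1) S]
  have "\<phi> = vcomp i j (vcomp i j \<phi> (fan_of S)) (inverse_arrow (H i j) (fan_of S))"
    "\<psi> = vcomp i j (vcomp i j \<psi> (fan_of S)) (inverse_arrow (H i j) (fan_of S))"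
    using assms(3,4) vertical_assoc[OF ob i(1) S] Comp_Ident[OF ob] by (simp_all add: i(3))
  with assms(5) show ?thesis by simp
qed

lemma strict_2_functor_simplex: "strict_2_functor (C2 n) C simplex"
proof (rule strict_2_functor_C2I)
  fix i j S assume A: "j \<le> n" "S \<in> P i j"
  have le: "i \<le> n" using A P_le[OF A(2)] by simp
  show "mor_map simplex i j S \<in> Obj (Hom C (obj_map simplex i) (obj_map simplex j))"
    using A le walk_fan_of_in by (simp add: simplex_simps)
  show "cell_map simplex i j (S, S)
      = Ident (Hom C (obj_map simplex i) (obj_map simplex j)) (mor_map simplex i j S)"
    using A le inverse_in(3)[OF le A(1) walk_fan_of_in(2)[OF A(2,1)]] by (simp add: simplex_simps)
  fix T assume T: "T \<in> P i j" "S \<subseteq> T"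
  note ST = hom_cell_in[OF A T]
  then show "cell_map simplex i j (S, T) \<in> arrows (Hom C (obj_map simplex i) (obj_map simplex j))
      (mor_map simplex i j S) (mor_map simplex i j T)"
    using A le T by (simp add: simplex_simps(1,2))
  fix U assume U: "U \<in> P i j" "T \<subseteq> U"
  note TU = hom_cell_in[OF A(1) T(1) U]
  have ob: "x i \<in> Ob C" "x j \<in> Ob C" using x_Ob A le by auto
  have SU: "S \<subseteq> U" using T U by auto
  \<comment> \<open>Both sides turn the fan of \<open>S\<close> into the fan of
    \<open>U\<close>.\<close>
  have "cell_map simplex i j (S, U)
      = vcomp i j (cell_map simplex i j (T, U)) (cell_map simplex i j (S, T))"
    by (rule cancel_fan[OF A hom_cell_in[OF A U(1) SU] Comp_in[OF ob ST TU]])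
      (simp add: vertical_assoc[OF ob walk_fan_of_in(2)[OF A(2,1)] ST TU]
        hom_cell_fan[OF A(1)] A T U SU)
  then show "cell_map simplex i j (S, U) = Comp (Hom C (obj_map simplex i) (obj_map simplex j))
      (cell_map simplex i j (T, U)) (cell_map simplex i j (S, T))"
    using A le by (simp add: simplex_simps(1))
next
  fix i j k S T assume A: "k \<le> n" "S \<in> P i j" "T \<in> P j k"
  then show "mor_map simplex i k (T \<union> S) = Comp1 C (obj_map simplex i) (obj_map simplex j)
      (obj_map simplex k) (mor_map simplex j k T) (mor_map simplex i j S)"
    using P_Un[OF A(2,3)] P_le[OF A(2)] P_le[OF A(3)] by (simp add: simplex_simps walk_fan_of_Un)
  fix S' T' assume A': "S' \<in> P i j" "S \<subseteq> S'" "T' \<in> P j k" "T \<subseteq> T'"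
  have le: "i \<le> j" "j \<le> k" "i \<le> n" "j \<le> n" "k \<le> n" using A(1) P_le[OF A(2)] P_le[OF A(3)] by auto
  then have ob: "x i \<in> Ob C" "x j \<in> Ob C" "x k \<in> Ob C" using x_Ob by auto
  let ?s = "cell_map simplex i j (S, S')" and ?t = "cell_map simplex j k (T, T')"
  note s = hom_cell_in[OF le(4) A(2) A'(1,2)] and t = hom_cell_in[OF le(5) A(3) A'(3,4)]
  note fS = walk_fan_of_in(2)[OF A(2) le(4)] and fT = walk_fan_of_in(2)[OF A(3) le(5)]
  note fan_Un = walk_fan_of_Un[OF A(2,3) le(5)] walk_fan_of_Un[OF A'(1,3) le(5)]
  have U: "T \<union> S \<in> P i k" "T' \<union> S' \<in> P i k" "T \<union> S \<subseteq> T' \<union> S'" using P_Un A A' by auto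
  have ts: "comp2 i j k ?t ?s \<in> arrows (H i k) (walk (T \<union> S)) (walk (T' \<union> S'))"
    using Comp2_in[OF ob s t] by (simp add: fan_Un)
  have "cell_map simplex i k (T \<union> S, T' \<union> S') = comp2 i j k ?t ?s"
  proof (rule cancel_fan[OF le(5) U(1) hom_cell_in[OF le(5) U] ts])
    \<comment> \<open>The fans of \<open>T \<union> S\<close> and of \<open>T' \<union> S'\<close>
      begin with the same \<open>a i j k\<close>, followed by a horizontal composite of two fans.
      Interchange lets \<open>?t\<close> and \<open>?s\<close> act on these two fans
      separately.\<close>
    have "vcomp i k (comp2 i j k ?t ?s) (fan_of (T \<union> S))
        = vcomp i k (vcomp i k (comp2 i j k ?t ?s) (comp2 i j k (fan_of T) (fan_of S))) (a i j k)"
      unfolding fan_Un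
      by (rule vertical_assoc[OF ob(1,3) a_in[OF le(1,2,5)] Comp2_in[OF ob fS fT] Comp2_in[OF ob s t],
            symmetric])
    also have "\<dots> = fan_of (T' \<union> S')"
      unfolding fan_Un interchange[OF ob fS s fT t, symmetric]
      by (simp only: hom_cell_fan[OF le(4) A(2) A'(1,2)] hom_cell_fan[OF le(5) A(3) A'(3,4)])
    finally show "vcomp i k (cell_map simplex i k (T \<union> S, T' \<union> S')) (fan_of (T \<union> S))
        = vcomp i k (comp2 i j k ?t ?s) (fan_of (T \<union> S))"
      using hom_cell_fan[OF le(5) U] by simp
  qed
  then show "cell_map simplex i k (T \<union> S, T' \<union> S') = Comp2 C (obj_map simplex i)
      (obj_map simplex j) (obj_map simplex k) ?t ?s"
    using le by (simp add: simplex_simps(1))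
qed (auto simp: simplex_def x_Ob walk_singleton P_iff)

lemma simplex_data_simps:
  "i \<le> n \<Longrightarrow> obj_map simplex i = x i"
  "\<lbrakk>i \<le> j; j \<le> n\<rbrakk> \<Longrightarrow> mor_map simplex i j {i, j} = f i j"
  "\<lbrakk>i \<le> j; j \<le> k; k \<le> n\<rbrakk> \<Longrightarrow> cell_map simplex i k ({i, k}, {i, j, k}) = a i j k"
proof -
  assume le: "i \<le> j" "j \<le> k" "k \<le> n"
  then have ob: "x i \<in> Ob C" "x k \<in> Ob C" and ik: "i \<le> k" and f: "f i k \<in> Obj (H i k)"
    using x_Ob f_Obj by auto
  have P: "{i, k} \<in> P i k" "{i, j, k} \<in> P i k" "{i, k} \<subseteq> {i, j, k}"
    using le by (auto simp: P_iff)
  note pair = walk_fan_of_pair[OF ik le(3)]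
  \<comment> \<open>The fan of \<open>{i, k}\<close> is an identity, so the equation characterising
    the cell already computes it.\<close>
  have "vcomp i k (cell_map simplex i k ({i, k}, {i, j, k})) (hid i k) = a i j k"
    using hom_cell_fan[OF le(3) P] unfolding pair fan_of_triple[OF le] .
  then show "cell_map simplex i k ({i, k}, {i, j, k}) = a i j k"
    using Comp_Ident[OF ob hom_cell_in[OF le(3) P, unfolded pair]] by simp
qed (auto simp: simplex_simps walk_fan_of_pair P_iff)

end

section \<open>Simplices of the nerve as coherent families\<close>

definition edge_at :: "('o, 'm, 'c) simplex \<Rightarrow> nat \<Rightarrow> nat \<Rightarrow> 'm" where
  "edge_at b i j = mor_map b i j {i, j}"

definition face_at :: "('o, 'm, 'c) simplex \<Rightarrow> nat \<Rightarrow> nat \<Rightarrow> nat \<Rightarrow> 'c" where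
  "face_at b i j k = cell_map b i k ({i, k}, {i, j, k})"

lemma P_pair: "i \<le> j \<Longrightarrow> {i, j} \<in> P i j"
  and P_triple: "\<lbrakk>i \<le> j; j \<le> k\<rbrakk> \<Longrightarrow> {i, j, k} \<in> P i k"
  by (auto simp: P_iff)

text \<open>Both sides of the coherence equation are the cell from \<open>{i, l}\<close> to
  \<open>{i, j, k, l}\<close>, factored through \<open>{i, j, l}\<close> on the left and through
  \<open>{i, k, l}\<close> on the right.\<close>

lemma (in strict_2_category) simplex_data_of_simplex:
  assumes b: "strict_2_functor (C2 n) C b"
  shows "simplex_data C n (obj_map b) (edge_at b) (face_at b)"
proof -
  note b = strict_2_functor_C2D[OF b]
  have triple: "{i, j, k} = {j, k} \<union> {i, j}" for i j k :: nat by auto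
  show ?thesis
  proof unfold_locales
    fix i j k assume le: "i \<le> j" "j \<le> k" "k \<le> n"
    show "face_at b i j k \<in> arrows (Hom C (obj_map b i) (obj_map b k)) (edge_at b i k)
        (Comp1 C (obj_map b i) (obj_map b j) (obj_map b k) (edge_at b j k) (edge_at b i j))"
      using b(3)[of k "{i, k}" i "{i, j, k}"] b(7)[of k "{i, j}" i j "{j, k}", folded triple] le
      by (simp add: face_at_def edge_at_def P_pair P_triple subset_insertI2)
  next
    fix i j k l assume le: "i \<le> j" "j \<le> k" and le': "k \<le> l" "l \<le> n"
    have c: "cell_map b i l ({i, l}, {i, j, k, l})
      = Comp (Hom C (obj_map b i) (obj_map b l)) (cell_map b i l ({i, m, l}, {i, j, k, l})) (face_at b i m l)"
      if "m \<in> {j, k}" for m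
      unfolding face_at_def
      by (rule b(5)) (use le le' that in \<open>auto simp: P_iff\<close>)
    \<comment> \<open>Inserting \<open>k\<close> only affects the part from \<open>j\<close> to
      \<open>l\<close>; the part \<open>{i, j}\<close> contributes an identity to the horizontal
      composite.\<close>
    have "cell_map b i l ({i, j, l}, {i, j, k, l}) = cell_map b i l ({j, l} \<union> {i, j}, {j, k, l} \<union> {i, j})"
      by (rule arg_cong[of _ _ "cell_map b i l"]) auto
    also have "\<dots> = Comp2 C (obj_map b i) (obj_map b j) (obj_map b l) (face_at b j k l)
        (Ident (Hom C (obj_map b i) (obj_map b j)) (edge_at b i j))"
      unfolding face_at_def edge_at_def using le le' b(4)[of j "{i, j}" i]
      by (subst b(8)[where i = i and j = j and k = l]) (auto simp: P_iff)
    finally have 1: "cell_map b i l ({i, j, l}, {i, j, k, l}) = \<dots>" .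
    have "cell_map b i l ({i, k, l}, {i, j, k, l}) = cell_map b i l ({k, l} \<union> {i, k}, {k, l} \<union> {i, j, k})"
      by (rule arg_cong[of _ _ "cell_map b i l"]) auto
    also have "\<dots> = Comp2 C (obj_map b i) (obj_map b k) (obj_map b l)
        (Ident (Hom C (obj_map b k) (obj_map b l)) (edge_at b k l)) (face_at b i j k)"
      unfolding face_at_def edge_at_def using le le' b(4)[of l "{k, l}" k]
      by (subst b(8)[where i = i and j = k and k = l]) (auto simp: P_iff)
    finally show "Comp (Hom C (obj_map b i) (obj_map b l))
        (Comp2 C (obj_map b i) (obj_map b j) (obj_map b l) (face_at b j k l)
          (Ident (Hom C (obj_map b i) (obj_map b j)) (edge_at b i j))) (face_at b i j l)
      = Comp (Hom C (obj_map b i) (obj_map b l))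
        (Comp2 C (obj_map b i) (obj_map b k) (obj_map b l)
          (Ident (Hom C (obj_map b k) (obj_map b l)) (edge_at b k l)) (face_at b i j k)) (face_at b i k l)"
      using c[of j] c[of k] 1 by simp
  qed (use b(1,2,4,6) in \<open>auto simp: edge_at_def face_at_def P_pair\<close>)
qed

lemma (in strict_21_category) ex_simplex:
  assumes "simplex_data C n x f a"
  shows "\<exists>b. strict_2_functor (C2 n) C b \<and> (\<forall>i\<le>n. obj_map b i = x i) \<and>
    (\<forall>i j. i \<le> j \<longrightarrow> j \<le> n \<longrightarrow> edge_at b i j = f i j) \<and>
    (\<forall>i j k. i \<le> j \<longrightarrow> j \<le> k \<longrightarrow> k \<le> n \<longrightarrow> face_at b i j k = a i j k)"
proof -
  interpret simplex_data C n x f a by (rule assms)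
  interpret groupoid_simplex_data C n x f a ..
  show ?thesis
    using strict_2_functor_simplex simplex_data_simps by (auto simp: edge_at_def face_at_def)
qed

text \<open>A member of \<open>P i j\<close> other than \<open>{i, j}\<close> has an interior point,
  and cutting it there gives two sets of smaller cardinality whose composite in \<open>C2 n\<close>
  is the given set.\<close>

lemma P_induct [consumes 1, case_names pair Un]:
  assumes "S \<in> P i j" and "\<And>i j. i \<le> j \<Longrightarrow> Q i j {i, j}"
    and "\<And>i j k S T. \<lbrakk>S \<in> P i k; T \<in> P k j; Q i k S; Q k j T\<rbrakk> \<Longrightarrow> Q i j (T \<union> S)"
  shows "Q i j S"
  using assms(1)
proof (induction "card S" arbitrary: i j S rule: less_induct)
  case less
  show ?case
  proof (cases "S = {i, j}")
    case True
    then show ?thesis using assms(2) less P_le by auto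
  next
    case False
    then obtain k where "k \<in> S" "k \<noteq> i" "k \<noteq> j" using less by (auto simp: P_iff)
    then have k: "k \<in> S" "i < k" "k < j" using less(2) by (auto simp: P_iff order_less_le)
    have fin: "finite S" using less(2) finite_subset by (auto simp: P_iff)
    let ?A = "S \<inter> {..k}" and ?B = "S \<inter> {k..}"
    have AB: "?A \<in> P i k" "?B \<in> P k j" using k less(2) by (auto simp: P_iff)
    have "j \<in> S - ?A" "i \<in> S - ?B" using k less(2) by (auto simp: P_iff)
    then have "?A \<subset> S" "?B \<subset> S" by blast+
    then have "card ?A < card S" "card ?B < card S" using fin psubset_card_mono by auto
    moreover have "?B \<union> ?A = S" by auto
    ultimately show ?thesis using assms(3)[OF AB less(1)[OF _ AB(1)] less(1)[OF _ AB(2)]] by simp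
  qed
qed

text \<open>The 1-morphisms of \<open>C2 n\<close> are composed of sets \<open>{i, j}\<close>, and
  its cells of identities and cells from \<open>{i, j}\<close> to \<open>{i, k, j}\<close>. Cells
  out of the least set are compared before general ones, because they are the base case of the
  induction on the smaller set of an inclusion.\<close>

lemma simplex_eqI:
  fixes b c :: "('o, 'm, 'c) simplex"
  assumes b: "strict_2_functor (C2 n) C b" and c: "strict_2_functor (C2 n) C c"
    and ob: "\<And>i. i \<le> n \<Longrightarrow> obj_map b i = obj_map c i"
    and edge: "\<And>i j. \<lbrakk>i \<le> j; j \<le> n\<rbrakk> \<Longrightarrow> edge_at b i j = edge_at c i j"
    and face: "\<And>i j k. \<lbrakk>i \<le> j; j \<le> k; k \<le> n\<rbrakk> \<Longrightarrow> face_at b i j k = face_at c i j k"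
  shows "b = c"
proof -
  note b = strict_2_functor_C2D[OF b] and c = strict_2_functor_C2D[OF c]
  have mor: "mor_map b i j S = mor_map c i j S" if "S \<in> P i j" "j \<le> n" for i j S
    using that
  proof (induction rule: P_induct)
    case (pair i j)
    then show ?case using edge by (simp add: edge_at_def)
  next
    case (Un i j k S T)
    have le: "i \<le> k" "k \<le> j" "j \<le> n" using Un P_le by auto
    then have "i \<le> n" "k \<le> n" by auto
    then show ?case
      using Un le ob by (simp add: b(7)[OF le(3) Un(1,2)] c(7)[OF le(3) Un(1,2)])
  qed
  have cell1: "cell_map b i j ({i, j}, S) = cell_map c i j ({i, j}, S)" if "S \<in> P i j" "j \<le> n" for i j S
    using that
  proof (induction rule: P_induct)
    case (pair i j)
    then have "i \<le> n" by simp
    then show ?case using pair b(4) c(4) mor ob by (simp add: P_pair)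
  next
    case (Un i j k S T)
    have le: "i \<le> k" "k \<le> j" "j \<le> n" using Un P_le by auto
    then have le': "i \<le> n" "k \<le> n" "i \<le> j" by auto
    have sub: "{i, k} \<subseteq> S" "{k, j} \<subseteq> T" "{i, j} \<subseteq> {k, j} \<union> {i, k}" "{k, j} \<union> {i, k} \<subseteq> T \<union> S"
      and tr: "{i, k, j} = {k, j} \<union> {i, k}"
      using Un(1,2) by (auto simp: P_iff)
    note pr = P_pair[OF le(1)] P_pair[OF le(2)] P_pair[OF le'(3)]
    note U = P_Un[OF Un(1,2)] P_Un[OF pr(1,2)]
    \<comment> \<open>The inclusion is factored through \<open>{i, k, j}\<close>: a face, followed
      by a horizontal composite of two smaller inclusions of the same kind.\<close>
    have "cell_map d i j ({i, j}, T \<union> S) = Comp (Hom C (obj_map d i) (obj_map d j))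
        (Comp2 C (obj_map d i) (obj_map d k) (obj_map d j) (cell_map d k j ({k, j}, T)) (cell_map d i k ({i, k}, S)))
        (face_at d i k j)" if d: "strict_2_functor (C2 n) C d" for d
      using strict_2_functor_C2D(5)[OF d le(3) pr(3) U(2) sub(3) U(1) sub(4)]
        strict_2_functor_C2D(8)[OF d le(3) pr(1,2) Un(1) sub(1) Un(2) sub(2)]
      by (simp only: face_at_def tr)
    from this[OF assms(1)] this[OF assms(2)] show ?case
      using Un le le' ob face[OF le] by simp
  qed
  \<comment> \<open>The larger set stays quantified in the induction: the point where
    \<open>S\<close> is cut also lies in \<open>T\<close>, so \<open>T\<close> splits there
    compatibly.\<close>
  have cell: "\<forall>T \<in> P i j. S \<subseteq> T \<longrightarrow> cell_map b i j (S, T) = cell_map c i j (S, T)"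
    if "S \<in> P i j" "j \<le> n" for i j S
    using that
  proof (induction rule: P_induct)
    case (pair i j)
    then show ?case using cell1 by auto
  next
    case (Un i j k S S')
    have le: "i \<le> k" "k \<le> j" "j \<le> n" using Un P_le by auto
    then have le': "i \<le> n" "k \<le> n" "i \<le> j" by auto
    show ?case
    proof (intro ballI impI)
      fix T assume T: "T \<in> P i j" "S' \<union> S \<subseteq> T"
      let ?A = "T \<inter> {..k}" and ?B = "T \<inter> {k..}"
      have AB: "?A \<in> P i k" "S \<subseteq> ?A" "?B \<in> P k j" "S' \<subseteq> ?B" and T_eq: "?B \<union> ?A = T"
        using Un(1,2) T by (auto simp: P_iff)
      show "cell_map b i j (S' \<union> S, T) = cell_map c i j (S' \<union> S, T)"
        using b(8)[OF le(3) Un(1,2) AB] c(8)[OF le(3) Un(1,2) AB] Un(3,4) AB le le' ob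
        unfolding T_eq by simp
    qed
  qed
  have "obj_map b = obj_map c" using ob b(9) c(9) by (metis ext)
  moreover have "mor_map b = mor_map c"
  proof (intro ext)
    fix i j S show "mor_map b i j S = mor_map c i j S"
      using mor[of S i j] b(10)[of j S i] c(10)[of j S i] by (cases "j \<le> n \<and> S \<in> P i j") auto
  qed
  moreover have "cell_map b = cell_map c"
  proof (intro ext)
    fix i j and p :: simplex_cell
    obtain S T where p: "p = (S, T)" by (cases p)
    show "cell_map b i j p = cell_map c i j p"
      unfolding p using cell[of S i j] b(11)[of j S i T] c(11)[of j S i T]
      by (cases "j \<le> n \<and> S \<in> P i j \<and> T \<in> P i j \<and> S \<subseteq> T") auto
  qed
  ultimately show ?thesis by simp
qed

section \<open>Operators and strict 2-functors acting on simplices\<close>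

lemma two_map_comp_C2:
  "i \<le> n \<Longrightarrow> obj_map (two_map_comp (C2 n) G b) i = obj_map G (obj_map b i)"
  "\<lbrakk>j \<le> n; S \<in> P i j\<rbrakk> \<Longrightarrow> mor_map (two_map_comp (C2 n) G b) i j S
    = mor_map G (obj_map b i) (obj_map b j) (mor_map b i j S)"
  "\<lbrakk>j \<le> n; S \<in> P i j; T \<in> P i j; S \<subseteq> T\<rbrakk> \<Longrightarrow> cell_map (two_map_comp (C2 n) G b) i j (S, T)
    = cell_map G (obj_map b i) (obj_map b j) (cell_map b i j (S, T))"
  "\<not> i \<le> n \<Longrightarrow> obj_map (two_map_comp (C2 n) G b) i = undefined"
  "\<not> (j \<le> n \<and> S \<in> P i j) \<Longrightarrow> mor_map (two_map_comp (C2 n) G b) i j S = undefined"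
  "\<not> (j \<le> n \<and> S \<in> P i j \<and> T \<in> P i j \<and> S \<subseteq> T)
    \<Longrightarrow> cell_map (two_map_comp (C2 n) G b) i j (S, T) = undefined"
  using P_le[of S i j]
  by (auto simp: two_map_comp_def C2_simps C2_Obj C2_Arr)

lemma Delta_maps_le:
  assumes "\<alpha> \<in> Delta_maps m n"
  shows "i \<le> m \<Longrightarrow> \<alpha> i \<le> n" and "\<lbrakk>i \<le> j; j \<le> m\<rbrakk> \<Longrightarrow> \<alpha> i \<le> \<alpha> j"
  using assms by (auto simp: Delta_maps_def mono_on_def)

lemma Delta_maps_P:
  assumes "\<alpha> \<in> Delta_maps m n" "j \<le> m" "S \<in> P i j"
  shows "\<alpha> ` S \<in> P (\<alpha> i) (\<alpha> j)"
proof -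
  have "\<alpha> i \<le> \<alpha> s \<and> \<alpha> s \<le> \<alpha> j" if "s \<in> S" for s
  proof -
    have "i \<le> s" "s \<le> j" using assms(3) that by (auto simp: P_iff)
    then show ?thesis using Delta_maps_le(2)[OF assms(1)] assms(2) by simp
  qed
  then have "\<alpha> ` S \<subseteq> {\<alpha> i..\<alpha> j}" by auto
  then show ?thesis using assms(3) by (simp add: P_iff)
qed

lemma two_map_comp_C2_map:
  "i \<le> m \<Longrightarrow> obj_map (two_map_comp (C2 m) b (C2_map \<alpha>)) i = obj_map b (\<alpha> i)"
  "\<lbrakk>j \<le> m; S \<in> P i j\<rbrakk> \<Longrightarrow> mor_map (two_map_comp (C2 m) b (C2_map \<alpha>)) i j S
    = mor_map b (\<alpha> i) (\<alpha> j) (\<alpha> ` S)"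
  "\<lbrakk>j \<le> m; S \<in> P i j; T \<in> P i j; S \<subseteq> T\<rbrakk> \<Longrightarrow> cell_map (two_map_comp (C2 m) b (C2_map \<alpha>)) i j (S, T)
    = cell_map b (\<alpha> i) (\<alpha> j) (\<alpha> ` S, \<alpha> ` T)"
  by (simp_all add: two_map_comp_C2 C2_map_def)

text \<open>\<open>C2_map \<alpha>\<close> is not \<open>undefined\<close> outside its domain and
  hence no \<open>strict_2_functor\<close>, so closure under composition cannot be quoted. The laws
  follow because images under \<open>\<alpha>\<close> preserve inclusions and unions and send
  \<open>P i j\<close> into \<open>P (\<alpha> i) (\<alpha> j)\<close>.\<close>

lemma strict_2_functor_Op:
  assumes b: "strict_2_functor (C2 n) C b" and \<alpha>: "\<alpha> \<in> Delta_maps m n"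
  shows "strict_2_functor (C2 m) C (two_map_comp (C2 m) b (C2_map \<alpha>))"
proof -
  note b = strict_2_functor_C2D[OF b]
  note im = Delta_maps_P[OF \<alpha>] and le = Delta_maps_le[OF \<alpha>]
  note c = two_map_comp_C2_map[where b = b and \<alpha> = \<alpha> and m = m]
  show ?thesis
  proof (rule strict_2_functor_C2I)
    fix i j S assume S: "j \<le> m" "S \<in> P i j"
    then have i: "i \<le> m" using P_le by force
    note \<alpha>j = le(1)[OF S(1)]
    show "mor_map (two_map_comp (C2 m) b (C2_map \<alpha>)) i j S \<in> Obj (Hom C
        (obj_map (two_map_comp (C2 m) b (C2_map \<alpha>)) i) (obj_map (two_map_comp (C2 m) b (C2_map \<alpha>)) j))"
      using b(2)[OF \<alpha>j im[OF S]] S i by (simp add: c)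
    show "cell_map (two_map_comp (C2 m) b (C2_map \<alpha>)) i j (S, S) = Ident (Hom C
        (obj_map (two_map_comp (C2 m) b (C2_map \<alpha>)) i) (obj_map (two_map_comp (C2 m) b (C2_map \<alpha>)) j))
        (mor_map (two_map_comp (C2 m) b (C2_map \<alpha>)) i j S)"
      using b(4)[OF \<alpha>j im[OF S]] S i by (simp add: c)
    fix T assume T: "T \<in> P i j" "S \<subseteq> T"
    note ST = image_mono[OF T(2), of \<alpha>]
    show "cell_map (two_map_comp (C2 m) b (C2_map \<alpha>)) i j (S, T) \<in> arrows (Hom C
        (obj_map (two_map_comp (C2 m) b (C2_map \<alpha>)) i) (obj_map (two_map_comp (C2 m) b (C2_map \<alpha>)) j))
        (mor_map (two_map_comp (C2 m) b (C2_map \<alpha>)) i j S)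
        (mor_map (two_map_comp (C2 m) b (C2_map \<alpha>)) i j T)"
      using b(3)[OF \<alpha>j im[OF S] im[OF S(1) T(1)] ST] S T i by (simp add: c)
    fix U assume U: "U \<in> P i j" "T \<subseteq> U"
    then have "S \<subseteq> U" using T by auto
    then show "cell_map (two_map_comp (C2 m) b (C2_map \<alpha>)) i j (S, U) = Comp (Hom C
        (obj_map (two_map_comp (C2 m) b (C2_map \<alpha>)) i) (obj_map (two_map_comp (C2 m) b (C2_map \<alpha>)) j))
        (cell_map (two_map_comp (C2 m) b (C2_map \<alpha>)) i j (T, U))
        (cell_map (two_map_comp (C2 m) b (C2_map \<alpha>)) i j (S, T))"
      using b(5)[OF \<alpha>j im[OF S] im[OF S(1) T(1)] ST im[OF S(1) U(1)] image_mono[OF U(2)]] S T U i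
      by (simp add: c)
  next
    fix i j k S T assume S: "k \<le> m" "S \<in> P i j" "T \<in> P j k"
    then have i: "i \<le> m" "j \<le> m" using P_le[OF S(2)] P_le[OF S(3)] by auto
    note \<alpha>k = le(1)[OF S(1)] and U = P_Un[OF S(2,3)]
    show "mor_map (two_map_comp (C2 m) b (C2_map \<alpha>)) i k (T \<union> S) = Comp1 C
        (obj_map (two_map_comp (C2 m) b (C2_map \<alpha>)) i) (obj_map (two_map_comp (C2 m) b (C2_map \<alpha>)) j)
        (obj_map (two_map_comp (C2 m) b (C2_map \<alpha>)) k)
        (mor_map (two_map_comp (C2 m) b (C2_map \<alpha>)) j k T)
        (mor_map (two_map_comp (C2 m) b (C2_map \<alpha>)) i j S)"
      using b(7)[OF \<alpha>k im[OF i(2) S(2)] im[OF S(1,3)]] S i U by (simp add: c image_Un)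
    fix S' T' assume S': "S' \<in> P i j" "S \<subseteq> S'" "T' \<in> P j k" "T \<subseteq> T'"
    note U' = P_Un[OF S'(1,3)] and sub = Un_mono[OF S'(4,2)]
    show "cell_map (two_map_comp (C2 m) b (C2_map \<alpha>)) i k (T \<union> S, T' \<union> S') = Comp2 C
        (obj_map (two_map_comp (C2 m) b (C2_map \<alpha>)) i) (obj_map (two_map_comp (C2 m) b (C2_map \<alpha>)) j)
        (obj_map (two_map_comp (C2 m) b (C2_map \<alpha>)) k)
        (cell_map (two_map_comp (C2 m) b (C2_map \<alpha>)) j k (T, T'))
        (cell_map (two_map_comp (C2 m) b (C2_map \<alpha>)) i j (S, S'))"
      using b(8)[OF \<alpha>k im[OF i(2) S(2)] im[OF S(1,3)] im[OF i(2) S'(1)] image_mono[OF S'(2)]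
          im[OF S(1) S'(3)] image_mono[OF S'(4)]] S S' i
      by (simp only: c two_map_comp_C2_map(3)[OF S(1) U U' sub] image_Un)
  next
    fix i assume "i \<le> m"
    then show "mor_map (two_map_comp (C2 m) b (C2_map \<alpha>)) i i {i}
        = Unit C (obj_map (two_map_comp (C2 m) b (C2_map \<alpha>)) i)"
      using b(6) le by (simp add: c P_iff)
  qed (use b(1) le in \<open>auto simp: c two_map_comp_C2(4-6)\<close>)
qed

lemma strict_2_functor_postcomp:
  assumes b: "strict_2_functor (C2 n) C b" and G: "strict_2_functor C D G"
  shows "strict_2_functor (C2 n) D (two_map_comp (C2 n) G b)"
proof -
  interpret G: strict_2_functor C D G by (rule G)
  note b = strict_2_functor_C2D[OF b]
  note c = two_map_comp_C2[where b = b and G = G and n = n]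
  show ?thesis
  proof (rule strict_2_functor_C2I)
    fix i j S assume S: "j \<le> n" "S \<in> P i j"
    then have i: "i \<le> n" using P_le by force
    interpret Gij: is_functor "Hom C (obj_map b i) (obj_map b j)"
      "Hom D (obj_map G (obj_map b i)) (obj_map G (obj_map b j))"
      "mor_map G (obj_map b i) (obj_map b j)" "cell_map G (obj_map b i) (obj_map b j)"
      using G.hom_functor b(1) S i by auto
    show "mor_map (two_map_comp (C2 n) G b) i j S \<in> Obj (Hom D
        (obj_map (two_map_comp (C2 n) G b) i) (obj_map (two_map_comp (C2 n) G b) j))"
      using Gij.map_Obj[OF b(2)[OF S]] S i by (simp add: c)
    show "cell_map (two_map_comp (C2 n) G b) i j (S, S) = Ident (Hom D
        (obj_map (two_map_comp (C2 n) G b) i) (obj_map (two_map_comp (C2 n) G b) j))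
        (mor_map (two_map_comp (C2 n) G b) i j S)"
      using Gij.map_Ident[OF b(2)[OF S]] b(4)[OF S] S i by (simp add: c)
    fix T assume T: "T \<in> P i j" "S \<subseteq> T"
    note ST = b(3)[OF S T]
    show "cell_map (two_map_comp (C2 n) G b) i j (S, T) \<in> arrows (Hom D
        (obj_map (two_map_comp (C2 n) G b) i) (obj_map (two_map_comp (C2 n) G b) j))
        (mor_map (two_map_comp (C2 n) G b) i j S) (mor_map (two_map_comp (C2 n) G b) i j T)"
      using Gij.map_arrows[OF ST] S T i by (simp add: c)
    fix U assume U: "U \<in> P i j" "T \<subseteq> U"
    then have SU: "S \<subseteq> U" using T by auto
    show "cell_map (two_map_comp (C2 n) G b) i j (S, U) = Comp (Hom D
        (obj_map (two_map_comp (C2 n) G b) i) (obj_map (two_map_comp (C2 n) G b) j))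
        (cell_map (two_map_comp (C2 n) G b) i j (T, U)) (cell_map (two_map_comp (C2 n) G b) i j (S, T))"
      using Gij.map_Comp[of "cell_map b i j (S, T)" "cell_map b i j (T, U)"] ST b(3)[OF S(1) T(1) U]
        b(5)[OF S T U] S T U i SU by (simp add: c arrows_iff)
  next
    fix i j k S T assume S: "k \<le> n" "S \<in> P i j" "T \<in> P j k"
    then have i: "i \<le> n" "j \<le> n" using P_le[OF S(2)] P_le[OF S(3)] by auto
    note ob = b(1)[OF i(1)] b(1)[OF i(2)] b(1)[OF S(1)] and U = P_Un[OF S(2,3)]
    show "mor_map (two_map_comp (C2 n) G b) i k (T \<union> S) = Comp1 D
        (obj_map (two_map_comp (C2 n) G b) i) (obj_map (two_map_comp (C2 n) G b) j)
        (obj_map (two_map_comp (C2 n) G b) k)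
        (mor_map (two_map_comp (C2 n) G b) j k T) (mor_map (two_map_comp (C2 n) G b) i j S)"
      using G.mor_map_Comp1[OF ob b(2)[OF i(2) S(2)] b(2)[OF S(1,3)]] b(7)[OF S] S i U by (simp add: c)
    fix S' T' assume S': "S' \<in> P i j" "S \<subseteq> S'" "T' \<in> P j k" "T \<subseteq> T'"
    note U' = P_Un[OF S'(1,3)] and sub = Un_mono[OF S'(4,2)]
    show "cell_map (two_map_comp (C2 n) G b) i k (T \<union> S, T' \<union> S') = Comp2 D
        (obj_map (two_map_comp (C2 n) G b) i) (obj_map (two_map_comp (C2 n) G b) j)
        (obj_map (two_map_comp (C2 n) G b) k)
        (cell_map (two_map_comp (C2 n) G b) j k (T, T')) (cell_map (two_map_comp (C2 n) G b) i j (S, S'))"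
      using G.cell_map_Comp2[OF ob, of "cell_map b i j (S, S')" "cell_map b j k (T, T')"]
        b(3)[OF i(2) S(2) S'(1,2)] b(3)[OF S(1,3) S'(3,4)] b(8)[OF S S'] S S' i
      by (simp add: c arrows_iff two_map_comp_C2(3)[OF S(1) U U' sub])
  next
    fix i assume "i \<le> n"
    then show "mor_map (two_map_comp (C2 n) G b) i i {i} = Unit D (obj_map (two_map_comp (C2 n) G b) i)"
      using b(1,6) G.mor_map_Unit by (simp add: c P_iff)
  qed (use b(1) G.obj_map_Ob in \<open>auto simp: c\<close>)
qed

section \<open>The nerve as a simplicial set\<close>

lemma nerve_simps:
  "b \<in> Simp (nerve C) n \<longleftrightarrow> strict_2_functor (C2 n) C b"
  "Op (nerve C) m n \<alpha> b = two_map_comp (C2 m) b (C2_map \<alpha>)"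
  by (simp_all add: nerve_def)

text \<open>Images commute with insertion of elements. As the indices on the right may coincide,
  operators that identify vertices are covered and degenerate simplices need no separate
  treatment.\<close>

lemma Op_data:
  "i \<le> m \<Longrightarrow> obj_map (Op (nerve C) m n \<alpha> b) i = obj_map b (\<alpha> i)"
  "\<lbrakk>i \<le> j; j \<le> m\<rbrakk> \<Longrightarrow> edge_at (Op (nerve C) m n \<alpha> b) i j = edge_at b (\<alpha> i) (\<alpha> j)"
  "\<lbrakk>i \<le> j; j \<le> k; k \<le> m\<rbrakk> \<Longrightarrow> face_at (Op (nerve C) m n \<alpha> b) i j k = face_at b (\<alpha> i) (\<alpha> j) (\<alpha> k)"
proof -
  assume "i \<le> j" "j \<le> k" "k \<le> m"
  then show "face_at (Op (nerve C) m n \<alpha> b) i j k = face_at b (\<alpha> i) (\<alpha> j) (\<alpha> k)"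
    using two_map_comp_C2_map(3)[of k m "{i, k}" i "{i, j, k}" b \<alpha>]
    by (simp add: face_at_def nerve_simps P_pair P_triple subset_insertI2)
qed (simp_all add: edge_at_def nerve_simps two_map_comp_C2_map P_pair)

lemma Op_in: "\<lbrakk>\<alpha> \<in> Delta_maps m n; b \<in> Simp (nerve C) n\<rbrakk> \<Longrightarrow> Op (nerve C) m n \<alpha> b \<in> Simp (nerve C) m"
  using strict_2_functor_Op by (simp add: nerve_simps)

lemma nerve_eqI:
  assumes "b \<in> Simp (nerve C) n" "c \<in> Simp (nerve C) n"
    and "\<And>i. i \<le> n \<Longrightarrow> obj_map b i = obj_map c i"
    and "\<And>i j. \<lbrakk>i \<le> j; j \<le> n\<rbrakk> \<Longrightarrow> edge_at b i j = edge_at c i j"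
    and "\<And>i j k. \<lbrakk>i \<le> j; j \<le> k; k \<le> n\<rbrakk> \<Longrightarrow> face_at b i j k = face_at c i j k"
  shows "b = c"
  using assms(1,2)[unfolded nerve_simps] assms(3-) by (rule simplex_eqI)

text \<open>By \<open>nerve_eqI\<close> the identity and composition laws become laws of index
  substitution.\<close>

lemma simplicial_set_nerve: "simplicial_set (nerve C)"
proof
  fix \<alpha> m n b assume "\<alpha> \<in> Delta_maps m n" "b \<in> Simp (nerve C) n"
  then show "Op (nerve C) m n \<alpha> b \<in> Simp (nerve C) m" by (rule Op_in)
next
  fix b n assume b: "b \<in> Simp (nerve C) n"
  have "(\<lambda>i\<in>{..n}. i) \<in> Delta_maps n n" by (auto simp: Delta_maps_def mono_on_def)
  from nerve_eqI[OF Op_in[OF this b] b] show "Op (nerve C) n n (\<lambda>i\<in>{..n}. i) b = b"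
    by (auto simp: Op_data)
next
  fix \<alpha> l m \<beta> n b
  assume \<alpha>: "\<alpha> \<in> Delta_maps l m" and \<beta>: "\<beta> \<in> Delta_maps m n" and b: "b \<in> Simp (nerve C) n"
  have "compose {..l} \<beta> \<alpha> \<in> Delta_maps l n"
    using Delta_maps_le[OF \<alpha>] Delta_maps_le[OF \<beta>]
    by (auto simp: Delta_maps_def mono_on_def compose_def)
  from nerve_eqI[OF Op_in[OF this b] Op_in[OF \<alpha> Op_in[OF \<beta> b]]]
  show "Op (nerve C) l n (compose {..l} \<beta> \<alpha>) b = Op (nerve C) l m \<alpha> (Op (nerve C) m n \<beta> b)"
    using Delta_maps_le[OF \<alpha>] by (auto simp: Op_data compose_def)
qed

section \<open>Simplices of dimension at most three\<close>

context strict_2_category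
begin

text \<open>With identities filled in at coinciding indices, the coherence equation collapses to
  unit laws whenever two neighbouring indices agree. Only strictly increasing indices remain to be
  checked by hand.\<close>

lemma simplex_data_pad:
  fixes x :: "nat \<Rightarrow> 'o" and f :: "nat \<Rightarrow> nat \<Rightarrow> 'm" and a :: "nat \<Rightarrow> nat \<Rightarrow> nat \<Rightarrow> 'c"
  defines "f' \<equiv> \<lambda>i j. if i < j then f i j else Unit C (x i)"
  defines "a' \<equiv> \<lambda>i j k. if i < j \<and> j < k then a i j k else Ident (Hom C (x i) (x k)) (f' i k)"
  assumes x: "\<And>i. i \<le> n \<Longrightarrow> x i \<in> Ob C"
    and f: "\<And>i j. \<lbrakk>i < j; j \<le> n\<rbrakk> \<Longrightarrow> f i j \<in> Obj (Hom C (x i) (x j))"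
    and a: "\<And>i j k. \<lbrakk>i < j; j < k; k \<le> n\<rbrakk> \<Longrightarrow>
      a i j k \<in> arrows (Hom C (x i) (x k)) (f i k) (Comp1 C (x i) (x j) (x k) (f j k) (f i j))"
    and coherence: "\<And>i j k l. \<lbrakk>i < j; j < k; k < l; l \<le> n\<rbrakk> \<Longrightarrow>
      Comp (Hom C (x i) (x l))
        (Comp2 C (x i) (x j) (x l) (a j k l) (Ident (Hom C (x i) (x j)) (f i j))) (a i j l)
      = Comp (Hom C (x i) (x l))
        (Comp2 C (x i) (x k) (x l) (Ident (Hom C (x k) (x l)) (f k l)) (a i j k)) (a i k l)"
  shows "simplex_data C n x f' a'"
proof
  show x': "x i \<in> Ob C" if "i \<le> n" for i using x that .
  show f': "f' i j \<in> Obj (Hom C (x i) (x j))" if "i \<le> j" "j \<le> n" for i j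
    using that f x Unit_Obj by (auto simp: f'_def)
  have refl: "f' i i = Unit C (x i)" for i by (simp add: f'_def)
  then show "f' i i = Unit C (x i)" for i .
  show a': "a' i j k \<in> arrows (Hom C (x i) (x k)) (f' i k) (Comp1 C (x i) (x j) (x k) (f' j k) (f' i j))"
    if le: "i \<le> j" "j \<le> k" "k \<le> n" for i j k
  proof -
    have ob: "x i \<in> Ob C" "x j \<in> Ob C" "x k \<in> Ob C" using x le by auto
    consider "i = j" | "j = k" | "i < j" "j < k" using le by linarith
    then show ?thesis
    proof cases
      case 1
      then show ?thesis using Ident_in[OF ob(1,3) f'] le
        by (simp add: a'_def Comp1_Unit_right[OF ob(2,3) f'] refl)
    next
      case 2
      then show ?thesis using Ident_in[OF ob(1,3) f'] le
        by (simp add: a'_def Comp1_Unit_left[OF ob(1,3) f'] refl)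
    qed (use a le in \<open>simp add: a'_def f'_def\<close>)
  qed
  show left: "a' i i j = Ident (Hom C (x i) (x j)) (f' i j)"
    and right: "a' i j j = Ident (Hom C (x i) (x j)) (f' i j)" for i j by (simp_all add: a'_def)
  fix i j k l assume le: "i \<le> j" "j \<le> k" "k \<le> l" "l \<le> n"
  then have ob: "x i \<in> Ob C" "x j \<in> Ob C" "x k \<in> Ob C" "x l \<in> Ob C" using x by auto
  have le': "i \<le> k" "i \<le> l" "j \<le> l" "j \<le> n" "k \<le> n" using le by auto
  consider "i = j" | "j = k" | "k = l" | "i < j" "j < k" "k < l" using le by linarith
  then show "Comp (Hom C (x i) (x l))
        (Comp2 C (x i) (x j) (x l) (a' j k l) (Ident (Hom C (x i) (x j)) (f' i j))) (a' i j l)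
      = Comp (Hom C (x i) (x l))
        (Comp2 C (x i) (x k) (x l) (Ident (Hom C (x k) (x l)) (f' k l)) (a' i j k)) (a' i k l)"
  proof cases
    case 1
    have "Comp (Hom C (x j) (x l)) (a' j k l) (Ident (Hom C (x j) (x l)) (f' j l)) = a' j k l"
      "Comp (Hom C (x j) (x l)) (Ident (Hom C (x j) (x l)) (Comp1 C (x j) (x k) (x l) (f' k l) (f' j k))) (a' j k l) = a' j k l"
      using Comp_Ident[OF ob(2,4) a'] Ident_Comp[OF ob(2,4) a'] le by auto
    then show ?thesis
      using 1 Comp2_Ident[OF ob(2-4) f' f'] le Comp2_Unit_right_in[OF ob(2,4) a'[OF le(2-4)]]
      by (simp add: left refl)
  next
    case 2
    then show ?thesis
      using Comp2_Ident[OF ob(1,3,4) f' f'] le le' by (simp add: left right)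
  next
    case 3
    have "Comp (Hom C (x i) (x l)) (a' i j l) (Ident (Hom C (x i) (x l)) (f' i l)) = a' i j l"
      "Comp (Hom C (x i) (x l)) (Ident (Hom C (x i) (x l)) (Comp1 C (x i) (x j) (x l) (f' j l) (f' i j))) (a' i j l) = a' i j l"
      using Comp_Ident[OF ob(1,4) a'] Ident_Comp[OF ob(1,4) a'] le le' by auto
    then show ?thesis
      using 3 Comp2_Ident[OF ob(1,2,4) f' f'] le le' Comp2_Unit_left_in[OF ob(1,4) a'[OF le(1) le'(3) le(4)]]
      by (simp add: right refl)
  next
    case 4
    then show ?thesis using coherence le by (simp add: a'_def f'_def)
  qed
qed

end

lemma less_3_cases: "\<lbrakk>i < j; j \<le> (3::nat)\<rbrakk> \<Longrightarrow>
  (i = 0 \<and> j = 1) \<or> (i = 0 \<and> j = 2) \<or> (i = 0 \<and> j = 3) \<or> (i = 1 \<and> j = 2) \<or> (i = 1 \<and> j = 3) \<or> (i = 2 \<and> j = 3)"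
  by (auto simp: numeral_3_eq_3 numeral_2_eq_2 le_Suc_eq less_Suc_eq)

context strict_21_category
begin

text \<open>The source of the 3-simplices used below. Their images under a simplicial map yield
  equations in the target, and their faces supply the triangles and edges on which
  \<open>pseudofunctor_of\<close> evaluates.\<close>

lemma ex_tetrahedron:
  assumes ob: "x0 \<in> Ob C" "x1 \<in> Ob C" "x2 \<in> Ob C" "x3 \<in> Ob C"
    and f: "f01 \<in> Obj (Hom C x0 x1)" "f12 \<in> Obj (Hom C x1 x2)" "f23 \<in> Obj (Hom C x2 x3)"
      "f02 \<in> Obj (Hom C x0 x2)" "f13 \<in> Obj (Hom C x1 x3)" "f03 \<in> Obj (Hom C x0 x3)"
    and a: "a012 \<in> arrows (Hom C x0 x2) f02 (Comp1 C x0 x1 x2 f12 f01)"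
      "a123 \<in> arrows (Hom C x1 x3) f13 (Comp1 C x1 x2 x3 f23 f12)"
      "a013 \<in> arrows (Hom C x0 x3) f03 (Comp1 C x0 x1 x3 f13 f01)"
      "a023 \<in> arrows (Hom C x0 x3) f03 (Comp1 C x0 x2 x3 f23 f02)"
    and coherence: "Comp (Hom C x0 x3) (Comp2 C x0 x1 x3 a123 (Ident (Hom C x0 x1) f01)) a013
      = Comp (Hom C x0 x3) (Comp2 C x0 x2 x3 (Ident (Hom C x2 x3) f23) a012) a023"
  shows "\<exists>b \<in> Simp (nerve C) 3.
    obj_map b 0 = x0 \<and> obj_map b 1 = x1 \<and> obj_map b 2 = x2 \<and> obj_map b 3 = x3 \<and>
    edge_at b 0 1 = f01 \<and> edge_at b 1 2 = f12 \<and> edge_at b 2 3 = f23 \<and>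
    edge_at b 0 2 = f02 \<and> edge_at b 1 3 = f13 \<and> edge_at b 0 3 = f03 \<and>
    face_at b 0 1 2 = a012 \<and> face_at b 1 2 3 = a123 \<and> face_at b 0 1 3 = a013 \<and> face_at b 0 2 3 = a023"
proof -
  \<comment> \<open>Only strictly increasing indices up to 3 are relevant, so the last branch of
    each case distinction can serve as a catch-all.\<close>
  define x where "x i = (if i = 0 then x0 else if i = 1 then x1 else if i = 2 then x2 else x3)" for i :: nat
  define f where "f i j = (if i = 0 then if j = 1 then f01 else if j = 2 then f02 else f03
    else if i = 1 then if j = 2 then f12 else f13 else f23)" for i j :: nat
  define a where "a i j k = (if i = 0 then if j = 1 then if k = 2 then a012 else a013 else a023 else a123)"
    for i j k :: nat
  note d = x_def f_def a_def
  have "simplex_data C 3 x (\<lambda>i j. if i < j then f i j else Unit C (x i))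
    (\<lambda>i j k. if i < j \<and> j < k then a i j k
      else Ident (Hom C (x i) (x k)) (if i < k then f i k else Unit C (x i)))"
  proof (rule simplex_data_pad)
    show "x i \<in> Ob C" for i using ob by (simp add: d)
    show "f i j \<in> Obj (Hom C (x i) (x j))" if "i < j" "j \<le> 3" for i j
      using less_3_cases[OF that] f by (elim disjE) (simp_all add: d)
    show "a i j k \<in> arrows (Hom C (x i) (x k)) (f i k) (Comp1 C (x i) (x j) (x k) (f j k) (f i j))"
      if le: "i < j" "j < k" "k \<le> 3" for i j k
    proof -
      have "(i = 0 \<and> j = 1 \<and> k = 2) \<or> (i = 0 \<and> j = 1 \<and> k = 3) \<or> (i = 0 \<and> j = 2 \<and> k = 3) \<or>
        (i = 1 \<and> j = 2 \<and> k = 3)" using le by arith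
      then show ?thesis using a by (elim disjE) (simp_all add: d)
    qed
    fix i j k l :: nat assume "i < j" "j < k" "k < l" "l \<le> 3"
    then have "i = 0" "j = 1" "k = 2" "l = 3" by arith+
    then show "Comp (Hom C (x i) (x l))
        (Comp2 C (x i) (x j) (x l) (a j k l) (Ident (Hom C (x i) (x j)) (f i j))) (a i j l)
      = Comp (Hom C (x i) (x l))
        (Comp2 C (x i) (x k) (x l) (Ident (Hom C (x k) (x l)) (f k l)) (a i j k)) (a i k l)"
      using coherence by (simp add: d)
  qed
  from ex_simplex[OF this] obtain b where b: "strict_2_functor (C2 3) C b"
    "\<forall>i\<le>3. obj_map b i = x i"
    "\<forall>i j. i \<le> j \<longrightarrow> j \<le> 3 \<longrightarrow> edge_at b i j = (if i < j then f i j else Unit C (x i))"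
    "\<forall>i j k. i \<le> j \<longrightarrow> j \<le> k \<longrightarrow> k \<le> 3 \<longrightarrow> face_at b i j k = (if i < j \<and> j < k then a i j k
      else Ident (Hom C (x i) (x k)) (if i < k then f i k else Unit C (x i)))"
    by blast
  show ?thesis by (intro bexI[of _ b] conjI) (simp_all add: b nerve_simps d)
qed

end

section \<open>Low-dimensional simplices as explicit records\<close>

definition pick :: "nat \<Rightarrow> nat \<Rightarrow> nat \<Rightarrow> nat \<Rightarrow> nat" where
  "pick i j k = (\<lambda>l\<in>{..2}. if l = 0 then i else if l = 1 then j else k)"

lemma pick_Delta_maps: "\<lbrakk>i \<le> j; j \<le> k; k \<le> n\<rbrakk> \<Longrightarrow> pick i j k \<in> Delta_maps 2 n"
  by (auto simp: pick_def Delta_maps_def mono_on_def)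

lemma pick_simps: "pick i j k 0 = i" "pick i j k (Suc 0) = j" "pick i j k 2 = k"
  by (simp_all add: pick_def)

lemma const_Delta_maps: "i \<le> n \<Longrightarrow> (\<lambda>l\<in>{..m}. i) \<in> Delta_maps m n"
  by (auto simp: Delta_maps_def mono_on_def)

lemma pair_Delta_maps: "\<lbrakk>i \<le> j; j \<le> n\<rbrakk> \<Longrightarrow> (\<lambda>l\<in>{..1}. if l = 0 then i else j) \<in> Delta_maps 1 n"
  by (auto simp: Delta_maps_def mono_on_def)

text \<open>Separates the two 1-morphisms from 0 to 2 when the branches of \<open>triangle\<close>
  are evaluated.\<close>

lemma insert_0_2_neq: "{0, 2} \<noteq> {0, Suc 0, 2}" "{0, Suc 0, 2} \<noteq> {0, 2}"
proof -
  have "Suc 0 \<in> {0, Suc 0, 2}" "Suc 0 \<notin> {0, 2}" by simp_all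
  then show "{0, 2} \<noteq> {0, Suc 0, 2}" "{0, Suc 0, 2} \<noteq> {0, 2}" by metis+
qed

lemma P_low:
  "S \<in> P 0 0 \<longleftrightarrow> S = {0}"
  "S \<in> P 1 1 \<longleftrightarrow> S = {1}"
  "S \<in> P 2 2 \<longleftrightarrow> S = {2}"
  "S \<in> P 0 1 \<longleftrightarrow> S = {0, 1}"
  "S \<in> P 1 2 \<longleftrightarrow> S = {1, 2}"
  "S \<in> P 0 2 \<longleftrightarrow> S = {0, 2} \<or> S = {0, 1, 2}"
proof -
  have "{0..1} = {0, 1::nat}" "{1..2} = {1, 2::nat}" "{0..2} = {0, 1, 2::nat}" by auto
  then show "S \<in> P 0 1 \<longleftrightarrow> S = {0, 1}" "S \<in> P 1 2 \<longleftrightarrow> S = {1, 2}"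
    "S \<in> P 0 2 \<longleftrightarrow> S = {0, 2} \<or> S = {0, 1, 2}"
    unfolding P_iff by auto
qed (auto simp: P_iff)

text \<open>The disjuncts follow the branches of \<open>triangle\<close>, so a case distinction
  selects a branch and the negation refutes every guard.\<close>

lemma P_le_2_iff: "j \<le> 2 \<and> S \<in> P i j \<longleftrightarrow>
    i = 0 \<and> j = 0 \<and> S = {0} \<or> i = 1 \<and> j = 1 \<and> S = {1} \<or> i = 2 \<and> j = 2 \<and> S = {2} \<or>
    i = 0 \<and> j = 1 \<and> S = {0, 1} \<or> i = 1 \<and> j = 2 \<and> S = {1, 2} \<or>
    i = 0 \<and> j = 2 \<and> S = {0, 2} \<or> i = 0 \<and> j = 2 \<and> S = {0, 1, 2}" (is "?L \<longleftrightarrow> ?R")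
proof
  assume L: ?L
  then have "i = 0 \<and> j = 0 \<or> i = 1 \<and> j = 1 \<or> i = 2 \<and> j = 2 \<or> i = 0 \<and> j = 1 \<or> i = 1 \<and> j = 2 \<or> i = 0 \<and> j = 2"
    using P_le[of S i j] by arith
  then show ?R using L by (elim disjE) (auto simp only: P_low)
next
  assume ?R then show ?L by (elim disjE) (simp_all add: P_low[unfolded One_nat_def])
qed

text \<open>In dimension 2, \<open>pseudofunctor_of\<close> evaluates a simplicial map only on
  records of the form \<open>triangle\<close>. This normal form makes its values available for every
  2-simplex.\<close>

lemma nerve_2_eq_triangle:
  assumes "b \<in> Simp (nerve C) 2"
  shows "b = triangle C (obj_map b 0) (obj_map b 1) (obj_map b 2)
    (edge_at b 0 1) (edge_at b 1 2) (edge_at b 0 2) (face_at b 0 1 2)"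
proof (rule two_map.equality)
  note b = strict_2_functor_C2D[OF assms[unfolded nerve_simps]]
  let ?t = "triangle C (obj_map b 0) (obj_map b 1) (obj_map b 2)
    (edge_at b 0 1) (edge_at b 1 2) (edge_at b 0 2) (face_at b 0 1 2)"
  \<comment> \<open>The only 1-morphism of \<open>C2 2\<close> that is neither a unit nor an edge;
    composition forces its value.\<close>
  have c: "mor_map b 0 2 {0, 1, 2} = Comp1 C (obj_map b 0) (obj_map b 1) (obj_map b 2)
      (edge_at b 1 2) (edge_at b 0 1)"
    using b(7)[of 2 "{0, 1}" 0 1 "{1, 2}"] P_low by (simp add: edge_at_def insert_commute)
  show "obj_map b = obj_map ?t"
  proof
    fix i show "obj_map b i = obj_map ?t i"
      using b(9)[of i] by (cases "i = 0 \<or> i = 1 \<or> i = 2") (auto simp: triangle_def)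
  qed
  show "mor_map b = mor_map ?t"
  proof (intro ext)
    fix i j S
    show "mor_map b i j S = mor_map ?t i j S"
    proof (cases "j \<le> 2 \<and> S \<in> P i j")
      case True
      then show ?thesis unfolding P_le_2_iff
        by (elim disjE) (simp_all add: triangle_def edge_at_def b(6)[simplified] c[unfolded edge_at_def, simplified] insert_0_2_neq)
    next
      case False
      then have "mor_map b i j S = undefined" using b(10) by blast
      moreover have "mor_map ?t i j S = undefined"
        using False unfolding P_le_2_iff de_Morgan_disj
        by (elim conjE) (simp only: triangle_def two_map.select_convs if_False)
      ultimately show ?thesis by simp
    qed
  qed
  show "cell_map b = cell_map ?t"
  proof (intro ext)
    fix i j and p :: simplex_cell
    obtain S T where p: "p = (S, T)" by (cases p)
    show "cell_map b i j p = cell_map ?t i j p"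
    proof (cases "j \<le> 2 \<and> S \<in> P i j \<and> T \<in> P i j \<and> S \<subseteq> T")
      case True
      show ?thesis
      proof (cases "S = T")
        case eq: True
        have "cell_map b i j (S, S) = Ident (Hom C (obj_map b i) (obj_map b j)) (mor_map b i j S)"
          using b(4) True by simp
        moreover have "j \<le> 2 \<and> S \<in> P i j" using True by simp
        ultimately show ?thesis unfolding P_le_2_iff p
          by (elim disjE) (simp_all add: triangle_def edge_at_def b(6)[simplified] c[unfolded edge_at_def, simplified]
              insert_0_2_neq eq[symmetric])
      next
        case False
        have "j \<le> 2 \<and> S \<in> P i j" "j \<le> 2 \<and> T \<in> P i j" "S \<subseteq> T" using True by simp_all
        \<comment> \<open>For \<open>j \<le> 2\<close> this is the only proper inclusion between
          members of one \<open>P i j\<close>.\<close>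
        then have "i = 0 \<and> j = 2 \<and> S = {0, 2} \<and> T = {0, 1, 2}"
          using False unfolding P_le_2_iff by (elim disjE conjE) simp_all
        then show ?thesis by (simp add: p triangle_def face_at_def insert_0_2_neq)
      qed
    next
      case False
      then have "cell_map b i j p = undefined" unfolding p using b(11) by blast
      moreover have "cell_map ?t i j p = undefined"
      proof -
        have "\<not> (i = 0 \<and> j = 0 \<and> p = ({0}, {0}))" "\<not> (i = 1 \<and> j = 1 \<and> p = ({1}, {1}))"
          "\<not> (i = 2 \<and> j = 2 \<and> p = ({2}, {2}))" "\<not> (i = 0 \<and> j = 1 \<and> p = ({0, 1}, {0, 1}))"
          "\<not> (i = 1 \<and> j = 2 \<and> p = ({1, 2}, {1, 2}))" "\<not> (i = 0 \<and> j = 2 \<and> p = ({0, 2}, {0, 2}))"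
          "\<not> (i = 0 \<and> j = 2 \<and> p = ({0, 1, 2}, {0, 1, 2}))"
          "\<not> (i = 0 \<and> j = 2 \<and> p = ({0, 2}, {0, 1, 2}))"
          using False unfolding p by (auto simp: P_low[unfolded One_nat_def])
        then show ?thesis by (simp only: triangle_def two_map.select_convs if_False)
      qed
      ultimately show ?thesis by simp
    qed
  qed
qed simp

lemma P_le_1_iff: "j \<le> 1 \<and> S \<in> P i j \<longleftrightarrow>
    i = 0 \<and> j = 0 \<and> S = {0} \<or> i = 1 \<and> j = 1 \<and> S = {1} \<or> i = 0 \<and> j = 1 \<and> S = {0, 1}"
    (is "?L \<longleftrightarrow> ?R")
proof
  assume L: ?L
  then have "i = 0 \<and> j = 0 \<or> i = 1 \<and> j = 1 \<or> i = 0 \<and> j = 1"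
    using P_le[of S i j] by arith
  then show ?R using L by (elim disjE) (auto simp only: P_low)
next
  assume ?R then show ?L by (elim disjE) (simp_all add: P_low[unfolded One_nat_def])
qed

lemma nerve_1_eq_edge:
  assumes "b \<in> Simp (nerve C) 1"
  shows "b = edge C (obj_map b 0) (obj_map b 1) (edge_at b 0 1)"
proof (rule two_map.equality)
  note b = strict_2_functor_C2D[OF assms[unfolded nerve_simps]]
  let ?t = "edge C (obj_map b 0) (obj_map b 1) (edge_at b 0 1)"
  show "obj_map b = obj_map ?t"
  proof
    fix i show "obj_map b i = obj_map ?t i"
      using b(9)[of i] by (cases "i = 0 \<or> i = 1") (auto simp: edge_def)
  qed
  show "mor_map b = mor_map ?t"
  proof (intro ext)
    fix i j S
    show "mor_map b i j S = mor_map ?t i j S"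
    proof (cases "j \<le> 1 \<and> S \<in> P i j")
      case True
      then show ?thesis unfolding P_le_1_iff
        by (elim disjE) (simp_all add: edge_def edge_at_def b(6)[simplified])
    next
      case False
      then have "mor_map b i j S = undefined" using b(10) by blast
      moreover have "mor_map ?t i j S = undefined"
        using False unfolding P_le_1_iff de_Morgan_disj
        by (elim conjE) (simp only: edge_def two_map.select_convs if_False)
      ultimately show ?thesis by simp
    qed
  qed
  show "cell_map b = cell_map ?t"
  proof (intro ext)
    fix i j and p :: simplex_cell
    obtain S T where p: "p = (S, T)" by (cases p)
    show "cell_map b i j p = cell_map ?t i j p"
    proof (cases "j \<le> 1 \<and> S \<in> P i j \<and> T \<in> P i j \<and> S \<subseteq> T")
      case True
      have ST: "j \<le> 1 \<and> S \<in> P i j" "j \<le> 1 \<and> T \<in> P i j" using True by simp_all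
      then have eq: "T = S" unfolding P_le_1_iff by (elim disjE conjE) simp_all
      have "cell_map b i j (S, S) = Ident (Hom C (obj_map b i) (obj_map b j)) (mor_map b i j S)"
        using b(4) True by simp
      with ST(1) show ?thesis unfolding P_le_1_iff p
        by (elim disjE) (simp_all add: edge_def edge_at_def b(6)[simplified] eq)
    next
      case False
      then have "cell_map b i j p = undefined" unfolding p using b(11) by blast
      moreover have "cell_map ?t i j p = undefined"
      proof -
        have "\<not> (i = 0 \<and> j = 0 \<and> p = ({0}, {0}))" "\<not> (i = 1 \<and> j = 1 \<and> p = ({1}, {1}))"
          "\<not> (i = 0 \<and> j = 1 \<and> p = ({0, 1}, {0, 1}))"
          using False unfolding p by (auto simp: P_low[unfolded One_nat_def])
        then show ?thesis by (simp only: edge_def two_map.select_convs if_False)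
      qed
      ultimately show ?thesis by simp
    qed
  qed
qed simp

lemma nerve_0_eq_vertex:
  assumes "b \<in> Simp (nerve C) 0"
  shows "b = vertex C (obj_map b 0)"
proof (rule two_map.equality)
  note b = strict_2_functor_C2D[OF assms[unfolded nerve_simps]]
  have P: "j \<le> 0 \<and> S \<in> P i j \<longleftrightarrow> i = 0 \<and> j = 0 \<and> S = {0}" for i j S
    using P_le[of S i j] P_low(1) by auto
  show "obj_map b = obj_map (vertex C (obj_map b 0))"
    using b(9) by (fastforce simp: vertex_def)
  show "mor_map b = mor_map (vertex C (obj_map b 0))"
  proof (intro ext)
    fix i j S
    show "mor_map b i j S = mor_map (vertex C (obj_map b 0)) i j S"
      using b(10)[unfolded P, of i j S] b(6) by (simp add: vertex_def)
  qed
  show "cell_map b = cell_map (vertex C (obj_map b 0))"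
  proof (intro ext)
    fix i j and p :: simplex_cell
    have 0: "{0} \<in> P 0 0" by (simp add: P_low)
    obtain S T where p: "p = (S, T)" by (cases p)
    have "cell_map b i j p = undefined" if "\<not> (i = 0 \<and> j = 0 \<and> p = ({0}, {0}))"
      unfolding p using that P[of j S i] P[of j T i] by (intro b(11)) (auto simp: p)
    then show "cell_map b i j p = cell_map (vertex C (obj_map b 0)) i j p"
      using b(4)[OF _ 0] b(6) by (auto simp: vertex_def)
  qed
qed simp

lemma Op_pick:
  assumes "b \<in> Simp (nerve C) n" "i \<le> j" "j \<le> k" "k \<le> n"
  shows "Op (nerve C) 2 n (pick i j k) b = triangle C (obj_map b i) (obj_map b j) (obj_map b k)
    (edge_at b i j) (edge_at b j k) (edge_at b i k) (face_at b i j k)"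
  using nerve_2_eq_triangle[OF Op_in[OF pick_Delta_maps[OF assms(2-4)] assms(1)]]
  by (simp add: Op_data pick_simps)

lemma Op_pair:
  assumes "b \<in> Simp (nerve C) n" "i \<le> j" "j \<le> n"
  shows "Op (nerve C) 1 n (\<lambda>l\<in>{..1}. if l = 0 then i else j) b
    = edge C (obj_map b i) (obj_map b j) (edge_at b i j)"
  using nerve_1_eq_edge[OF Op_in[OF pair_Delta_maps[OF assms(2-3)] assms(1)]]
  by (simp add: Op_data)

lemma Op_const:
  assumes "b \<in> Simp (nerve C) n" "i \<le> n"
  shows "Op (nerve C) 0 n (\<lambda>l\<in>{..0}. i) b = vertex C (obj_map b i)"
  using nerve_0_eq_vertex[OF Op_in[OF const_Delta_maps[OF assms(2)] assms(1)]]
  by (simp add: Op_data)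

lemma vertex_data: "obj_map (vertex C x) 0 = x" "edge_at (vertex C x) 0 0 = Unit C x"
  by (simp_all add: vertex_def edge_at_def)

lemma edge_data:
  "obj_map (edge C x y f) 0 = x" "obj_map (edge C x y f) (Suc 0) = y" "edge_at (edge C x y f) 0 (Suc 0) = f"
  by (simp_all add: edge_def edge_at_def)

lemma triangle_data:
  "obj_map (triangle C x y z f g h \<phi>) 0 = x" "obj_map (triangle C x y z f g h \<phi>) (Suc 0) = y"
  "obj_map (triangle C x y z f g h \<phi>) 2 = z"
  "edge_at (triangle C x y z f g h \<phi>) 0 (Suc 0) = f" "edge_at (triangle C x y z f g h \<phi>) (Suc 0) 2 = g"
  "edge_at (triangle C x y z f g h \<phi>) 0 2 = h" "face_at (triangle C x y z f g h \<phi>) 0 (Suc 0) 2 = \<phi>"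
  by (simp_all add: triangle_def edge_at_def face_at_def insert_0_2_neq)

section \<open>The explicit records are simplices\<close>

context strict_21_category
begin

text \<open>The triangle is the face \<open>0 1 2\<close> of a tetrahedron whose edge from 2 to 3 is
  a unit; both sides of its coherence equation equal \<open>\<phi>\<close>. \<open>edge_in\<close>
  and \<open>vertex_in\<close> descend further in the same way, by passing to faces of degenerate
  simplices.\<close>

lemma triangle_in:
  assumes ob: "x \<in> Ob C" "y \<in> Ob C" "z \<in> Ob C" and f: "f \<in> Obj (Hom C x y)" "g \<in> Obj (Hom C y z)"
    and \<phi>: "\<phi> \<in> arrows (Hom C x z) h (Comp1 C x y z g f)"
  shows "triangle C x y z f g h \<phi> \<in> Simp (nerve C) 2"
proof -
  note h = Hom_arrows_Obj[OF ob(1,3) \<phi>]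
  have "\<exists>b \<in> Simp (nerve C) 3.
    obj_map b 0 = x \<and> obj_map b 1 = y \<and> obj_map b 2 = z \<and> obj_map b 3 = z \<and>
    edge_at b 0 1 = f \<and> edge_at b 1 2 = g \<and> edge_at b 2 3 = Unit C z \<and>
    edge_at b 0 2 = h \<and> edge_at b 1 3 = g \<and> edge_at b 0 3 = h \<and>
    face_at b 0 1 2 = \<phi> \<and> face_at b 1 2 3 = Ident (Hom C y z) g \<and> face_at b 0 1 3 = \<phi> \<and>
    face_at b 0 2 3 = Ident (Hom C x z) h"
    by (rule ex_tetrahedron)
      (use assms h Unit_Obj in \<open>simp_all add: Ident_in Comp1_Unit_left Comp2_Ident
        Ident_Comp[OF ob(1,3) \<phi>] Comp_Ident[OF ob(1,3) \<phi>] Comp2_Unit_left_in[OF ob(1,3) \<phi>]\<close>)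
  then obtain b where b: "b \<in> Simp (nerve C) 3" "obj_map b 0 = x" "obj_map b 1 = y" "obj_map b 2 = z"
    "edge_at b 0 1 = f" "edge_at b 1 2 = g" "edge_at b 0 2 = h" "face_at b 0 1 2 = \<phi>" by blast
  then have "Op (nerve C) 2 3 (pick 0 1 2) b = triangle C x y z f g h \<phi>"
    using Op_pick[OF b(1), of 0 1 2] by simp
  then show ?thesis using Op_in[OF pick_Delta_maps b(1), of 0 1 2] by simp
qed

lemma edge_in:
  assumes "x \<in> Ob C" "y \<in> Ob C" "f \<in> Obj (Hom C x y)"
  shows "edge C x y f \<in> Simp (nerve C) 1"
proof -
  let ?t = "triangle C x y y f (Unit C y) f (Ident (Hom C x y) f)"
  have t: "?t \<in> Simp (nerve C) 2"
    using assms Unit_Obj by (intro triangle_in) (simp_all add: Comp1_Unit_left Ident_in)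
  show ?thesis
    using Op_pair[OF t, of 0 1] Op_in[OF pair_Delta_maps t, of 0 1] by (simp add: triangle_data)
qed

lemma vertex_in:
  assumes "x \<in> Ob C"
  shows "vertex C x \<in> Simp (nerve C) 0"
proof -
  have e: "edge C x x (Unit C x) \<in> Simp (nerve C) 1" using assms Unit_Obj by (intro edge_in)
  show ?thesis
    using Op_const[OF e, of 0] Op_in[OF const_Delta_maps e, of 0 0] by (simp add: edge_data)
qed

end

section \<open>From simplicial maps to pseudofunctors\<close>

locale nerve_21_map =
  C: strict_21_category C + D: strict_21_category D + simplicial_map "nerve C" "nerve D" \<sigma>
  for C :: "('o, 'm, 'c) two_category" and D :: "('o2, 'm2, 'c2) two_category" and \<sigma>
begin

abbreviation "F0 \<equiv> obj_map (pseudofunctor_of C \<sigma>)"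
abbreviation "F1 \<equiv> mor_map (pseudofunctor_of C \<sigma>)"
abbreviation "F2 \<equiv> cell_map (pseudofunctor_of C \<sigma>)"
abbreviation "\<eta> \<equiv> eta (pseudofunctor_of C \<sigma>)"

text \<open>Only the 2-morphism of the image triangle is recorded: its objects and edges are given
  by \<open>F0\<close> and \<open>F1\<close>, as \<open>\<sigma>_data\<close> shows.\<close>

definition F_triangle :: "'o \<Rightarrow> 'o \<Rightarrow> 'o \<Rightarrow> 'm \<Rightarrow> 'm \<Rightarrow> 'm \<Rightarrow> 'c \<Rightarrow> 'c2" where
  "F_triangle x y z f g h \<phi> = face_at (\<sigma> 2 (triangle C x y z f g h \<phi>)) 0 1 2"

lemma \<sigma>_in: "b \<in> Simp (nerve C) n \<Longrightarrow> \<sigma> n b \<in> Simp (nerve D) n"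
  using map_Simp by (auto simp: PiE_def)

lemma F_obj_map: "x \<in> Ob C \<Longrightarrow> F0 x = obj_map (\<sigma> 0 (vertex C x)) 0"
  and F_mor_map: "\<lbrakk>x \<in> Ob C; y \<in> Ob C; f \<in> Obj (Hom C x y)\<rbrakk> \<Longrightarrow> F1 x y f = edge_at (\<sigma> 1 (edge C x y f)) 0 1"
  and F_cell_map: "\<lbrakk>x \<in> Ob C; y \<in> Ob C; \<phi> \<in> arrows (Hom C x y) f g\<rbrakk>
    \<Longrightarrow> F2 x y \<phi> = F_triangle x y y g (Unit C y) f \<phi>"
  and F_eta: "\<lbrakk>x \<in> Ob C; y \<in> Ob C; z \<in> Ob C; f \<in> Obj (Hom C x y); g \<in> Obj (Hom C y z)\<rbrakk>
    \<Longrightarrow> \<eta> x y z f g = F_triangle x y z f g (Comp1 C x y z g f) (Ident (Hom C x z) (Comp1 C x y z g f))"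
  by (simp_all add: pseudofunctor_of_def F_triangle_def edge_at_def face_at_def arrows_iff)

text \<open>Naturality of \<open>\<sigma>\<close> under the operators selecting one, two or three
  vertices reduces each component to the value on a \<open>vertex\<close>, an \<open>edge\<close> or
  a \<open>triangle\<close>.\<close>

lemma \<sigma>_data:
  assumes b: "b \<in> Simp (nerve C) n"
  shows "i \<le> n \<Longrightarrow> obj_map (\<sigma> n b) i = F0 (obj_map b i)"
    and "\<lbrakk>i \<le> j; j \<le> n\<rbrakk> \<Longrightarrow> edge_at (\<sigma> n b) i j = F1 (obj_map b i) (obj_map b j) (edge_at b i j)"
    and "\<lbrakk>i \<le> j; j \<le> k; k \<le> n\<rbrakk> \<Longrightarrow> face_at (\<sigma> n b) i j k
      = F_triangle (obj_map b i) (obj_map b j) (obj_map b k) (edge_at b i j) (edge_at b j k) (edge_at b i k) (face_at b i j k)"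
proof -
  interpret b: simplex_data C n "obj_map b" "edge_at b" "face_at b"
    using C.simplex_data_of_simplex b by (simp add: nerve_simps)
  show "obj_map (\<sigma> n b) i = F0 (obj_map b i)" if "i \<le> n"
    using map_Op[OF const_Delta_maps[OF that, of 0] b] that
    by (simp only: F_obj_map b.x_Ob Op_const[OF b] Op_const[OF \<sigma>_in[OF b]] vertex_data)
  show "edge_at (\<sigma> n b) i j = F1 (obj_map b i) (obj_map b j) (edge_at b i j)" if "i \<le> j" "j \<le> n"
    using map_Op[OF pair_Delta_maps[OF that] b] that
    by (simp add: F_mor_map b.x_Ob b.f_Obj Op_pair[OF b, simplified] Op_pair[OF \<sigma>_in[OF b], simplified] edge_data)
  show "face_at (\<sigma> n b) i j k
      = F_triangle (obj_map b i) (obj_map b j) (obj_map b k) (edge_at b i j) (edge_at b j k) (edge_at b i k) (face_at b i j k)"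
    if "i \<le> j" "j \<le> k" "k \<le> n"
    using map_Op[OF pick_Delta_maps[OF that] b] that
    by (simp add: F_triangle_def Op_pick[OF b] Op_pick[OF \<sigma>_in[OF b]] triangle_data)
qed

lemma simplex_data_image:
  "b \<in> Simp (nerve C) n \<Longrightarrow> simplex_data D n (obj_map (\<sigma> n b)) (edge_at (\<sigma> n b)) (face_at (\<sigma> n b))"
  using D.simplex_data_of_simplex \<sigma>_in by (simp add: nerve_simps)

lemma F0_in: "x \<in> Ob C \<Longrightarrow> F0 x \<in> Ob D"
  using simplex_data.x_Ob[OF simplex_data_image[OF C.vertex_in], of x 0]
  by (simp add: \<sigma>_data[OF C.vertex_in] vertex_data)

lemma F1_in: "\<lbrakk>x \<in> Ob C; y \<in> Ob C; f \<in> Obj (Hom C x y)\<rbrakk> \<Longrightarrow> F1 x y f \<in> Obj (Hom D (F0 x) (F0 y))"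
  using simplex_data.f_Obj[OF simplex_data_image[OF C.edge_in], of x y f 0 1]
  by (simp add: \<sigma>_data[OF C.edge_in, simplified] edge_data)

lemma F1_Unit: "x \<in> Ob C \<Longrightarrow> F1 x x (Unit C x) = Unit D (F0 x)"
  using simplex_data.f_refl[OF simplex_data_image[OF C.vertex_in], of x 0]
  by (simp add: \<sigma>_data[OF C.vertex_in] vertex_data)

lemma F_triangle_in:
  assumes "x \<in> Ob C" "y \<in> Ob C" "z \<in> Ob C" "f \<in> Obj (Hom C x y)" "g \<in> Obj (Hom C y z)"
    "\<phi> \<in> arrows (Hom C x z) h (Comp1 C x y z g f)"
  shows "F_triangle x y z f g h \<phi> \<in> arrows (Hom D (F0 x) (F0 z)) (F1 x z h)
    (Comp1 D (F0 x) (F0 y) (F0 z) (F1 y z g) (F1 x y f))"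
  using simplex_data.a_in[OF simplex_data_image[OF C.triangle_in[OF assms]], of 0 1 2]
  by (simp add: \<sigma>_data[OF C.triangle_in[OF assms]] triangle_data)

text \<open>Both triangles are degenerate: they are the faces \<open>0 0 1\<close> and
  \<open>0 1 1\<close> of an edge, and the image of that edge is normalised in
  \<open>D\<close>.\<close>

lemma F_triangle_Unit:
  assumes "x \<in> Ob C" "y \<in> Ob C" "f \<in> Obj (Hom C x y)"
  shows "F_triangle x x y (Unit C x) f f (Ident (Hom C x y) f) = Ident (Hom D (F0 x) (F0 y)) (F1 x y f)"
    and "F_triangle x y y f (Unit C y) f (Ident (Hom C x y) f) = Ident (Hom D (F0 x) (F0 y)) (F1 x y f)"
proof -
  let ?e = "edge C x y f"
  have e: "?e \<in> Simp (nerve C) (Suc 0)" using C.edge_in[OF assms] by simp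
  interpret e: simplex_data C "Suc 0" "obj_map ?e" "edge_at ?e" "face_at ?e"
    using C.simplex_data_of_simplex e by (simp add: nerve_simps)
  interpret Fe: simplex_data D "Suc 0" "obj_map (\<sigma> (Suc 0) ?e)" "edge_at (\<sigma> (Suc 0) ?e)" "face_at (\<sigma> (Suc 0) ?e)"
    using simplex_data_image[OF e] .
  show "F_triangle x x y (Unit C x) f f (Ident (Hom C x y) f) = Ident (Hom D (F0 x) (F0 y)) (F1 x y f)"
    using Fe.a_left[of 0 "Suc 0"] e.a_left[of 0 "Suc 0"] e.f_refl[of 0]
    by (simp add: \<sigma>_data[OF e] edge_data)
  show "F_triangle x y y f (Unit C y) f (Ident (Hom C x y) f) = Ident (Hom D (F0 x) (F0 y)) (F1 x y f)"
    using Fe.a_right[of 0 "Suc 0"] e.a_right[of 0 "Suc 0"] e.f_refl[of "Suc 0"]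
    by (simp add: \<sigma>_data[OF e] edge_data)
qed

text \<open>This is \<open>a_coherence\<close> for the image of a 3-simplex. Compatibility with
  vertical composition and the naturality and coherence of \<open>\<eta>\<close> all come from
  special choices of the tetrahedron.\<close>

lemma F_triangle_tetrahedron:
  assumes ob: "x0 \<in> Ob C" "x1 \<in> Ob C" "x2 \<in> Ob C" "x3 \<in> Ob C"
    and f: "f01 \<in> Obj (Hom C x0 x1)" "f12 \<in> Obj (Hom C x1 x2)" "f23 \<in> Obj (Hom C x2 x3)"
      "f02 \<in> Obj (Hom C x0 x2)" "f13 \<in> Obj (Hom C x1 x3)" "f03 \<in> Obj (Hom C x0 x3)"
    and a: "a012 \<in> arrows (Hom C x0 x2) f02 (Comp1 C x0 x1 x2 f12 f01)"
      "a123 \<in> arrows (Hom C x1 x3) f13 (Comp1 C x1 x2 x3 f23 f12)"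
      "a013 \<in> arrows (Hom C x0 x3) f03 (Comp1 C x0 x1 x3 f13 f01)"
      "a023 \<in> arrows (Hom C x0 x3) f03 (Comp1 C x0 x2 x3 f23 f02)"
    and coherence: "Comp (Hom C x0 x3) (Comp2 C x0 x1 x3 a123 (Ident (Hom C x0 x1) f01)) a013
      = Comp (Hom C x0 x3) (Comp2 C x0 x2 x3 (Ident (Hom C x2 x3) f23) a012) a023"
  shows "Comp (Hom D (F0 x0) (F0 x3)) (Comp2 D (F0 x0) (F0 x1) (F0 x3) (F_triangle x1 x2 x3 f12 f23 f13 a123)
        (Ident (Hom D (F0 x0) (F0 x1)) (F1 x0 x1 f01))) (F_triangle x0 x1 x3 f01 f13 f03 a013)
    = Comp (Hom D (F0 x0) (F0 x3)) (Comp2 D (F0 x0) (F0 x2) (F0 x3)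
        (Ident (Hom D (F0 x2) (F0 x3)) (F1 x2 x3 f23)) (F_triangle x0 x1 x2 f01 f12 f02 a012))
        (F_triangle x0 x2 x3 f02 f23 f03 a023)"
proof -
  obtain b where b: "b \<in> Simp (nerve C) 3"
    and d: "obj_map b 0 = x0" "obj_map b 1 = x1" "obj_map b 2 = x2" "obj_map b 3 = x3"
      "edge_at b 0 1 = f01" "edge_at b 1 2 = f12" "edge_at b 2 3 = f23"
      "edge_at b 0 2 = f02" "edge_at b 1 3 = f13" "edge_at b 0 3 = f03"
      "face_at b 0 1 2 = a012" "face_at b 1 2 3 = a123" "face_at b 0 1 3 = a013" "face_at b 0 2 3 = a023"
    using C.ex_tetrahedron[OF assms] by blast
  show ?thesis
    using simplex_data.a_coherence[OF simplex_data_image[OF b], of 0 1 2 3]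
    by (simp add: \<sigma>_data[OF b] d[simplified])
qed

end

section \<open>Axioms of the associated pseudofunctor\<close>

context nerve_21_map
begin

text \<open>The unit in \<open>id \<circ> g\<close> disappears strictly in \<open>C\<close>, and in
  \<open>D\<close> as well because \<open>F1\<close> preserves units.\<close>

lemma F2_in:
  assumes "x \<in> Ob C" "y \<in> Ob C" "\<phi> \<in> arrows (Hom C x y) f g"
  shows "F2 x y \<phi> \<in> arrows (Hom D (F0 x) (F0 y)) (F1 x y f) (F1 x y g)"
proof -
  note fg = C.Hom_arrows_Obj[OF assms]
  have "\<phi> \<in> arrows (Hom C x y) f (Comp1 C x y y (Unit C y) g)"
    using assms fg by (simp add: C.Comp1_Unit_left)
  from F_triangle_in[OF assms(1,2,2) fg(2) C.Unit_Obj[OF assms(2)] this] show ?thesis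
    using assms fg by (simp add: F_cell_map F1_Unit D.Comp1_Unit_left F0_in F1_in)
qed

lemma F2_Ident:
  "\<lbrakk>x \<in> Ob C; y \<in> Ob C; f \<in> Obj (Hom C x y)\<rbrakk>
    \<Longrightarrow> F2 x y (Ident (Hom C x y) f) = Ident (Hom D (F0 x) (F0 y)) (F1 x y f)"
  using F_cell_map[OF _ _ C.Ident_in] F_triangle_Unit(2) by simp

text \<open>From the 3-simplex with vertices \<open>x, y, y, y\<close>, edges
  \<open>h, id, id\<close> and faces \<open>\<psi>\<close>, \<open>id\<close>,
  \<open>\<psi> \<cdot> \<phi>\<close>, \<open>\<phi>\<close>; whiskering with units then drops
  out.\<close>

lemma F2_Comp:
  assumes ob: "x \<in> Ob C" "y \<in> Ob C" and \<phi>: "\<phi> \<in> arrows (Hom C x y) f g"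
    and \<psi>: "\<psi> \<in> arrows (Hom C x y) g h"
  shows "F2 x y (Comp (Hom C x y) \<psi> \<phi>) = Comp (Hom D (F0 x) (F0 y)) (F2 x y \<psi>) (F2 x y \<phi>)"
proof -
  note fg = C.Hom_arrows_Obj[OF ob \<phi>] and h = C.Hom_arrows_Obj(2)[OF ob \<psi>]
  note c = C.Comp_in[OF ob \<phi> \<psi>] and U = C.Unit_Obj[OF ob(2)]
  note Fob = ob[THEN F0_in]
  note Fin = F2_in[OF ob \<phi>] F2_in[OF ob \<psi>] F2_in[OF ob c]
  have "Comp (Hom D (F0 x) (F0 y)) (Comp2 D (F0 x) (F0 y) (F0 y)
        (F_triangle y y y (Unit C y) (Unit C y) (Unit C y) (Unit2 C y))
        (Ident (Hom D (F0 x) (F0 y)) (F1 x y h))) (F_triangle x y y h (Unit C y) f (Comp (Hom C x y) \<psi> \<phi>))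
    = Comp (Hom D (F0 x) (F0 y)) (Comp2 D (F0 x) (F0 y) (F0 y)
        (Ident (Hom D (F0 y) (F0 y)) (F1 y y (Unit C y))) (F_triangle x y y h (Unit C y) g \<psi>))
        (F_triangle x y y g (Unit C y) f \<phi>)"
  proof (rule F_triangle_tetrahedron)
    show "Comp (Hom C x y) (Comp2 C x y y (Unit2 C y) (Ident (Hom C x y) h)) (Comp (Hom C x y) \<psi> \<phi>)
      = Comp (Hom C x y) (Comp2 C x y y (Unit2 C y) \<psi>) \<phi>"
      by (simp add: C.Comp2_Unit_left_in[OF ob C.Ident_in[OF ob h]] C.Comp2_Unit_left_in[OF ob \<psi>]
          C.Ident_Comp[OF ob c])
  qed (use ob U fg h \<phi> \<psi> c in \<open>simp_all add: C.Comp1_Unit_left C.Ident_in\<close>)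
  then show ?thesis
    by (simp add: F_triangle_Unit ob U F1_Unit D.Comp2_Unit_left_in[OF Fob D.Ident_in[OF Fob F1_in[OF ob h]]]
        D.Comp2_Unit_left_in[OF Fob Fin(2)] D.Ident_Comp[OF Fob Fin(3)]
        flip: F_cell_map[OF ob c] F_cell_map[OF ob \<phi>] F_cell_map[OF ob \<psi>])
qed

lemma eta_in:
  assumes ob: "x \<in> Ob C" "y \<in> Ob C" "z \<in> Ob C" and f: "f \<in> Obj (Hom C x y)" "g \<in> Obj (Hom C y z)"
  shows "\<eta> x y z f g \<in> arrows (Hom D (F0 x) (F0 z)) (F1 x z (Comp1 C x y z g f))
    (Comp1 D (F0 x) (F0 y) (F0 z) (F1 y z g) (F1 x y f))"
  unfolding F_eta[OF assms]
  by (rule F_triangle_in[OF assms C.Ident_in[OF ob(1,3) C.Comp1_in[OF assms]]])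

text \<open>From the 3-simplex with edges \<open>f, g', id\<close> and faces \<open>id\<close>, \<open>\<psi>\<close>, \<open>\<chi>\<close>, \<open>(\<psi> \<circ> f) \<cdot> \<chi>\<close>.\<close>

lemma eta_postcomp:
  assumes ob: "x \<in> Ob C" "y \<in> Ob C" "z \<in> Ob C" and f: "f \<in> Obj (Hom C x y)"
    and \<psi>: "\<psi> \<in> arrows (Hom C y z) g g'" and \<chi>: "\<chi> \<in> arrows (Hom C x z) h (Comp1 C x y z g f)"
  shows "Comp (Hom D (F0 x) (F0 z)) (\<eta> x y z f g')
      (F2 x z (Comp (Hom C x z) (Comp2 C x y z \<psi> (Ident (Hom C x y) f)) \<chi>))
    = Comp (Hom D (F0 x) (F0 z)) (Comp2 D (F0 x) (F0 y) (F0 z) (F2 y z \<psi>)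
        (Ident (Hom D (F0 x) (F0 y)) (F1 x y f))) (F_triangle x y z f g h \<chi>)"
proof -
  note g = C.Hom_arrows_Obj[OF ob(2,3) \<psi>] and h = C.Hom_arrows_Obj(1)[OF ob(1,3) \<chi>]
  note U = C.Unit_Obj[OF ob(3)] and gf = C.Comp1_in[OF ob f g(2)]
  let ?\<omega> = "Comp (Hom C x z) (Comp2 C x y z \<psi> (Ident (Hom C x y) f)) \<chi>"
  have \<omega>: "?\<omega> \<in> arrows (Hom C x z) h (Comp1 C x y z g' f)"
    by (rule C.Comp_in[OF ob(1,3) \<chi> C.Comp2_in[OF ob C.Ident_in[OF ob(1,2) f] \<psi>]])
  have "Comp (Hom D (F0 x) (F0 z)) (Comp2 D (F0 x) (F0 y) (F0 z) (F_triangle y z z g' (Unit C z) g \<psi>)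
        (Ident (Hom D (F0 x) (F0 y)) (F1 x y f))) (F_triangle x y z f g h \<chi>)
    = Comp (Hom D (F0 x) (F0 z)) (Comp2 D (F0 x) (F0 z) (F0 z) (Ident (Hom D (F0 z) (F0 z)) (F1 z z (Unit C z)))
        (F_triangle x y z f g' (Comp1 C x y z g' f) (Ident (Hom C x z) (Comp1 C x y z g' f))))
        (F_triangle x z z (Comp1 C x y z g' f) (Unit C z) h ?\<omega>)"
  proof (rule F_triangle_tetrahedron)
    show "?\<omega> = Comp (Hom C x z) (Comp2 C x z z (Unit2 C z) (Ident (Hom C x z) (Comp1 C x y z g' f))) ?\<omega>"
      by (simp add: C.Comp2_Unit_left_in[OF ob(1,3) C.Ident_in[OF ob(1,3) gf]] C.Ident_Comp[OF ob(1,3) \<omega>])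
  qed (use ob f U g gf h \<psi> \<chi> \<omega> in \<open>simp_all add: C.Comp1_Unit_left C.Ident_in\<close>)
  moreover have "Comp2 D (F0 x) (F0 z) (F0 z) (Unit2 D (F0 z)) (\<eta> x y z f g') = \<eta> x y z f g'"
    by (rule D.Comp2_Unit_left_in[OF F0_in[OF ob(1)] F0_in[OF ob(3)] eta_in[OF ob f g(2)]])
  ultimately show ?thesis
    by (simp add: F1_Unit ob flip: F_eta[OF ob f g(2)] F_cell_map[OF ob(2,3) \<psi>] F_cell_map[OF ob(1,3) \<omega>])
qed

text \<open>The case of \<open>eta_postcomp\<close> in which \<open>\<psi>\<close> is the identity
  on \<open>g\<close>.\<close>

lemma F_triangle_eq:
  assumes ob: "x \<in> Ob C" "y \<in> Ob C" "z \<in> Ob C" and f: "f \<in> Obj (Hom C x y)" "g \<in> Obj (Hom C y z)"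
    and \<chi>: "\<chi> \<in> arrows (Hom C x z) h (Comp1 C x y z g f)"
  shows "F_triangle x y z f g h \<chi> = Comp (Hom D (F0 x) (F0 z)) (\<eta> x y z f g) (F2 x z \<chi>)"
  using eta_postcomp[OF ob f(1) C.Ident_in[OF ob(2,3) f(2)] \<chi>]
    D.Ident_Comp[OF F0_in[OF ob(1)] F0_in[OF ob(3)] F_triangle_in[OF ob f \<chi>]]
  by (simp add: C.Comp2_Ident C.Ident_Comp[OF ob(1,3) \<chi>] F2_Ident D.Comp2_Ident F0_in F1_in ob f)

text \<open>From the 3-simplex with edges \<open>f', id, g\<close> and faces \<open>\<phi>\<close>, \<open>id\<close>, \<open>(g \<circ> \<phi>) \<cdot> \<chi>\<close>, \<open>\<chi>\<close>.\<close>

lemma F_triangle_precomp: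
  assumes ob: "x \<in> Ob C" "y \<in> Ob C" "z \<in> Ob C" and g: "g \<in> Obj (Hom C y z)"
    and \<phi>: "\<phi> \<in> arrows (Hom C x y) f f'" and \<chi>: "\<chi> \<in> arrows (Hom C x z) h (Comp1 C x y z g f)"
  shows "F_triangle x y z f' g h (Comp (Hom C x z) (Comp2 C x y z (Ident (Hom C y z) g) \<phi>) \<chi>)
    = Comp (Hom D (F0 x) (F0 z)) (Comp2 D (F0 x) (F0 y) (F0 z)
        (Ident (Hom D (F0 y) (F0 z)) (F1 y z g)) (F2 x y \<phi>)) (F_triangle x y z f g h \<chi>)"
proof -
  note f = C.Hom_arrows_Obj[OF ob(1,2) \<phi>] and h = C.Hom_arrows_Obj(1)[OF ob(1,3) \<chi>]
  note U = C.Unit_Obj[OF ob(2)] and Fob = ob[THEN F0_in]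
  let ?\<omega> = "Comp (Hom C x z) (Comp2 C x y z (Ident (Hom C y z) g) \<phi>) \<chi>"
  have \<omega>: "?\<omega> \<in> arrows (Hom C x z) h (Comp1 C x y z g f')"
    by (rule C.Comp_in[OF ob(1,3) \<chi> C.Comp2_in[OF ob \<phi> C.Ident_in[OF ob(2,3) g]]])
  have "Comp (Hom D (F0 x) (F0 z)) (Comp2 D (F0 x) (F0 y) (F0 z)
        (F_triangle y y z (Unit C y) g g (Ident (Hom C y z) g))
        (Ident (Hom D (F0 x) (F0 y)) (F1 x y f'))) (F_triangle x y z f' g h ?\<omega>)
    = Comp (Hom D (F0 x) (F0 z)) (Comp2 D (F0 x) (F0 y) (F0 z) (Ident (Hom D (F0 y) (F0 z)) (F1 y z g))
        (F_triangle x y y f' (Unit C y) f \<phi>)) (F_triangle x y z f g h \<chi>)"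
  proof (rule F_triangle_tetrahedron)
    show "Comp (Hom C x z) (Comp2 C x y z (Ident (Hom C y z) g) (Ident (Hom C x y) f')) ?\<omega> = ?\<omega>"
      by (simp add: C.Comp2_Ident ob f g C.Ident_Comp[OF ob(1,3) \<omega>])
  qed (use ob f U g h \<phi> \<chi> \<omega> in \<open>simp_all add: C.Comp1_Unit_left C.Comp1_Unit_right C.Ident_in\<close>)
  then show ?thesis
    using D.Ident_Comp[OF Fob(1,3) F_triangle_in[OF ob f(2) g \<omega>]]
    by (simp add: F_triangle_Unit ob f g D.Comp2_Ident Fob F1_in flip: F_cell_map[OF ob(1,2) \<phi>])
qed

text \<open>By interchange \<open>\<psi> \<circ> \<phi>\<close> is
  \<open>(\<psi> \<circ> f') \<cdot> (g \<circ> \<phi>)\<close>. The first factor is handled by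
  \<open>eta_postcomp\<close>, the second by \<open>F_triangle_precomp\<close>.\<close>

lemma eta_natural:
  assumes ob: "x \<in> Ob C" "y \<in> Ob C" "z \<in> Ob C"
    and \<phi>: "\<phi> \<in> arrows (Hom C x y) f f'" and \<psi>: "\<psi> \<in> arrows (Hom C y z) g g'"
  shows "Comp (Hom D (F0 x) (F0 z)) (\<eta> x y z f' g') (F2 x z (Comp2 C x y z \<psi> \<phi>))
    = Comp (Hom D (F0 x) (F0 z)) (Comp2 D (F0 x) (F0 y) (F0 z) (F2 y z \<psi>) (F2 x y \<phi>)) (\<eta> x y z f g)"
proof -
  note f = C.Hom_arrows_Obj[OF ob(1,2) \<phi>] and g = C.Hom_arrows_Obj[OF ob(2,3) \<psi>]
  note Fob = ob[THEN F0_in] and If' = C.Ident_in[OF ob(1,2) f(2)] and Ig = C.Ident_in[OF ob(2,3) g(1)]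
  note FIf' = D.Ident_in[OF Fob(1,2) F1_in[OF ob(1,2) f(2)]]
    and FIg = D.Ident_in[OF Fob(2,3) F1_in[OF ob(2,3) g(1)]]
  note gf = C.Comp1_in[OF ob f(1) g(1)]
  note g\<phi> = C.Comp2_in[OF ob \<phi> Ig]
  have "Comp2 C x y z \<psi> \<phi>
    = Comp (Hom C x z) (Comp2 C x y z \<psi> (Ident (Hom C x y) f')) (Comp2 C x y z (Ident (Hom C y z) g) \<phi>)"
    using C.interchange[OF ob \<phi> If' Ig \<psi>]
    by (simp add: C.Ident_Comp[OF ob(1,2) \<phi>] C.Comp_Ident[OF ob(2,3) \<psi>])
  then have "Comp (Hom D (F0 x) (F0 z)) (\<eta> x y z f' g') (F2 x z (Comp2 C x y z \<psi> \<phi>))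
    = Comp (Hom D (F0 x) (F0 z)) (Comp2 D (F0 x) (F0 y) (F0 z) (F2 y z \<psi>)
        (Ident (Hom D (F0 x) (F0 y)) (F1 x y f')))
        (F_triangle x y z f' g (Comp1 C x y z g f) (Comp2 C x y z (Ident (Hom C y z) g) \<phi>))"
    using eta_postcomp[OF ob f(2) \<psi> g\<phi>] by simp
  \<comment> \<open>Here \<open>\<chi>\<close> is the identity on \<open>g \<circ> f\<close>, so the
    remaining triangle is the one defining \<open>\<eta>\<close>.\<close>
  also have "F_triangle x y z f' g (Comp1 C x y z g f) (Comp2 C x y z (Ident (Hom C y z) g) \<phi>)
    = Comp (Hom D (F0 x) (F0 z)) (Comp2 D (F0 x) (F0 y) (F0 z)
        (Ident (Hom D (F0 y) (F0 z)) (F1 y z g)) (F2 x y \<phi>)) (\<eta> x y z f g)"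
    using F_triangle_precomp[OF ob g(1) \<phi> C.Ident_in[OF ob(1,3) gf]]
    by (simp add: C.Comp_Ident[OF ob(1,3) g\<phi>] F_eta ob f g)
  also have "Comp (Hom D (F0 x) (F0 z)) (Comp2 D (F0 x) (F0 y) (F0 z) (F2 y z \<psi>)
        (Ident (Hom D (F0 x) (F0 y)) (F1 x y f'))) \<dots>
    = Comp (Hom D (F0 x) (F0 z)) (Comp (Hom D (F0 x) (F0 z)) (Comp2 D (F0 x) (F0 y) (F0 z) (F2 y z \<psi>)
        (Ident (Hom D (F0 x) (F0 y)) (F1 x y f'))) (Comp2 D (F0 x) (F0 y) (F0 z)
        (Ident (Hom D (F0 y) (F0 z)) (F1 y z g)) (F2 x y \<phi>))) (\<eta> x y z f g)"
    by (rule D.vertical_assoc[OF Fob(1,3) eta_in[OF ob f(1) g(1)] D.Comp2_in[OF Fob F2_in[OF ob(1,2) \<phi>] FIg]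
          D.Comp2_in[OF Fob FIf' F2_in[OF ob(2,3) \<psi>]], symmetric])
  also have "\<dots> = Comp (Hom D (F0 x) (F0 z)) (Comp2 D (F0 x) (F0 y) (F0 z) (F2 y z \<psi>) (F2 x y \<phi>)) (\<eta> x y z f g)"
    using D.interchange[OF Fob F2_in[OF ob(1,2) \<phi>] FIf' FIg F2_in[OF ob(2,3) \<psi>]]
    by (simp add: D.Ident_Comp[OF Fob(1,2) F2_in[OF ob(1,2) \<phi>]] D.Comp_Ident[OF Fob(2,3) F2_in[OF ob(2,3) \<psi>]])
  finally show ?thesis .
qed

text \<open>From the tetrahedron with edges \<open>f, g, h\<close> and identities as faces. It is
  coherent in \<open>C\<close> because composition of 1-morphisms is strictly associative.\<close>

lemma eta_coherence:
  assumes ob: "w \<in> Ob C" "x \<in> Ob C" "y \<in> Ob C" "z \<in> Ob C"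
    and f: "f \<in> Obj (Hom C w x)" "g \<in> Obj (Hom C x y)" "h \<in> Obj (Hom C y z)"
  shows "Comp (Hom D (F0 w) (F0 z)) (Comp2 D (F0 w) (F0 x) (F0 z) (\<eta> x y z g h)
        (Ident (Hom D (F0 w) (F0 x)) (F1 w x f))) (\<eta> w x z f (Comp1 C x y z h g))
    = Comp (Hom D (F0 w) (F0 z)) (Comp2 D (F0 w) (F0 y) (F0 z)
        (Ident (Hom D (F0 y) (F0 z)) (F1 y z h)) (\<eta> w x y f g)) (\<eta> w y z (Comp1 C w x y g f) h)"
proof -
  note gf = C.Comp1_in[OF ob(1-3) f(1,2)] and hg = C.Comp1_in[OF ob(2-4) f(2,3)]
  note hgf = C.Comp1_in[OF ob(1,2,4) f(1) hg] and a = C.Comp1_assoc[OF ob f]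
  show ?thesis
    unfolding F_eta[OF ob(2-4) f(2,3)] F_eta[OF ob(1-3) f(1,2)] F_eta[OF ob(1,2,4) f(1) hg]
      F_eta[OF ob(1,3,4) gf f(3)] a[symmetric]
    by (rule F_triangle_tetrahedron)
      (use ob f gf hg hgf C.Ident_in[OF ob(1,4) hgf] in \<open>simp_all add: C.Ident_in C.Comp2_Ident a\<close>)
qed

lemma normal_pseudofunctor_pseudofunctor_of: "normal_pseudofunctor C D (pseudofunctor_of C \<sigma>)"
proof (intro normal_pseudofunctor.intro normal_oplax_functor.intro hom_functorial.intro
    normal_oplax_functor_axioms.intro normal_pseudofunctor_axioms.intro)
  fix x y assume ob: "x \<in> Ob C" "y \<in> Ob C"
  interpret xy: is_category "Hom C x y" by (rule C.Hom_category[OF ob])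
  have arr: "p \<in> arrows (Hom C x y) (Dom (Hom C x y) p) (Cod (Hom C x y) p)" if "p \<in> Arr (Hom C x y)" for p
    using that by (simp add: arrows_iff)
  show "is_functor (Hom C x y) (Hom D (F0 x) (F0 y)) (F1 x y) (F2 x y)"
  proof
    fix p assume "p \<in> Arr (Hom C x y)"
    note F2_in[OF ob arr[OF this]]
    then show "F2 x y p \<in> Arr (Hom D (F0 x) (F0 y))"
      "Dom (Hom D (F0 x) (F0 y)) (F2 x y p) = F1 x y (Dom (Hom C x y) p)"
      "Cod (Hom D (F0 x) (F0 y)) (F2 x y p) = F1 x y (Cod (Hom C x y) p)"
      by (simp_all add: arrows_iff)
  next
    fix p q assume "p \<in> Arr (Hom C x y)" "q \<in> Arr (Hom C x y)" "Cod (Hom C x y) p = Dom (Hom C x y) q"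
    then show "F2 x y (Comp (Hom C x y) q p) = Comp (Hom D (F0 x) (F0 y)) (F2 x y q) (F2 x y p)"
      using F2_Comp[OF ob arr[of p]] arr[of q] by simp
  qed (use ob F1_in F2_Ident in auto)
next
  fix x y z f g assume A: "x \<in> Ob C" "y \<in> Ob C" "z \<in> Ob C" "f \<in> Obj (Hom C x y)" "g \<in> Obj (Hom C y z)"
  note e = eta_in[OF A]
  then show arr: "\<eta> x y z f g \<in> Arr (Hom D (F0 x) (F0 z))"
    and "Dom (Hom D (F0 x) (F0 z)) (\<eta> x y z f g) = F1 x z (Comp1 C x y z g f)"
    and "Cod (Hom D (F0 x) (F0 z)) (\<eta> x y z f g) = Comp1 D (F0 x) (F0 y) (F0 z) (F1 y z g) (F1 x y f)"
    by (simp_all add: arrows_iff)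
  \<comment> \<open>Invertibility is automatic, since the mapping categories of \<open>D\<close> are
    groupoids.\<close>
  show "is_iso (Hom D (F0 x) (F0 z)) (\<eta> x y z f g)"
    using is_groupoid.all_iso[OF D.Hom_groupoid arr] A F0_in by simp
next
  fix x y f assume A: "x \<in> Ob C" "y \<in> Ob C" "f \<in> Obj (Hom C x y)"
  show "\<eta> x x y (Unit C x) f = Ident (Hom D (F0 x) (F0 y)) (F1 x y f)"
    "\<eta> x y y f (Unit C y) = Ident (Hom D (F0 x) (F0 y)) (F1 x y f)"
    using A by (simp_all add: F_eta C.Unit_Obj C.Comp1_Unit_left C.Comp1_Unit_right F_triangle_Unit)
next
  fix x y z \<phi> f f' \<psi> g g'
  assume "x \<in> Ob C" "y \<in> Ob C" "z \<in> Ob C"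
    "\<phi> \<in> Arr (Hom C x y)" "Dom (Hom C x y) \<phi> = f" "Cod (Hom C x y) \<phi> = f'"
    "\<psi> \<in> Arr (Hom C y z)" "Dom (Hom C y z) \<psi> = g" "Cod (Hom C y z) \<psi> = g'"
  then show "Comp (Hom D (F0 x) (F0 z)) (\<eta> x y z f' g') (F2 x z (Comp2 C x y z \<psi> \<phi>))
    = Comp (Hom D (F0 x) (F0 z)) (Comp2 D (F0 x) (F0 y) (F0 z) (F2 y z \<psi>) (F2 x y \<phi>)) (\<eta> x y z f g)"
    by (intro eta_natural arrowsI)
next
  show "\<not> (x \<in> Ob C \<and> y \<in> Ob C \<and> z \<in> Ob C \<and> f \<in> Obj (Hom C x y) \<and> g \<in> Obj (Hom C y z))
      \<Longrightarrow> \<eta> x y z f g = undefined" for x y z f g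
    unfolding pseudofunctor_of_def by (simp only: oplax_map.select_convs if_False)
  show "\<not> (x \<in> Ob C \<and> y \<in> Ob C \<and> f \<in> Obj (Hom C x y)) \<Longrightarrow> F1 x y f = undefined" for x y f
    unfolding pseudofunctor_of_def by (simp only: two_map.select_convs if_False)
  show "\<not> (x \<in> Ob C \<and> y \<in> Ob C \<and> \<phi> \<in> Arr (Hom C x y)) \<Longrightarrow> F2 x y \<phi> = undefined" for x y \<phi>
    unfolding pseudofunctor_of_def by (simp only: two_map.select_convs if_False)
  show "x \<notin> Ob C \<Longrightarrow> F0 x = undefined" for x by (simp add: pseudofunctor_of_def)
qed (use eta_coherence F0_in F1_Unit in auto)

end

section \<open>Injectivity\<close>

lemma (in nerve_21_map) \<sigma>_face:
  assumes "b \<in> Simp (nerve C) n" "i \<le> j" "j \<le> k" "k \<le> n"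
  shows "face_at (\<sigma> n b) i j k = Comp (Hom D (F0 (obj_map b i)) (F0 (obj_map b k)))
    (\<eta> (obj_map b i) (obj_map b j) (obj_map b k) (edge_at b i j) (edge_at b j k))
    (F2 (obj_map b i) (obj_map b k) (face_at b i j k))"
proof -
  interpret b: simplex_data C n "obj_map b" "edge_at b" "face_at b"
    using C.simplex_data_of_simplex assms by (simp add: nerve_simps)
  show ?thesis
    using assms by (simp add: \<sigma>_data F_triangle_eq b.x_Ob b.f_Obj b.a_in)
qed

text \<open>By \<open>\<sigma>_data\<close> and \<open>\<sigma>_face\<close> the pseudofunctor alone
  determines all components of the image of a simplex. Outside the simplices both maps are
  \<open>undefined\<close>.\<close>

lemma pseudofunctor_of_inj:
  assumes "nerve_21_map C D \<sigma>" "nerve_21_map C D \<tau>" and eq: "pseudofunctor_of C \<sigma> = pseudofunctor_of C \<tau>"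
  shows "\<sigma> = \<tau>"
proof (intro ext)
  interpret \<sigma>: nerve_21_map C D \<sigma> by (rule assms)
  interpret \<tau>: nerve_21_map C D \<tau> by (rule assms)
  fix n b
  show "\<sigma> n b = \<tau> n b"
  proof (cases "b \<in> Simp (nerve C) n")
    case True
    from nerve_eqI[OF \<sigma>.\<sigma>_in[OF True] \<tau>.\<sigma>_in[OF True]] show ?thesis
      by (simp add: \<sigma>.\<sigma>_data(1,2)[OF True] \<tau>.\<sigma>_data(1,2)[OF True] \<sigma>.\<sigma>_face[OF True] \<tau>.\<sigma>_face[OF True] eq)
  next
    case False
    then show ?thesis
      using PiE_arb[OF \<sigma>.map_Simp[of n]] PiE_arb[OF \<tau>.map_Simp[of n]] by simp
  qed
qed

section \<open>From pseudofunctors to simplicial maps\<close>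

text \<open>Replaces the two middle factors of a fourfold vertical composite in one step; in its
  uses \<open>eq\<close> is a naturality square of \<open>eta\<close>.\<close>

lemma (in strict_2_category) vertical_exchange:
  assumes ob: "x \<in> Ob C" "y \<in> Ob C"
    and in': "\<phi> \<in> arrows (Hom C x y) a b" "\<psi> \<in> arrows (Hom C x y) b c" "\<chi> \<in> arrows (Hom C x y) c d"
      "\<omega> \<in> arrows (Hom C x y) d e" "\<psi>' \<in> arrows (Hom C x y) b c'" "\<chi>' \<in> arrows (Hom C x y) c' d"
    and eq: "Comp (Hom C x y) \<chi> \<psi> = Comp (Hom C x y) \<chi>' \<psi>'"
  shows "Comp (Hom C x y) (Comp (Hom C x y) \<omega> \<chi>) (Comp (Hom C x y) \<psi> \<phi>)
    = Comp (Hom C x y) (Comp (Hom C x y) \<omega> \<chi>') (Comp (Hom C x y) \<psi>' \<phi>)"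
  using vertical_assoc[OF ob Comp_in[OF ob in'(1,2)] in'(3,4)] vertical_assoc[OF ob in'(1-3)]
    vertical_assoc[OF ob Comp_in[OF ob in'(1,5)] in'(6,4)] vertical_assoc[OF ob in'(1,5,6)] eq
  by simp

locale normal_pseudofunctor_21 =
  C: strict_21_category C + D: strict_21_category D + normal_pseudofunctor C D F
  for C :: "('o, 'm, 'c) two_category" and D :: "('o2, 'm2, 'c2) two_category" and F
begin

lemma mor_map_in: "\<lbrakk>x \<in> Ob C; y \<in> Ob C; f \<in> Obj (Hom C x y)\<rbrakk>
    \<Longrightarrow> mor_map F x y f \<in> Obj (Hom D (obj_map F x) (obj_map F y))"
  using is_functor.map_Obj[OF hom_functor] .

lemma cell_map_in: "\<lbrakk>x \<in> Ob C; y \<in> Ob C; \<phi> \<in> arrows (Hom C x y) f g\<rbrakk>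
    \<Longrightarrow> cell_map F x y \<phi> \<in> arrows (Hom D (obj_map F x) (obj_map F y)) (mor_map F x y f) (mor_map F x y g)"
  using is_functor.map_arrows[OF hom_functor] .

lemma cell_map_Ident: "\<lbrakk>x \<in> Ob C; y \<in> Ob C; f \<in> Obj (Hom C x y)\<rbrakk>
    \<Longrightarrow> cell_map F x y (Ident (Hom C x y) f) = Ident (Hom D (obj_map F x) (obj_map F y)) (mor_map F x y f)"
  using is_functor.map_Ident[OF hom_functor] .

lemma cell_map_Comp:
  "\<lbrakk>x \<in> Ob C; y \<in> Ob C; \<phi> \<in> arrows (Hom C x y) f g; \<psi> \<in> arrows (Hom C x y) g h\<rbrakk>
    \<Longrightarrow> cell_map F x y (Comp (Hom C x y) \<psi> \<phi>)
      = Comp (Hom D (obj_map F x) (obj_map F y)) (cell_map F x y \<psi>) (cell_map F x y \<phi>)"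
  using is_functor.map_Comp[OF hom_functor] by (simp add: arrows_iff)

lemma eta_in:
  "\<lbrakk>x \<in> Ob C; y \<in> Ob C; z \<in> Ob C; f \<in> Obj (Hom C x y); g \<in> Obj (Hom C y z)\<rbrakk>
    \<Longrightarrow> eta F x y z f g \<in> arrows (Hom D (obj_map F x) (obj_map F z)) (mor_map F x z (Comp1 C x y z g f))
      (Comp1 D (obj_map F x) (obj_map F y) (obj_map F z) (mor_map F y z g) (mor_map F x y f))"
  by (simp add: arrows_iff eta_Arr Dom_eta Cod_eta)

definition "image_obj b i = obj_map F (obj_map b i)"
definition "image_edge b i j = mor_map F (obj_map b i) (obj_map b j) (edge_at b i j)"
definition "image_face b i j k = Comp (Hom D (image_obj b i) (image_obj b k))
  (eta F (obj_map b i) (obj_map b j) (obj_map b k) (edge_at b i j) (edge_at b j k))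
  (cell_map F (obj_map b i) (obj_map b k) (face_at b i j k))"

text \<open>In the coherence equation, the 2-morphisms \<open>eta\<close> and the images of faces
  alternate. Naturality of \<open>eta\<close> moves the images of both faces into one application of
  \<open>cell_map\<close>, with the two \<open>eta\<close> after it; in this form the coherence laws
  of \<open>F\<close> and of \<open>b\<close> apply independently.\<close>

lemma simplex_data_pseudo_image:
  assumes "b \<in> Simp (nerve C) n"
  shows "simplex_data D n (image_obj b) (image_edge b) (image_face b)"
proof -
  interpret b: simplex_data C n "obj_map b" "edge_at b" "face_at b"
    using C.simplex_data_of_simplex assms by (simp add: nerve_simps)
  show ?thesis
  proof
    show ob: "image_obj b i \<in> Ob D" if "i \<le> n" for i
      using that b.x_Ob obj_map_Ob by (simp add: image_obj_def)
    show e: "image_edge b i j \<in> Obj (Hom D (image_obj b i) (image_obj b j))" if "i \<le> j" "j \<le> n" for i j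
      using that b.x_Ob b.f_Obj mor_map_in by (simp add: image_obj_def image_edge_def)
    show "image_edge b i i = Unit D (image_obj b i)" if "i \<le> n" for i
      using that b.x_Ob mor_map_Unit by (simp add: image_edge_def image_obj_def b.f_refl)
    show "image_face b i j k \<in> arrows (Hom D (image_obj b i) (image_obj b k)) (image_edge b i k)
        (Comp1 D (image_obj b i) (image_obj b j) (image_obj b k) (image_edge b j k) (image_edge b i j))"
      if "i \<le> j" "j \<le> k" "k \<le> n" for i j k
      unfolding image_face_def image_edge_def image_obj_def
      by (rule D.Comp_in[OF _ _ cell_map_in[OF _ _ b.a_in] eta_in])
        (use that b.x_Ob b.f_Obj obj_map_Ob in auto)
    show "image_face b i i j = Ident (Hom D (image_obj b i) (image_obj b j)) (image_edge b i j)"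
      "image_face b i j j = Ident (Hom D (image_obj b i) (image_obj b j)) (image_edge b i j)"
      if "i \<le> j" "j \<le> n" for i j
    proof -
      have x: "obj_map b i \<in> Ob C" "obj_map b j \<in> Ob C" and f: "edge_at b i j \<in> Obj (Hom C (obj_map b i) (obj_map b j))"
        using that b.x_Ob b.f_Obj by auto
      have "Comp (Hom D (image_obj b i) (image_obj b j))
          (Ident (Hom D (image_obj b i) (image_obj b j)) (image_edge b i j))
          (Ident (Hom D (image_obj b i) (image_obj b j)) (image_edge b i j))
        = Ident (Hom D (image_obj b i) (image_obj b j)) (image_edge b i j)"
        using that ob[of i] ob[of j] e[of i j] by (intro D.Ident_Comp[OF _ _ D.Ident_in]) auto
      then show "image_face b i i j = Ident (Hom D (image_obj b i) (image_obj b j)) (image_edge b i j)"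
        "image_face b i j j = Ident (Hom D (image_obj b i) (image_obj b j)) (image_edge b i j)"
        using that x f
        by (simp_all add: image_face_def image_edge_def image_obj_def b.a_left b.a_right b.f_refl
            cell_map_Ident eta_Unit_left eta_Unit_right)
    qed
    fix i j k l assume le: "i \<le> j" "j \<le> k" "k \<le> l" "l \<le> n"
    define w x y z where d: "w = obj_map b i" "x = obj_map b j" "y = obj_map b k" "z = obj_map b l"
    have ob: "w \<in> Ob C" "x \<in> Ob C" "y \<in> Ob C" "z \<in> Ob C" using le b.x_Ob by (auto simp: d)
    note Fob = ob[THEN obj_map_Ob]
    let ?ij = "edge_at b i j" and ?jk = "edge_at b j k" and ?kl = "edge_at b k l"
    let ?ik = "edge_at b i k" and ?jl = "edge_at b j l" and ?il = "edge_at b i l"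
    have f: "?ij \<in> Obj (Hom C w x)" "?jk \<in> Obj (Hom C x y)" "?kl \<in> Obj (Hom C y z)"
      "?ik \<in> Obj (Hom C w y)" "?jl \<in> Obj (Hom C x z)" using le b.f_Obj by (auto simp: d)
    have a: "face_at b i j k \<in> arrows (Hom C w y) ?ik (Comp1 C w x y ?jk ?ij)"
      "face_at b j k l \<in> arrows (Hom C x z) ?jl (Comp1 C x y z ?kl ?jk)"
      "face_at b i j l \<in> arrows (Hom C w z) ?il (Comp1 C w x z ?jl ?ij)"
      "face_at b i k l \<in> arrows (Hom C w z) ?il (Comp1 C w y z ?kl ?ik)"
      using le b.a_in by (auto simp: d)
    note Iij = C.Ident_in[OF ob(1,2) f(1)] and Ikl = C.Ident_in[OF ob(3,4) f(3)]
    note FIij = D.Ident_in[OF Fob(1,2) mor_map_in[OF ob(1,2) f(1)]]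
      and FIkl = D.Ident_in[OF Fob(3,4) mor_map_in[OF ob(3,4) f(3)]]
    note c1 = C.Comp2_in[OF ob(1,2,4) Iij a(2)] and c2 = C.Comp2_in[OF ob(1,3,4) a(1) Ikl]
    let ?V = "Comp (Hom D (obj_map F w) (obj_map F z))"
    let ?L = "Comp2 D (obj_map F w) (obj_map F x) (obj_map F z)"
    let ?R = "Comp2 D (obj_map F w) (obj_map F y) (obj_map F z)"
    let ?Iij = "Ident (Hom D (obj_map F w) (obj_map F x)) (mor_map F w x ?ij)"
    let ?Ikl = "Ident (Hom D (obj_map F y) (obj_map F z)) (mor_map F y z ?kl)"
    have "?V (?L (Comp (Hom D (obj_map F x) (obj_map F z)) (eta F x y z ?jk ?kl) (cell_map F x z (face_at b j k l))) ?Iij)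
        (?V (eta F w x z ?ij ?jl) (cell_map F w z (face_at b i j l)))
      = ?V (?V (?L (eta F x y z ?jk ?kl) ?Iij) (?L (cell_map F x z (face_at b j k l)) (cell_map F w x (Ident (Hom C w x) ?ij))))
        (?V (eta F w x z ?ij ?jl) (cell_map F w z (face_at b i j l)))"
      using D.interchange[OF Fob(1,2,4) FIij FIij cell_map_in[OF ob(2,4) a(2)] eta_in[OF ob(2-4) f(2,3)]]
      by (simp add: D.Ident_Comp[OF Fob(1,2) FIij] cell_map_Ident ob f)
    \<comment> \<open>Naturality of \<open>eta\<close> with respect to
      \<open>face_at b j k l\<close> and the identity on the edge from \<open>i\<close> to
      \<open>j\<close>.\<close>
    also have "\<dots> = ?V (?V (?L (eta F x y z ?jk ?kl) ?Iij) (eta F w x z ?ij (Comp1 C x y z ?kl ?jk)))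
        (?V (cell_map F w z (Comp2 C w x z (face_at b j k l) (Ident (Hom C w x) ?ij))) (cell_map F w z (face_at b i j l)))"
    proof (rule D.vertical_exchange[OF Fob(1,4) cell_map_in[OF ob(1,4) a(3)] eta_in[OF ob(1,2,4) f(1,5)]
          D.Comp2_in[OF Fob(1,2,4) cell_map_in[OF ob(1,2) Iij] cell_map_in[OF ob(2,4) a(2)]]
          D.Comp2_in[OF Fob(1,2,4) FIij eta_in[OF ob(2-4) f(2,3)]]
          cell_map_in[OF ob(1,4) c1] eta_in[OF ob(1,2,4) f(1) C.Comp1_in[OF ob(2-4) f(2,3)]]])
      show "?V (?L (cell_map F x z (face_at b j k l)) (cell_map F w x (Ident (Hom C w x) ?ij))) (eta F w x z ?ij ?jl)
        = ?V (eta F w x z ?ij (Comp1 C x y z ?kl ?jk))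
          (cell_map F w z (Comp2 C w x z (face_at b j k l) (Ident (Hom C w x) ?ij)))"
        by (rule eta_natural[symmetric]) (use ob Iij a(2) in \<open>auto simp: arrows_iff\<close>)
    qed
    also have "\<dots> = ?V (?V (?L (eta F x y z ?jk ?kl) ?Iij) (eta F w x z ?ij (Comp1 C x y z ?kl ?jk)))
        (cell_map F w z (Comp (Hom C w z) (Comp2 C w x z (face_at b j k l) (Ident (Hom C w x) ?ij)) (face_at b i j l)))"
      by (simp add: cell_map_Comp[OF ob(1,4) a(3) c1])
    \<comment> \<open>Both coherence laws act here: \<open>eta_coherence\<close> on the outer factor
      and \<open>a_coherence\<close> inside \<open>cell_map\<close>.\<close>
    also have "\<dots> = ?V (?V (?R ?Ikl (eta F w x y ?ij ?jk)) (eta F w y z (Comp1 C w x y ?jk ?ij) ?kl))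
        (cell_map F w z (Comp (Hom C w z) (Comp2 C w y z (Ident (Hom C y z) ?kl) (face_at b i j k)) (face_at b i k l)))"
      using eta_coherence[OF ob f(1-3)] b.a_coherence[OF le] by (simp add: d)
    also have "\<dots> = ?V (?V (?R ?Ikl (eta F w x y ?ij ?jk)) (eta F w y z (Comp1 C w x y ?jk ?ij) ?kl))
        (?V (cell_map F w z (Comp2 C w y z (Ident (Hom C y z) ?kl) (face_at b i j k))) (cell_map F w z (face_at b i k l)))"
      by (simp add: cell_map_Comp[OF ob(1,4) a(4) c2])
    \<comment> \<open>The rearrangement is undone on the other side, by naturality for the identity
      on the edge from \<open>k\<close> to \<open>l\<close> and
      \<open>face_at b i j k\<close>.\<close>
    also have "\<dots> = ?V (?V (?R ?Ikl (eta F w x y ?ij ?jk)) (?R (cell_map F y z (Ident (Hom C y z) ?kl)) (cell_map F w y (face_at b i j k))))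
        (?V (eta F w y z ?ik ?kl) (cell_map F w z (face_at b i k l)))"
    proof (rule D.vertical_exchange[OF Fob(1,4) cell_map_in[OF ob(1,4) a(4)] cell_map_in[OF ob(1,4) c2]
          eta_in[OF ob(1,3,4) C.Comp1_in[OF ob(1-3) f(1,2)] f(3)]
          D.Comp2_in[OF Fob(1,3,4) eta_in[OF ob(1-3) f(1,2)] FIkl] eta_in[OF ob(1,3,4) f(4,3)]
          D.Comp2_in[OF Fob(1,3,4) cell_map_in[OF ob(1,3) a(1)] cell_map_in[OF ob(3,4) Ikl]], rotated])
      show "?V (eta F w y z (Comp1 C w x y ?jk ?ij) ?kl) (cell_map F w z (Comp2 C w y z (Ident (Hom C y z) ?kl) (face_at b i j k)))
        = ?V (?R (cell_map F y z (Ident (Hom C y z) ?kl)) (cell_map F w y (face_at b i j k))) (eta F w y z ?ik ?kl)"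
        by (rule eta_natural) (use ob Ikl a(1) in \<open>auto simp: arrows_iff\<close>)
    qed
    also have "\<dots> = ?V (?R ?Ikl (Comp (Hom D (obj_map F w) (obj_map F y)) (eta F w x y ?ij ?jk) (cell_map F w y (face_at b i j k))))
        (?V (eta F w y z ?ik ?kl) (cell_map F w z (face_at b i k l)))"
      using D.interchange[OF Fob(1,3,4) cell_map_in[OF ob(1,3) a(1)] eta_in[OF ob(1-3) f(1,2)] FIkl FIkl]
      by (simp add: D.Ident_Comp[OF Fob(3,4) FIkl] cell_map_Ident ob f)
    finally show "Comp (Hom D (image_obj b i) (image_obj b l))
        (Comp2 D (image_obj b i) (image_obj b j) (image_obj b l) (image_face b j k l)
          (Ident (Hom D (image_obj b i) (image_obj b j)) (image_edge b i j))) (image_face b i j l)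
      = Comp (Hom D (image_obj b i) (image_obj b l))
        (Comp2 D (image_obj b i) (image_obj b k) (image_obj b l)
          (Ident (Hom D (image_obj b k) (image_obj b l)) (image_edge b k l)) (image_face b i j k)) (image_face b i k l)"
      by (simp add: image_face_def image_edge_def image_obj_def d)
  qed
qed

definition simplicial :: "nat \<Rightarrow> ('o, 'm, 'c) simplex \<Rightarrow> ('o2, 'm2, 'c2) simplex" where
  "simplicial n = (\<lambda>b\<in>Simp (nerve C) n. simplex_data.simplex D n (image_obj b) (image_edge b) (image_face b))"

lemma simplicial:
  assumes b: "b \<in> Simp (nerve C) n"
  shows "simplicial n b \<in> Simp (nerve D) n"
    and "i \<le> n \<Longrightarrow> obj_map (simplicial n b) i = image_obj b i"
    and "\<lbrakk>i \<le> j; j \<le> n\<rbrakk> \<Longrightarrow> edge_at (simplicial n b) i j = image_edge b i j"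
    and "\<lbrakk>i \<le> j; j \<le> k; k \<le> n\<rbrakk> \<Longrightarrow> face_at (simplicial n b) i j k = image_face b i j k"
proof -
  interpret simplex_data D n "image_obj b" "image_edge b" "image_face b"
    by (rule simplex_data_pseudo_image[OF b])
  interpret groupoid_simplex_data D n "image_obj b" "image_edge b" "image_face b" ..
  show "simplicial n b \<in> Simp (nerve D) n"
    "i \<le> n \<Longrightarrow> obj_map (simplicial n b) i = image_obj b i"
    "\<lbrakk>i \<le> j; j \<le> n\<rbrakk> \<Longrightarrow> edge_at (simplicial n b) i j = image_edge b i j"
    "\<lbrakk>i \<le> j; j \<le> k; k \<le> n\<rbrakk> \<Longrightarrow> face_at (simplicial n b) i j k = image_face b i j k"
    using b strict_2_functor_simplex simplex_data_simps
    by (simp_all add: simplicial_def nerve_simps edge_at_def face_at_def)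
qed

text \<open>The image family at given indices depends only on the components of \<open>b\<close> at
  these indices, so it commutes with index substitution.\<close>

lemma simplicial_map_simplicial: "simplicial_map (nerve C) (nerve D) simplicial"
proof (intro simplicial_map.intro simplicial_set_nerve simplicial_map_axioms.intro)
  show "simplicial n \<in> Simp (nerve C) n \<rightarrow>\<^sub>E Simp (nerve D) n" for n
    using simplicial(1) by (auto simp: simplicial_def)
  fix \<alpha> m n b assume \<alpha>: "\<alpha> \<in> Delta_maps m n" and b: "b \<in> Simp (nerve C) n"
  from nerve_eqI[OF simplicial(1)[OF Op_in[OF \<alpha> b]] Op_in[OF \<alpha> simplicial(1)[OF b]]]
  show "simplicial m (Op (nerve C) m n \<alpha> b) = Op (nerve D) m n \<alpha> (simplicial n b)"
    using Delta_maps_le[OF \<alpha>]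
    by (simp add: simplicial(2-4)[OF Op_in[OF \<alpha> b]] simplicial(2-4)[OF b] Op_data
        image_obj_def image_edge_def image_face_def)
qed

lemma pseudofunctor_of_simplicial: "pseudofunctor_of C simplicial = F"
proof -
  interpret S: nerve_21_map C D simplicial
    by (intro nerve_21_map.intro simplicial_map_simplicial C.strict_21_category_axioms D.strict_21_category_axioms)
  \<comment> \<open>Supplies the \<open>undefined\<close> values outside the domains that equality
    of records requires.\<close>
  interpret S: normal_pseudofunctor C D "pseudofunctor_of C simplicial"
    by (rule S.normal_pseudofunctor_pseudofunctor_of)
  \<comment> \<open>This formula recovers both kinds of 2-morphism: for \<open>g\<close> a unit the
    factor \<open>eta\<close> is an identity and \<open>cell_map\<close> remains; for
    \<open>\<phi>\<close> an identity its image is an identity and \<open>eta\<close>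
    remains.\<close>
  have triangle: "S.F_triangle x y z f g h \<phi>
      = Comp (Hom D (obj_map F x) (obj_map F z)) (eta F x y z f g) (cell_map F x z \<phi>)"
    if "x \<in> Ob C" "y \<in> Ob C" "z \<in> Ob C" "f \<in> Obj (Hom C x y)" "g \<in> Obj (Hom C y z)"
      "\<phi> \<in> arrows (Hom C x z) h (Comp1 C x y z g f)" for x y z f g h \<phi>
    by (simp add: S.F_triangle_def simplicial[OF C.triangle_in[OF that]] image_face_def image_obj_def triangle_data)
  show ?thesis
  proof (rule oplax_map.equality)
    show "S.F0 = obj_map F"
    proof
      fix x show "S.F0 x = obj_map F x"
      proof (cases "x \<in> Ob C")
        case True
        then show ?thesis
          by (simp add: S.F_obj_map simplicial[OF C.vertex_in[OF True]] image_obj_def vertex_data)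
      qed (simp add: obj_map_undefined S.obj_map_undefined)
    qed
    show "S.F1 = mor_map F"
    proof (intro ext)
      fix x y f show "S.F1 x y f = mor_map F x y f"
      proof (cases "x \<in> Ob C \<and> y \<in> Ob C \<and> f \<in> Obj (Hom C x y)")
        case True
        then show ?thesis
          by (simp add: S.F_mor_map simplicial[OF C.edge_in, simplified] image_edge_def edge_data)
      next
        case False
        show ?thesis by (simp only: mor_map_undefined[OF False] S.mor_map_undefined[OF False])
      qed
    qed
    show "S.F2 = cell_map F"
    proof (intro ext)
      fix x y \<phi> show "S.F2 x y \<phi> = cell_map F x y \<phi>"
      proof (cases "x \<in> Ob C \<and> y \<in> Ob C \<and> \<phi> \<in> Arr (Hom C x y)")
        case True
        then have ob: "x \<in> Ob C" "y \<in> Ob C"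
          and \<phi>: "\<phi> \<in> arrows (Hom C x y) (Dom (Hom C x y) \<phi>) (Cod (Hom C x y) \<phi>)" by (simp_all add: arrows_iff)
        note g = C.Hom_arrows_Obj(2)[OF ob \<phi>]
        show ?thesis
          unfolding S.F_cell_map[OF ob \<phi>]
          by (subst triangle)
            (use ob \<phi> g C.Unit_Obj D.Ident_Comp[OF obj_map_Ob[OF ob(1)] obj_map_Ob[OF ob(2)] cell_map_in[OF ob \<phi>]]
              in \<open>simp_all add: C.Comp1_Unit_left eta_Unit_right\<close>)
      next
        case False
        show ?thesis by (simp only: cell_map_undefined[OF False] S.cell_map_undefined[OF False])
      qed
    qed
    show "S.\<eta> = eta F"
    proof (intro ext)
      fix x y z f g show "S.\<eta> x y z f g = eta F x y z f g"
      proof (cases "x \<in> Ob C \<and> y \<in> Ob C \<and> z \<in> Ob C \<and> f \<in> Obj (Hom C x y) \<and> g \<in> Obj (Hom C y z)")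
        case True
        then have A: "x \<in> Ob C" "y \<in> Ob C" "z \<in> Ob C" "f \<in> Obj (Hom C x y)" "g \<in> Obj (Hom C y z)" by simp_all
        note gf = C.Comp1_in[OF A]
        show ?thesis
          using D.Comp_Ident[OF obj_map_Ob[OF A(1)] obj_map_Ob[OF A(3)] eta_in[OF A]]
          by (simp add: S.F_eta[OF A] triangle[OF A C.Ident_in[OF A(1,3) gf]] cell_map_Ident[OF A(1,3) gf])
      next
        case False
        show ?thesis by (simp only: eta_undefined[OF False] S.eta_undefined[OF False])
      qed
    qed
  qed simp
qed

end

section \<open>Composition and strict 2-functors\<close>

lemma simplicial_map_comp:
  assumes "simplicial_map X Y \<sigma>" "simplicial_map Y Z \<tau>"
  shows "simplicial_map X Z (simplicial_map_comp X \<tau> \<sigma>)"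
proof -
  interpret \<sigma>: simplicial_map X Y \<sigma> by (rule assms)
  interpret \<tau>: simplicial_map Y Z \<tau> by (rule assms)
  show ?thesis
  proof
    show "simplicial_map_comp X \<tau> \<sigma> n \<in> Simp X n \<rightarrow>\<^sub>E Simp Z n" for n
      using \<sigma>.map_Simp[of n] \<tau>.map_Simp[of n] by (auto simp: simplicial_map_comp_def compose_def)
    show "simplicial_map_comp X \<tau> \<sigma> m (Op X m n \<alpha> a) = Op Z m n \<alpha> (simplicial_map_comp X \<tau> \<sigma> n a)"
      if "\<alpha> \<in> Delta_maps m n" "a \<in> Simp X n" for \<alpha> m n a
    proof -
      have "\<sigma> n a \<in> Simp Y n" using \<sigma>.map_Simp[of n] that by auto
      then show ?thesis
        using that \<sigma>.map_Op[OF that] \<tau>.map_Op[OF that(1)] \<sigma>.X.Op_Simp[OF that]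
        by (simp add: simplicial_map_comp_def compose_def)
    qed
  qed
qed

text \<open>The composite sends a triangle to the value of \<open>\<tau>\<close> on the image
  triangle under \<open>\<sigma>\<close>. For the triangle defining \<open>eta\<close> this image
  carries \<open>S.\<eta>\<close>, in general not an identity, and \<open>F_triangle_eq\<close> for
  \<open>\<tau>\<close> turns its value into \<open>T.\<eta>\<close> after the image of
  \<open>S.\<eta>\<close>, the formula in \<open>pseudofunctor_comp\<close>.\<close>

lemma pseudofunctor_of_comp:
  assumes C: "strict_21_category C" and D: "strict_21_category D" and E: "strict_21_category E"
    and \<sigma>: "simplicial_map (nerve C) (nerve D) \<sigma>" and \<tau>: "simplicial_map (nerve D) (nerve E) \<tau>"
  shows "pseudofunctor_of C (simplicial_map_comp (nerve C) \<tau> \<sigma>)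
    = pseudofunctor_comp C E (pseudofunctor_of D \<tau>) (pseudofunctor_of C \<sigma>)"
proof -
  let ?\<rho> = "simplicial_map_comp (nerve C) \<tau> \<sigma>"
  interpret S: nerve_21_map C D \<sigma> by (intro nerve_21_map.intro C D \<sigma>)
  interpret T: nerve_21_map D E \<tau> by (intro nerve_21_map.intro D E \<tau>)
  interpret R: nerve_21_map C E ?\<rho> by (intro nerve_21_map.intro C E simplicial_map_comp[OF \<sigma> \<tau>])
  interpret R: normal_pseudofunctor C E "pseudofunctor_of C ?\<rho>"
    by (rule R.normal_pseudofunctor_pseudofunctor_of)
  have \<rho>: "?\<rho> n b = \<tau> n (\<sigma> n b)" if "b \<in> Simp (nerve C) n" for n b
    using that by (simp add: simplicial_map_comp_def compose_def)
  have triangle: "R.F_triangle x y z f g h \<phi> = T.F_triangle (S.F0 x) (S.F0 y) (S.F0 z)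
      (S.F1 x y f) (S.F1 y z g) (S.F1 x z h) (S.F_triangle x y z f g h \<phi>)"
    if "x \<in> Ob C" "y \<in> Ob C" "z \<in> Ob C" "f \<in> Obj (Hom C x y)" "g \<in> Obj (Hom C y z)"
      "\<phi> \<in> arrows (Hom C x z) h (Comp1 C x y z g f)" for x y z f g h \<phi>
  proof -
    note t = S.C.triangle_in[OF that]
    show ?thesis
      by (simp add: R.F_triangle_def \<rho>[OF t] T.\<sigma>_data[OF S.\<sigma>_in[OF t]] S.\<sigma>_data[OF t] triangle_data)
  qed
  let ?P = "pseudofunctor_comp C E (pseudofunctor_of D \<tau>) (pseudofunctor_of C \<sigma>)"
  show ?thesis
  proof (rule oplax_map.equality)
    show "R.F0 = obj_map ?P"
    proof
      fix x show "R.F0 x = obj_map ?P x"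
      proof (cases "x \<in> Ob C")
        case True
        note v = S.C.vertex_in[OF True]
        show ?thesis using True
          by (simp add: R.F_obj_map \<rho>[OF v] T.\<sigma>_data[OF S.\<sigma>_in[OF v]] S.\<sigma>_data[OF v] vertex_data pseudofunctor_comp_def)
      qed (simp add: R.obj_map_undefined pseudofunctor_comp_def)
    qed
    show "R.F1 = mor_map ?P"
    proof (intro ext)
      fix x y f show "R.F1 x y f = mor_map ?P x y f"
      proof (cases "x \<in> Ob C \<and> y \<in> Ob C \<and> f \<in> Obj (Hom C x y)")
        case True
        then have e: "edge C x y f \<in> Simp (nerve C) (Suc 0)" using S.C.edge_in by simp
        show ?thesis using True
          by (simp add: R.F_mor_map \<rho>[OF e] T.\<sigma>_data[OF S.\<sigma>_in[OF e]] S.\<sigma>_data[OF e] edge_data pseudofunctor_comp_def)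
      next
        case False
        show ?thesis
          by (simp only: R.mor_map_undefined[OF False] if_not_P[OF False] pseudofunctor_comp_def two_map.select_convs)
      qed
    qed
    show "R.F2 = cell_map ?P"
    proof (intro ext)
      fix x y \<phi> show "R.F2 x y \<phi> = cell_map ?P x y \<phi>"
      proof (cases "x \<in> Ob C \<and> y \<in> Ob C \<and> \<phi> \<in> Arr (Hom C x y)")
        case True
        then have ob: "x \<in> Ob C" "y \<in> Ob C"
          and \<phi>: "\<phi> \<in> arrows (Hom C x y) (Dom (Hom C x y) \<phi>) (Cod (Hom C x y) \<phi>)" by (simp_all add: arrows_iff)
        note g = S.C.Hom_arrows_Obj(2)[OF ob \<phi>]
        \<comment> \<open>Since \<open>S.F1\<close> preserves units, the image under
          \<open>\<sigma>\<close> of a triangle that encodes a 2-morphism again encodes one.\<close>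
        have "R.F2 x y \<phi> = T.F2 (S.F0 x) (S.F0 y) (S.F2 x y \<phi>)"
          unfolding R.F_cell_map[OF ob \<phi>] T.F_cell_map[OF S.F0_in[OF ob(1)] S.F0_in[OF ob(2)] S.F2_in[OF ob \<phi>]]
          by (subst triangle) (use ob \<phi> g S.C.Unit_Obj in
              \<open>simp_all add: S.C.Comp1_Unit_left S.F1_Unit S.F_cell_map[OF ob \<phi>]\<close>)
        then show ?thesis using True by (simp add: pseudofunctor_comp_def)
      next
        case False
        show ?thesis
          by (simp only: R.cell_map_undefined[OF False] if_not_P[OF False] pseudofunctor_comp_def two_map.select_convs)
      qed
    qed
    show "R.\<eta> = eta ?P"
    proof (intro ext)
      fix x y z f g show "R.\<eta> x y z f g = eta ?P x y z f g"
      proof (cases "x \<in> Ob C \<and> y \<in> Ob C \<and> z \<in> Ob C \<and> f \<in> Obj (Hom C x y) \<and> g \<in> Obj (Hom C y z)")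
        case True
        then have A: "x \<in> Ob C" "y \<in> Ob C" "z \<in> Ob C" "f \<in> Obj (Hom C x y)" "g \<in> Obj (Hom C y z)" by simp_all
        note gf = S.C.Comp1_in[OF A]
        have "R.\<eta> x y z f g = Comp (Hom E (T.F0 (S.F0 x)) (T.F0 (S.F0 z)))
            (T.\<eta> (S.F0 x) (S.F0 y) (S.F0 z) (S.F1 x y f) (S.F1 y z g)) (T.F2 (S.F0 x) (S.F0 z) (S.\<eta> x y z f g))"
          unfolding R.F_eta[OF A] triangle[OF A S.C.Ident_in[OF A(1,3) gf]] S.F_eta[OF A, symmetric]
          by (rule T.F_triangle_eq[OF A(1-3)[THEN S.F0_in] S.F1_in[OF A(1,2,4)] S.F1_in[OF A(2,3,5)] S.eta_in[OF A]])
        then show ?thesis using A by (simp add: pseudofunctor_comp_def)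
      next
        case False
        show ?thesis
          by (simp only: R.eta_undefined[OF False] if_not_P[OF False] pseudofunctor_comp_def oplax_map.select_convs)
      qed
    qed
  qed simp
qed

lemma two_map_comp_data:
  "i \<le> n \<Longrightarrow> obj_map (two_map_comp (C2 n) G b) i = obj_map G (obj_map b i)"
  "\<lbrakk>i \<le> j; j \<le> n\<rbrakk> \<Longrightarrow> edge_at (two_map_comp (C2 n) G b) i j
    = mor_map G (obj_map b i) (obj_map b j) (edge_at b i j)"
  "\<lbrakk>i \<le> j; j \<le> k; k \<le> n\<rbrakk> \<Longrightarrow> face_at (two_map_comp (C2 n) G b) i j k
    = cell_map G (obj_map b i) (obj_map b k) (face_at b i j k)"
  by (simp_all add: two_map_comp_C2 edge_at_def face_at_def P_pair P_triple subset_insertI2)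

text \<open>In components an operator substitutes indices while \<open>G\<close> acts on values, so
  the two commute.\<close>

lemma simplicial_map_nerve_map:
  assumes G: "strict_2_functor C D G"
  shows "simplicial_map (nerve C) (nerve D) (nerve_map C G)"
proof (intro simplicial_map.intro simplicial_set_nerve simplicial_map_axioms.intro)
  have G_in: "two_map_comp (C2 n) G b \<in> Simp (nerve D) n" if "b \<in> Simp (nerve C) n" for n b
    using that strict_2_functor_postcomp[OF _ G] by (simp add: nerve_simps)
  then show "nerve_map C G n \<in> Simp (nerve C) n \<rightarrow>\<^sub>E Simp (nerve D) n" for n
    by (auto simp: nerve_map_def)
  fix \<alpha> m n b assume \<alpha>: "\<alpha> \<in> Delta_maps m n" and b: "b \<in> Simp (nerve C) n"
  from nerve_eqI[OF G_in[OF Op_in[OF \<alpha> b]] Op_in[OF \<alpha> G_in[OF b]]]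
  have "two_map_comp (C2 m) G (Op (nerve C) m n \<alpha> b) = Op (nerve D) m n \<alpha> (two_map_comp (C2 n) G b)"
    using Delta_maps_le[OF \<alpha>] by (simp add: Op_data two_map_comp_data)
  then show "nerve_map C G m (Op (nerve C) m n \<alpha> b) = Op (nerve D) m n \<alpha> (nerve_map C G n b)"
    using b Op_in[OF \<alpha> b] by (simp add: nerve_map_def)
qed

text \<open>A nerve map sends the 2-morphism of a triangle to its image under \<open>G\<close>
  alone, as \<open>G\<close> preserves composites strictly. Identity triangles therefore have
  identity images, and \<open>eta\<close> is trivial.\<close>

lemma pseudofunctor_of_nerve_map:
  assumes C: "strict_21_category C" and D: "strict_21_category D" and G: "strict_2_functor C D G"
  shows "pseudofunctor_of C (nerve_map C G) = strict_as_pseudofunctor C D G"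
proof -
  interpret G: strict_2_functor C D G by (rule G)
  interpret R: nerve_21_map C D "nerve_map C G"
    by (intro nerve_21_map.intro C D simplicial_map_nerve_map G)
  interpret R: normal_pseudofunctor C D "pseudofunctor_of C (nerve_map C G)"
    by (rule R.normal_pseudofunctor_pseudofunctor_of)
  have nerve_map: "nerve_map C G n b = two_map_comp (C2 n) G b" if "b \<in> Simp (nerve C) n" for n b
    using that by (simp add: nerve_map_def)
  have triangle: "R.F_triangle x y z f g h \<phi> = cell_map G x z \<phi>"
    if "x \<in> Ob C" "y \<in> Ob C" "z \<in> Ob C" "f \<in> Obj (Hom C x y)" "g \<in> Obj (Hom C y z)"
      "\<phi> \<in> arrows (Hom C x z) h (Comp1 C x y z g f)" for x y z f g h \<phi>
    using R.C.triangle_in[OF that] by (simp add: R.F_triangle_def nerve_map two_map_comp_data triangle_data)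
  let ?P = "strict_as_pseudofunctor C D G"
  show ?thesis
  proof (rule oplax_map.equality)
    show "R.F0 = obj_map ?P"
    proof
      fix x show "R.F0 x = obj_map ?P x"
        using R.C.vertex_in[of x]
        by (cases "x \<in> Ob C") (simp_all add: R.F_obj_map nerve_map two_map_comp_data vertex_data
            strict_as_pseudofunctor_def R.obj_map_undefined G.obj_map_undefined)
    qed
    show "R.F1 = mor_map ?P"
    proof (intro ext)
      fix x y f show "R.F1 x y f = mor_map ?P x y f"
      proof (cases "x \<in> Ob C \<and> y \<in> Ob C \<and> f \<in> Obj (Hom C x y)")
        case True
        then have e: "edge C x y f \<in> Simp (nerve C) (Suc 0)" using R.C.edge_in by simp
        then show ?thesis using True
          by (simp add: R.F_mor_map nerve_map two_map_comp_data edge_data strict_as_pseudofunctor_def)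
      next
        case False
        show ?thesis
          by (simp only: R.mor_map_undefined[OF False] if_not_P[OF False] strict_as_pseudofunctor_def two_map.select_convs G.mor_map_undefined[OF False])
      qed
    qed
    show "R.F2 = cell_map ?P"
    proof (intro ext)
      fix x y \<phi> show "R.F2 x y \<phi> = cell_map ?P x y \<phi>"
      proof (cases "x \<in> Ob C \<and> y \<in> Ob C \<and> \<phi> \<in> Arr (Hom C x y)")
        case True
        then have ob: "x \<in> Ob C" "y \<in> Ob C"
          and \<phi>: "\<phi> \<in> arrows (Hom C x y) (Dom (Hom C x y) \<phi>) (Cod (Hom C x y) \<phi>)" by (simp_all add: arrows_iff)
        show ?thesis
          unfolding R.F_cell_map[OF ob \<phi>]
          by (subst triangle) (use ob \<phi> R.C.Hom_arrows_Obj(2)[OF ob \<phi>] R.C.Unit_Obj in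
              \<open>simp_all add: R.C.Comp1_Unit_left strict_as_pseudofunctor_def\<close>)
      next
        case False
        show ?thesis
          by (simp only: R.cell_map_undefined[OF False] if_not_P[OF False] strict_as_pseudofunctor_def two_map.select_convs G.cell_map_undefined[OF False])
      qed
    qed
    show "R.\<eta> = eta ?P"
    proof (intro ext)
      fix x y z f g show "R.\<eta> x y z f g = eta ?P x y z f g"
      proof (cases "x \<in> Ob C \<and> y \<in> Ob C \<and> z \<in> Ob C \<and> f \<in> Obj (Hom C x y) \<and> g \<in> Obj (Hom C y z)")
        case True
        then have A: "x \<in> Ob C" "y \<in> Ob C" "z \<in> Ob C" "f \<in> Obj (Hom C x y)" "g \<in> Obj (Hom C y z)" by simp_all
        note gf = R.C.Comp1_in[OF A]
        show ?thesis using A is_functor.map_Ident[OF G.hom_functor[OF A(1,3)] gf]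
          by (simp add: R.F_eta[OF A] triangle[OF A R.C.Ident_in[OF A(1,3) gf]] strict_as_pseudofunctor_def)
      next
        case False
        show ?thesis
          by (simp only: R.eta_undefined[OF False] if_not_P[OF False] strict_as_pseudofunctor_def oplax_map.select_convs)
      qed
    qed
  qed simp
qed

text \<open>The second and third conjuncts make the bijection natural: taking one of the two
  simplicial maps in the composition formula to be the nerve of a strict 2-functor gives
  compatibility with pre- and postcomposition by strict 2-functors.\<close>

theorem corollaryA21:
  fixes C :: "('o, 'm, 'c) two_category" and D :: "('o2, 'm2, 'c2) two_category"
  assumes C: "strict_21_category C" and D: "strict_21_category D"
  shows "bij_betw (pseudofunctor_of C)
      {\<sigma>. simplicial_map (nerve C) (nerve D) \<sigma>} {F. normal_pseudofunctor C D F}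
    \<and> (\<forall>(E :: ('o3, 'm3, 'c3) two_category) \<sigma> \<tau>. strict_21_category E \<longrightarrow>
        simplicial_map (nerve C) (nerve D) \<sigma> \<longrightarrow> simplicial_map (nerve D) (nerve E) \<tau> \<longrightarrow>
        pseudofunctor_of C (simplicial_map_comp (nerve C) \<tau> \<sigma>)
          = pseudofunctor_comp C E (pseudofunctor_of D \<tau>) (pseudofunctor_of C \<sigma>))
    \<and> (\<forall>G. strict_2_functor C D G \<longrightarrow>
        simplicial_map (nerve C) (nerve D) (nerve_map C G) \<and>
        pseudofunctor_of C (nerve_map C G) = strict_as_pseudofunctor C D G)"
proof (intro conjI)
  show "bij_betw (pseudofunctor_of C)
      {\<sigma>. simplicial_map (nerve C) (nerve D) \<sigma>} {F. normal_pseudofunctor C D F}"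
  proof (intro bij_betw_imageI inj_onI set_eqI iffI)
    fix \<sigma> \<tau> assume "\<sigma> \<in> {\<sigma>. simplicial_map (nerve C) (nerve D) \<sigma>}"
      "\<tau> \<in> {\<sigma>. simplicial_map (nerve C) (nerve D) \<sigma>}" "pseudofunctor_of C \<sigma> = pseudofunctor_of C \<tau>"
    then show "\<sigma> = \<tau>"
      using C D by (intro pseudofunctor_of_inj[of C D] nerve_21_map.intro) auto
  next
    fix F assume "F \<in> pseudofunctor_of C ` {\<sigma>. simplicial_map (nerve C) (nerve D) \<sigma>}"
    then show "F \<in> {F. normal_pseudofunctor C D F}"
      using C D nerve_21_map.normal_pseudofunctor_pseudofunctor_of nerve_21_map.intro by blast
  next
    fix F assume "F \<in> {F. normal_pseudofunctor C D F}"
    then interpret normal_pseudofunctor_21 C D F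
      using C D by (simp add: normal_pseudofunctor_21.intro)
    show "F \<in> pseudofunctor_of C ` {\<sigma>. simplicial_map (nerve C) (nerve D) \<sigma>}"
      using pseudofunctor_of_simplicial simplicial_map_simplicial by (metis image_eqI mem_Collect_eq)
  qed
qed (use pseudofunctor_of_comp[OF C D] simplicial_map_nerve_map pseudofunctor_of_nerve_map[OF C D] in auto)

end
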